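(* Consider the precoded MIMO system with zero-forcing detection described in the context, using $M$-ary PAM, PSK or square QAM signals. Let the eigenvalue decomposition of $\mathbf\Sigma$ be $\mathbf\Sigma=\mathbf W\mathbf\Lambda\mathbf W^H$, where $\mathbf W$ is unitary and $\mathbf\Lambda=\mathrm{diag}(\lambda_1,\dots,\lambda_{N_t})$ with $\lambda_1\le\lambda_2\le\cdots\le\lambda_{N_t}$. Suppose the precoder $\mathbf F$, subject to the power constraint $\mathrm{tr}(\mathbf F^H\mathbf F)=1$, is restricted to the set $\big\{\mathbf F:\zeta_1(\mathbf F^H\mathbf F)\ge\frac1{\lambda_1T}\big\}$, where $\zeta_1(\mathbf F^H\mathbf F)$ is the minimum eigenvalue of $\mathbf F^H\mathbf F$ and $T$ is the threshold defined in the context. Then the optimal precoder minimizing the average SEP is given by $$\widetilde{\mathbf F}=\frac1{\sqrt{\mathrm{tr}(\mathbf\Lambda^{-1/2})}}\,\mathbf W\mathbf\Lambda^{-1/4}\widetilde{\mathbf V}_2,$$ where $\widetilde{\mathbf V}_2$ is the $N_t\times N_t$ normalized DFT matrix (that is, $\mathrm P(\mathbf F)\ge\mathrm P(\widetilde{\mathbf F})$ for every such $\mathbf F$), and the resulting minimum average SEP is $$\mathrm P_{\min}(\widetilde{\mathbf F})=\mathrm P(\widetilde{\mathbf F})=G\left(\frac{\big(\sum_{k=1}^{N_t}\lambda_k^{-1/2}\big)^2}{N_t}\right).$$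
   Context: System model. Let $N_r>N_t\ge1$. The received vector is $\mathbf r=\mathbf H\mathbf F\mathbf s+\boldsymbol\xi\in\mathbb C^{N_r}$, where: $\mathbf H$ is an $N_r\times N_t$ random matrix whose rows $\mathbf h_1^T,\dots,\mathbf h_{N_r}^T$ are i.i.d. zero-mean circularly-symmetric complex Gaussian with $\mathbb E[(\mathbf h_m^T)^H\mathbf h_m^T]=\mathbf\Sigma$, a Hermitian positive definite $N_t\times N_t$ matrix; $\mathbf F$ is an $N_t\times N_t$ nonsingular deterministic precoding matrix; $\boldsymbol\xi$ is circularly-symmetric complex Gaussian noise with covariance $\sigma^2\mathbf I$; $\mathbf s=[s_1,\dots,s_{N_t}]^T$ has i.i.d. entries, each uniform on a constellation $\mathcal S\subset\mathbb C$ of size $M$ with unit average energy; $\mathbf H,\mathbf s,\boldsymbol\xi$ are independent. The system SNR is $\eta=1/\sigma^2$. The total transmit power budget is one. Constellations. $M$-PAM ($M\ge2$): $\{\delta(2i-1-M):i=1,\dots,M\}\subset\mathbb R$ with $\delta=\sqrt{3/(M^2-1)}$. $M$-PSK ($M\ge2$): $\{e^{2\pi j i/M}:i=0,\dots,M-1\}$ (with $j=\sqrt{-1}$). Square $M$-QAM ($\sqrt M\ge 2$ an integer): $\{a+jb\}$ with $a,b$ ranging over $\{\delta(2i-1-\sqrt M):i=1,\dots,\sqrt M\}$, $\delta=\sqrt{3/(2(M-1))}$. Zero-forcing detection. With $(\mathbf H\mathbf F)^+=(\mathbf F^H\mathbf H^H\mathbf H\mathbf F)^{-1}\mathbf F^H\mathbf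 H^H$, the receiver forms $\mathbf r'=(\mathbf H\mathbf F)^+\mathbf r$ and decides $\hat s_k=\arg\min_{s\in\mathcal S}|r'_k-s|^2$ for each $k$. Average SEP. $\mathrm P(\mathbf F)=\frac1{N_t}\sum_{k=1}^{N_t}\Pr(\hat s_k\ne s_k)$, the probability being over $\mathbf H$, $\mathbf s$ and $\boldsymbol\xi$. Functions $G$ and thresholds $T$, according to the modulation, for $x>0$: PAM: $G(x)=\frac{2(M-1)}{M\pi}\int_0^{\pi/2}\big(1+\frac{3\eta}{(M^2-1)x\sin^2\theta}\big)^{-(N_r-N_t+1)}d\theta$, $T=\frac{3\eta(N_r-N_t)}{2(M^2-1)}$. PSK: $G(x)=\frac1\pi\int_0^{(M-1)\pi/M}\big(1+\frac{\eta\sin^2(\pi/M)}{x\sin^2\theta}\big)^{-(N_r-N_t+1)}d\theta$, $T=\frac{\eta(N_r-N_t)\sin^2(\pi/M)}{2}$. QAM: $G(x)=\frac{4(\sqrt M-1)}{\sqrt M\pi}\int_{\pi/4}^{\pi/2}\big(1+\frac{3\eta}{2(M-1)x\sin^2\theta}\big)^{-(N_r-N_t+1)}d\theta+\frac{4(\sqrt M-1)}{M\pi}\int_0^{\pi/4}\big(1+\frac{3\eta}{2(M-1)x\sin^2\theta}\big)^{-(N_r-N_t+1)}d\theta$, $T=\frac{3\eta(N_r-N_t)}{4(M-1)}$. The normalized DFT matrix has $(m,n)$ entry $N_t^{-1/2}e^{-2\pi j(m-1)(n-1)/N_t}$. *)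

theory Defs
  imports "HOL-Probability.Probability"
begin

definition ctranspose :: "complex^'n^'m \<Rightarrow> complex^'m^'n"  ("(_\<^sup>H)" [1000] 999)
  where "A\<^sup>H = transpose (map_matrix cnj A)"

definition cinner :: "complex^'n \<Rightarrow> complex^'n \<Rightarrow> complex"
  where "cinner x y = (\<Sum>i\<in>UNIV. cnj (x $ i) * y $ i)"

definition hermitian_posdef :: "complex^'n^'n \<Rightarrow> bool"
  where "hermitian_posdef A \<longleftrightarrow> A\<^sup>H = A \<and> (\<forall>x. x \<noteq> 0 \<longrightarrow> Re (cinner x (A *v x)) > 0)"

definition unitary :: "complex^'n^'n \<Rightarrow> bool"
  where "unitary U \<longleftrightarrow> U\<^sup>H ** U = mat 1 \<and> U ** U\<^sup>H = mat 1"

definition diag :: "('n \<Rightarrow> 'a::zero) \<Rightarrow> 'a^'n^'n"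
  where "diag d = (\<chi> i k. if i = k then d i else 0)"

definition eigenvalue :: "complex^'n^'n \<Rightarrow> complex \<Rightarrow> bool"
  where "eigenvalue A c \<longleftrightarrow> (\<exists>v. v \<noteq> 0 \<and> A *v v = c *s v)"

text \<open>Meant for Hermitian matrices, whose eigenvalues are all real.\<close>

definition min_eigenvalue :: "complex^'n^'n \<Rightarrow> real"
  where "min_eigenvalue A = Min {x. eigenvalue A (complex_of_real x)}"

text \<open>
  Index types are finite linear orders, so that the \<open>i\<close>-th index in increasing order is well
  defined: \<open>card {..<i}\<close> is its zero-based position (\<open>m - 1\<close> for the \<open>m\<close>-th index).
\<close>

definition dft_matrix :: "complex^('n::{finite,linorder})^('n::{finite,linorder})"
  where "dft_matrix = (\<chi> m n. complex_of_real (1 / sqrt (real CARD('n))) *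
    exp (- 2 * complex_of_real pi * \<i> * of_nat (card {..<m}) * of_nat (card {..<n}) / of_nat CARD('n)))"

text \<open>
  Density of the zero-mean circularly-symmetric complex Gaussian law on \<open>complex^'n\<close> whose
  covariance matrix, in the convention \<open>E[z z\<^sup>H]\<close>, is \<open>C\<close>.  The reference measure is Lebesgue
  measure on the underlying real space of dimension \<open>2 * CARD('n)\<close>.
\<close>

definition circ_gaussian_density :: "complex^'n^'n \<Rightarrow> complex^'n \<Rightarrow> real"
  where "circ_gaussian_density C z =
    exp (- Re (cinner z (matrix_inv C *v z))) / (pi ^ CARD('n) * Re (det C))"

text \<open>
  Only nondegenerate laws are covered, which is all that is needed for positive definite
  covariances.
\<close>

definition circ_gaussian :: "'w measure \<Rightarrow> ('w \<Rightarrow> complex^'n) \<Rightarrow> bool"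
  where "circ_gaussian \<Omega> X \<longleftrightarrow>
    (\<exists>C. hermitian_posdef C \<and> distributed \<Omega> lborel X (\<lambda>z. ennreal (circ_gaussian_density C z)))"

text \<open>
  Mutual independence of three random variables of different types, which \<^const>\<open>prob_space.indep_vars\<close>
  cannot express directly: independence of the generated \<open>\<sigma>\<close>-algebras.
\<close>

definition (in prob_space) indep_three ::
    "('a \<Rightarrow> 'b::topological_space) \<Rightarrow> ('a \<Rightarrow> 'c::topological_space) \<Rightarrow> ('a \<Rightarrow> 'd::topological_space) \<Rightarrow> bool"
  where "indep_three X Y Z \<longleftrightarrow>
    random_variable borel X \<and> random_variable borel Y \<and> random_variable borel Z \<and>
    indep_sets ((!) [{X -` A \<inter> space M | A. A \<in> sets borel},
                     {Y -` A \<inter> space M | A. A \<in> sets borel},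
                     {Z -` A \<inter> space M | A. A \<in> sets borel}]) {0, 1, 2}"

datatype modulation = PAM | PSK | QAM

fun valid_order :: "modulation \<Rightarrow> nat \<Rightarrow> bool"
  where
    "valid_order PAM M \<longleftrightarrow> M \<ge> 2"
  | "valid_order PSK M \<longleftrightarrow> M \<ge> 2"
  | "valid_order QAM M \<longleftrightarrow> (\<exists>r\<ge>2. M = r\<^sup>2)"

fun constellation :: "modulation \<Rightarrow> nat \<Rightarrow> complex set"
  where
    "constellation PAM M =
      (let \<delta> = sqrt (3 / ((real M)\<^sup>2 - 1))
       in {complex_of_real (\<delta> * (2 * real i - 1 - real M)) | i. 1 \<le> i \<and> i \<le> M})"
  | "constellation PSK M = {exp (2 * complex_of_real pi * \<i> * of_nat i / of_nat M) | i. i < M}"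
  | "constellation QAM M =
      (let \<delta> = sqrt (3 / (2 * (real M - 1)));
           L = {\<delta> * (2 * real i - 1 - sqrt (real M)) | i. 1 \<le> i \<and> real i \<le> sqrt (real M)}
       in {Complex a b | a b. a \<in> L \<and> b \<in> L})"

definition zf_inverse :: "complex^'n^'m \<Rightarrow> complex^'m^'n"
  where "zf_inverse A = matrix_inv (A\<^sup>H ** A) ** A\<^sup>H"

definition received ::
    "('w \<Rightarrow> complex^'n^'m) \<Rightarrow> ('w \<Rightarrow> complex^'n) \<Rightarrow> ('w \<Rightarrow> complex^'m) \<Rightarrow> complex^'n^'n \<Rightarrow> 'w \<Rightarrow> complex^'m"
  where "received H s \<xi> F \<omega> = (H \<omega> ** F) *v s \<omega> + \<xi> \<omega>"

definition zf_output ::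
    "('w \<Rightarrow> complex^'n^'m) \<Rightarrow> ('w \<Rightarrow> complex^'n) \<Rightarrow> ('w \<Rightarrow> complex^'m) \<Rightarrow> complex^'n^'n \<Rightarrow> 'w \<Rightarrow> complex^'n"
  where "zf_output H s \<xi> F \<omega> = zf_inverse (H \<omega> ** F) *v received H s \<xi> F \<omega>"

text \<open>
  Ties have probability zero; \<^const>\<open>arg_min_on\<close> resolves them by a choice that depends only on the
  set of nearest points, so the decision is a measurable function of \<open>z\<close>.
\<close>

definition decide :: "complex set \<Rightarrow> complex \<Rightarrow> complex"
  where "decide S z = arg_min_on (\<lambda>c. (cmod (z - c))\<^sup>2) S"

definition average_sep ::
    "'w measure \<Rightarrow> ('w \<Rightarrow> complex^'n^'m) \<Rightarrow> ('w \<Rightarrow> complex^'n) \<Rightarrow> ('w \<Rightarrow> complex^'m) \<Rightarrow>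
     complex set \<Rightarrow> complex^'n^'n \<Rightarrow> real"
  where "average_sep \<Omega> H s \<xi> S F = (1 / real CARD('n)) *
    (\<Sum>k\<in>UNIV. measure \<Omega> {\<omega> \<in> space \<Omega>. decide S (zf_output H s \<xi> F \<omega> $ k) \<noteq> s \<omega> $ k})"

text \<open>
  \<open>nr\<close> and \<open>nt\<close> are the numbers of receive and transmit antennas.  At \<open>\<theta> = 0\<close> the integrands take
  an irrelevant value (division by zero).
\<close>

definition G_kernel :: "nat \<Rightarrow> nat \<Rightarrow> real \<Rightarrow> real \<Rightarrow> real \<Rightarrow> real"
  where "G_kernel nr nt a x \<theta> =
    (1 + a / (x * (sin \<theta>)\<^sup>2)) powi (- (int nr - int nt + 1))"

fun G_fun :: "modulation \<Rightarrow> nat \<Rightarrow> nat \<Rightarrow> nat \<Rightarrow> real \<Rightarrow> real \<Rightarrow> real"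
  where
    "G_fun PAM M nr nt \<eta> x =
      2 * (real M - 1) / (real M * pi) *
        integral {0..pi/2} (G_kernel nr nt (3 * \<eta> / ((real M)\<^sup>2 - 1)) x)"
  | "G_fun PSK M nr nt \<eta> x =
      1 / pi *
        integral {0..(real M - 1) * pi / real M} (G_kernel nr nt (\<eta> * (sin (pi / real M))\<^sup>2) x)"
  | "G_fun QAM M nr nt \<eta> x =
      4 * (sqrt (real M) - 1) / (sqrt (real M) * pi) *
        integral {pi/4..pi/2} (G_kernel nr nt (3 * \<eta> / (2 * (real M - 1))) x)
    + 4 * (sqrt (real M) - 1) / (real M * pi) *
        integral {0..pi/4} (G_kernel nr nt (3 * \<eta> / (2 * (real M - 1))) x)"

fun T_threshold :: "modulation \<Rightarrow> nat \<Rightarrow> nat \<Rightarrow> nat \<Rightarrow> real \<Rightarrow> real"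
  where
    "T_threshold PAM M nr nt \<eta> = 3 * \<eta> * (real nr - real nt) / (2 * ((real M)\<^sup>2 - 1))"
  | "T_threshold PSK M nr nt \<eta> = \<eta> * (real nr - real nt) * (sin (pi / real M))\<^sup>2 / 2"
  | "T_threshold QAM M nr nt \<eta> = 3 * \<eta> * (real nr - real nt) / (4 * (real M - 1))"

definition opt_precoder :: 
    "complex^('n::{finite,linorder})^('n::{finite,linorder}) \<Rightarrow> ('n::{finite,linorder} \<Rightarrow> real) \<Rightarrow>
     complex^('n::{finite,linorder})^('n::{finite,linorder})"
  where "opt_precoder W lam =
    (1 / sqrt (trace (diag (\<lambda>k. lam k powr (-1/2))))) *\<^sub>R
      (W ** diag (\<lambda>k. complex_of_real (lam k powr (-1/4))) ** dft_matrix)"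

end

theory Submission
  imports Defs
begin

text \<open>Write \<open>x\<^sub>k\<close> for the \<open>k\<close>-th diagonal entry of \<open>(F\<^sup>H \<Sigma> F)\<^sup>-\<^sup>1\<close>. After whitening the rows of
  the channel, the \<open>k\<close>-th zero-forcing output is \<open>s\<^sub>k\<close> plus \<open>\<surd>x\<^sub>k\<close> times Gaussian noise divided by
  the distance \<open>d\<close> of the \<open>k\<close>-th column of a standard Gaussian matrix to the span of the others;
  \<open>d\<^sup>2\<close> is a sum of \<open>N\<^sub>r - N\<^sub>t + 1\<close> exponential variables, independent of the noise. For fixed \<open>d\<close>
  Craig's formula writes the error probability as an integral over \<open>\<theta>\<close> of
  \<open>exp (- g d\<^sup>2 / (x\<^sub>k sin\<^sup>2 \<theta>))\<close>, so averaging over \<open>d\<close> gives \<open>G x\<^sub>k\<close>.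

  The integrand of \<open>G\<close> is convex and increasing on \<open>(0, T]\<close>, and the restriction on \<open>F\<close> forces
  \<open>x\<^sub>k \<le> T\<close>. Jensen's inequality at the mean of the \<open>x\<^sub>k\<close> and the Cauchy--Schwarz bound
  \<open>\<Sum> x\<^sub>k \<ge> (tr \<Sigma>\<^sup>-\<^sup>1\<^sup>/\<^sup>2)\<^sup>2\<close> give the lower bound. The proposed precoder attains it because the
  entries of the DFT matrix have constant modulus, which makes all \<open>x\<^sub>k\<close> equal.\<close>

subsection \<open>The standard Gaussian measure\<close>

text \<open>The threshold \<open>T\<close> is an inflection point. With t = g \<eta> / sin^2
  \<theta>, where g is the modulation constant in \<open>G\<close>, the integrand is (x / (x + t))^d
  for d = N_r - N_t + 1. It is convex for 0 < x \<le> t (d - 1) / 2, and the smallest of these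
  bounds, reached at sin \<theta> = 1, is \<open>T\<close>. The two factors of the optimal precoder
  answer the two inequalities. Equality in Cauchy--Schwarz only asks that F F^H be proportional to
  \<Sigma>^(-1/2), which leaves a unitary right factor free. That factor decides how the total noise
  is shared among the outputs, and equality in Jensen asks for equal shares. The obstacle is that
  the pseudo-inverse is nonlinear in the channel while the Gaussian laws are given only by
  densities. Hence all randomness is reduced to one family of measures, \<open>std_gaussian\<close>
  on arbitrary Euclidean spaces, preserved by every coisometry: coordinate changes, rotations,
  projections and the replacement of a column are instances of this one fact. Averages are taken as
  nonnegative integrals, so that their order can be exchanged without integrability
  conditions.\<close>

lemma nn_integral_lborel_translate:
  fixes f :: "'a::euclidean_space \<Rightarrow> ennreal"
  assumes [measurable]: "f \<in> borel_measurable borel"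
  shows "(\<integral>\<^sup>+x. f (a + x) \<partial>lborel) = (\<integral>\<^sup>+x. f x \<partial>lborel)"
proof -
  have "(\<integral>\<^sup>+x. f x \<partial>lborel) = (\<integral>\<^sup>+x. f x \<partial>(distr lborel borel ((+) a)))"
    by (simp add: lborel_distr_plus)
  also have "\<dots> = (\<integral>\<^sup>+x. f (a + x) \<partial>lborel)"
    by (subst nn_integral_distr) auto
  finally show ?thesis ..
qed

lemma nn_integral_lborel_reflect:
  fixes f :: "'a::euclidean_space \<Rightarrow> ennreal"
  assumes [measurable]: "f \<in> borel_measurable borel"
  shows "(\<integral>\<^sup>+x. f (a - x) \<partial>lborel) = (\<integral>\<^sup>+x. f x \<partial>lborel)"
proof -
  have "(\<integral>\<^sup>+x. f x \<partial>lborel) =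
      (\<integral>\<^sup>+x. f (a + (\<Sum>j\<in>Basis. (-1 * (x \<bullet> j)) *\<^sub>R j)) \<partial>(lborel :: 'a measure))"
    by (subst lborel_affine_euclidean[where t = a and c = "\<lambda>_. -1"])
       (auto simp: nn_integral_density nn_integral_distr)
  also have "\<dots> = (\<integral>\<^sup>+x. f (a - x) \<partial>lborel)"
    by (simp add: sum_negf euclidean_representation)
  finally show ?thesis ..
qed

text \<open>Uniqueness of Haar measure up to a constant, which spares all Jacobian determinants:
  the constants are recovered from the total mass of a probability density.\<close>

lemma nn_integral_linear_cross:
  fixes f :: "'a::euclidean_space \<Rightarrow> 'b::euclidean_space"
  assumes lin: "linear f" and bij: "bij f"
    and [measurable]: "g \<in> borel_measurable borel" "h \<in> borel_measurable borel"
  shows "(\<integral>\<^sup>+x. g (f x) \<partial>lborel) * (\<integral>\<^sup>+y. h y \<partial>lborel) =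
    (\<integral>\<^sup>+x. h (f x) \<partial>lborel) * (\<integral>\<^sup>+y. g y \<partial>lborel)"
proof -
  have [measurable]: "f \<in> borel_measurable borel"
    using lin by (intro borel_measurable_continuous_onI) (simp add: linear_continuous_on linear_conv_bounded_linear)
  obtain k where k: "\<And>y. f (k y) = y"
    using bij by (metis bij_pointE)
  have "(\<integral>\<^sup>+x. g (f x) \<partial>lborel) * (\<integral>\<^sup>+y. h y \<partial>lborel)
      = (\<integral>\<^sup>+x. g (f x) * (\<integral>\<^sup>+y. h (f x + y) \<partial>lborel) \<partial>lborel)"
    by (subst nn_integral_lborel_translate) (auto simp: nn_integral_multc)
  also have "\<dots> = (\<integral>\<^sup>+x. (\<integral>\<^sup>+y. g (f x) * h (f x + y) \<partial>lborel) \<partial>lborel)"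
    by (intro nn_integral_cong) (simp add: nn_integral_cmult)
  also have "\<dots> = (\<integral>\<^sup>+y. (\<integral>\<^sup>+x. g (f x) * h (f x + y) \<partial>lborel) \<partial>lborel)"
    by (rule lborel_pair.Fubini') measurable
  \<comment> \<open>Translating x by a preimage of y shifts \<open>f x\<close> by y, which moves y
    from the argument of \<open>h\<close> to that of \<open>g\<close>. Integrating over y first then
    separates the two factors.\<close>
  also have "\<dots> = (\<integral>\<^sup>+y. (\<integral>\<^sup>+x. g (f x - y) * h (f x) \<partial>lborel) \<partial>lborel)"
  proof (rule nn_integral_cong)
    fix y
    show "(\<integral>\<^sup>+x. g (f x) * h (f x + y) \<partial>lborel) = (\<integral>\<^sup>+x. g (f x - y) * h (f x) \<partial>lborel)"
      using nn_integral_lborel_translate[of "\<lambda>x. g (f x - y) * h (f x)" "k y"] lin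
      by (simp add: linear_add k add.commute)
  qed
  also have "\<dots> = (\<integral>\<^sup>+x. (\<integral>\<^sup>+y. g (f x - y) * h (f x) \<partial>lborel) \<partial>lborel)"
    by (rule lborel_pair.Fubini'[symmetric]) measurable
  also have "\<dots> = (\<integral>\<^sup>+x. (\<integral>\<^sup>+y. g y \<partial>lborel) * h (f x) \<partial>lborel)"
    by (subst nn_integral_multc) (auto simp: nn_integral_lborel_reflect)
  also have "\<dots> = (\<integral>\<^sup>+x. h (f x) \<partial>lborel) * (\<integral>\<^sup>+y. g y \<partial>lborel)"
    by (simp add: nn_integral_cmult mult.commute)
  finally show ?thesis .
qed

text \<open>Variance \<open>1/2\<close> per real coordinate, hence unit variance on the complex numbers.\<close>

definition std_gaussian :: "'a::euclidean_space measure"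
  where "std_gaussian = density lborel (\<lambda>x. ennreal (exp (- (norm x)\<^sup>2) / sqrt pi ^ DIM('a)))"

lemma space_std_gaussian[simp]: "space std_gaussian = UNIV"
  and sets_std_gaussian[simp, measurable_cong]: "sets std_gaussian = sets borel"
  by (simp_all add: std_gaussian_def)

lemma nn_integral_exp_minus_sq:
  assumes "a > 0"
  shows "(\<integral>\<^sup>+t. ennreal (exp (- (a * t\<^sup>2))) \<partial>lborel) = ennreal (sqrt (pi / a))"
proof -
  \<comment> \<open>The standard deviation for which the normal density is proportional to exp (- a
    t^2).\<close>
  let ?s = "1 / sqrt (2 * a)"
  have s: "?s > 0" using assms by simp
  have s2: "?s\<^sup>2 = 1 / (2 * a)"
    using assms by (simp add: power_divide)
  have "(\<integral>\<^sup>+t. ennreal (normal_density 0 ?s t) \<partial>lborel) = 1"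
    using prob_space.emeasure_space_1[OF prob_space_normal_density[OF s, of 0]]
    by (simp add: emeasure_density)
  moreover have "normal_density 0 ?s t = sqrt (a / pi) * exp (- (a * t\<^sup>2))" for t
    unfolding normal_density_def s2 using assms by (simp add: real_sqrt_divide field_simps)
  ultimately have "ennreal (sqrt (a / pi)) * (\<integral>\<^sup>+t. ennreal (exp (- (a * t\<^sup>2))) \<partial>lborel) = 1"
    using assms by (simp add: ennreal_mult' nn_integral_cmult)
  then have "ennreal (sqrt (pi / a)) * (ennreal (sqrt (a / pi)) *
     (\<integral>\<^sup>+t. ennreal (exp (- (a * t\<^sup>2))) \<partial>lborel)) = ennreal (sqrt (pi / a))"
    by simp
  moreover have "ennreal (sqrt (pi / a)) * ennreal (sqrt (a / pi)) = 1"
    using assms by (simp add: ennreal_mult'[symmetric] real_sqrt_mult[symmetric])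
  ultimately show ?thesis
    by (simp add: mult.assoc[symmetric])
qed

lemma nn_integral_exp_minus_sum_sq:
  fixes a :: "'a::euclidean_space \<Rightarrow> real"
  assumes "\<And>b. b \<in> Basis \<Longrightarrow> a b > 0"
  shows "(\<integral>\<^sup>+x. ennreal (exp (- (\<Sum>b\<in>Basis. a b * (x \<bullet> b)\<^sup>2))) \<partial>(lborel :: 'a measure)) =
    ennreal (\<Prod>b\<in>Basis. sqrt (pi / a b))"
proof -
  have "(\<integral>\<^sup>+x. ennreal (exp (- (\<Sum>b\<in>Basis. a b * (x \<bullet> b)\<^sup>2))) \<partial>(lborel :: 'a measure)) =
    (\<integral>\<^sup>+x. (\<Prod>b\<in>Basis. ennreal (exp (- (a b * (x \<bullet> b)\<^sup>2)))) \<partial>lborel)"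
    by (simp add: prod_ennreal exp_sum sum_negf[symmetric])
  also have "\<dots> = (\<Prod>b\<in>Basis. (\<integral>\<^sup>+t. ennreal (exp (- (a b * t\<^sup>2))) \<partial>lborel))"
    by (subst nn_integral_lborel_prod) auto
  also have "\<dots> = (\<Prod>b\<in>Basis. ennreal (sqrt (pi / a b)))"
    using assms by (intro prod.cong nn_integral_exp_minus_sq) auto
  also have "\<dots> = ennreal (\<Prod>b\<in>Basis. sqrt (pi / a b))"
    using assms by (subst prod_ennreal) (auto simp: less_imp_le)
  finally show ?thesis .
qed

lemma norm_sq_Basis: "(norm (x::'a::euclidean_space))\<^sup>2 = (\<Sum>b\<in>Basis. (x \<bullet> b)\<^sup>2)"
  unfolding power2_norm_eq_inner by (subst euclidean_inner) (simp add: power2_eq_square)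

lemma nn_integral_exp_minus_norm_sq:
  "(\<integral>\<^sup>+x. ennreal (exp (- (norm x)\<^sup>2)) \<partial>(lborel :: 'a::euclidean_space measure)) =
    ennreal (sqrt pi ^ DIM('a))"
  using nn_integral_exp_minus_sum_sq[of "\<lambda>_::'a. 1"] by (simp add: norm_sq_Basis)

lemma prob_space_std_gaussian: "prob_space std_gaussian"
proof
  have "emeasure (std_gaussian :: 'a measure) (space std_gaussian) =
    (\<integral>\<^sup>+x. ennreal (1 / sqrt pi ^ DIM('a)) * ennreal (exp (- (norm x)\<^sup>2)) \<partial>(lborel :: 'a measure))"
    by (simp add: std_gaussian_def emeasure_density ennreal_mult'[symmetric])
  also have "\<dots> = 1"
    by (subst nn_integral_cmult) (simp_all add: nn_integral_exp_minus_norm_sq ennreal_mult'[symmetric])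
  finally show "emeasure (std_gaussian :: 'a measure) (space std_gaussian) = 1" .
qed

interpretation std_gaussian: prob_space std_gaussian
  by (rule prob_space_std_gaussian)

lemma nn_integral_std_gaussian:
  fixes g :: "'a::euclidean_space \<Rightarrow> ennreal"
  assumes [measurable]: "g \<in> borel_measurable borel"
  shows "(\<integral>\<^sup>+x. g x \<partial>std_gaussian) =
    (\<integral>\<^sup>+x. ennreal (exp (- (norm x)\<^sup>2) / sqrt pi ^ DIM('a)) * g x \<partial>lborel)"
  by (simp add: std_gaussian_def nn_integral_density)

lemma linear_borel_measurable:
  fixes f :: "'a::euclidean_space \<Rightarrow> 'b::real_normed_vector"
  assumes "linear f"
  shows "f \<in> borel_measurable borel"
  using assms by (intro borel_measurable_continuous_onI)
    (simp add: linear_continuous_on linear_conv_bounded_linear)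

text \<open>The density is a function of the norm. Taking the density itself as the second function
  in \<open>nn_integral_linear_cross\<close> cancels the unknown Jacobian factor, because it has
  mass 1 on both spaces.\<close>

lemma std_gaussian_isometry:
  fixes f :: "'a::euclidean_space \<Rightarrow> 'b::euclidean_space"
  assumes lin: "linear f" and surj: "surj f" and norm: "\<And>x. norm (f x) = norm x"
  shows "distr std_gaussian borel f = std_gaussian"
proof (rule measure_eqI)
  show "sets (distr std_gaussian borel f) = sets std_gaussian" by simp
next
  fix A assume "A \<in> sets (distr std_gaussian borel f)"
  then have [measurable]: "A \<in> sets borel" by simp
  have [measurable]: "f \<in> borel_measurable borel"
    using lin by (rule linear_borel_measurable)
  have inj: "inj f"
  proof (rule linear_injective_0[THEN iffD2, OF lin], intro allI impI)
    fix x assume "f x = 0" then show "x = 0" using norm[of x] by simp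
  qed
  have dim: "DIM('a) = DIM('b)"
    using dim_image_eq[OF lin, of UNIV] inj surj by simp
  let ?c = "sqrt pi ^ DIM('b)"
  let ?e = "\<lambda>x. ennreal (exp (- (norm x)\<^sup>2) / ?c)"
  have one: "(\<integral>\<^sup>+x. ?e x \<partial>(lborel :: 'b measure)) = 1" "(\<integral>\<^sup>+x. ?e x \<partial>(lborel :: 'a measure)) = 1"
    using std_gaussian.emeasure_space_1[where 'a='b] std_gaussian.emeasure_space_1[where 'a='a] dim
    by (simp_all add: std_gaussian_def emeasure_density)
  have "emeasure (distr std_gaussian borel f) A = (\<integral>\<^sup>+x. indicator A x \<partial>distr std_gaussian borel f)"
    by simp
  also have "\<dots> = (\<integral>\<^sup>+x. indicator A (f x) \<partial>std_gaussian)"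
    by (subst nn_integral_distr) auto
  also have "\<dots> = (\<integral>\<^sup>+x. ?e (f x) * indicator A (f x) \<partial>lborel)"
    by (subst nn_integral_std_gaussian) (auto simp: norm dim)
  also have "\<dots> = (\<integral>\<^sup>+x. ?e (f x) * indicator A (f x) \<partial>lborel) * (\<integral>\<^sup>+x. ?e x \<partial>(lborel :: 'b measure))"
    by (simp add: one)
  also have "\<dots> = (\<integral>\<^sup>+x. ?e (f x) \<partial>lborel) * (\<integral>\<^sup>+y. ?e y * indicator A y \<partial>lborel)"
    using lin inj surj by (intro nn_integral_linear_cross[of f "\<lambda>x. ?e x * indicator A x" ?e]) (auto simp: bij_def)
  also have "\<dots> = emeasure std_gaussian A"
    by (simp add: norm one std_gaussian_def emeasure_density)
  finally show "emeasure (distr std_gaussian borel f) A = emeasure std_gaussian A" .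
qed

text \<open>Squared norms add over components. Independent pairs thus become single vectors of a
  larger Euclidean space, to which the invariance under linear maps applies.\<close>

lemma std_gaussian_prod:
  "std_gaussian \<Otimes>\<^sub>M std_gaussian = (std_gaussian :: ('a::euclidean_space \<times> 'b::euclidean_space) measure)"
proof -
  have "std_gaussian \<Otimes>\<^sub>M std_gaussian = density (lborel \<Otimes>\<^sub>M lborel)
     (\<lambda>(x::'a, y::'b). ennreal (exp (- (norm x)\<^sup>2) / sqrt pi ^ DIM('a)) *
       ennreal (exp (- (norm y)\<^sup>2) / sqrt pi ^ DIM('b)))"
    unfolding std_gaussian_def
    by (rule pair_measure_density)
      (auto intro: prob_space_imp_sigma_finite std_gaussian.prob_space_axioms
        lborel.sigma_finite_measure_axioms simp flip: std_gaussian_def)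
  also have "\<dots> = std_gaussian"
    by (simp add: lborel_prod std_gaussian_def norm_prod_def ennreal_mult'[symmetric]
       mult_exp_exp power_add split_beta' real_sqrt_pow2)
  finally show ?thesis .
qed

text \<open>Here \<open>g\<close> is the adjoint of \<open>f\<close> and a right inverse of it. Such
  a map dilates to a surjective isometry: adjoin an independent vector y of the target space and let
  \<open>T (x, y)\<close> carry \<open>f x\<close> in its first component and, in the second, x with
  its part in the range of \<open>g\<close> replaced by \<open>g y\<close>. The law of
  \<open>f\<close> is then a first marginal.\<close>

lemma std_gaussian_coisometry:
  fixes f :: "'a::euclidean_space \<Rightarrow> 'b::euclidean_space"
  assumes f: "linear f" and g: "linear g" and fg: "\<And>y. f (g y) = y"
    and adj: "\<And>x y. f x \<bullet> y = x \<bullet> g y"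
  shows "distr std_gaussian borel f = std_gaussian"
proof -
  define T where "T = (\<lambda>(x, y). (f x, x - g (f x) + g y))"
  have T_fst: "fst (T p) = f (fst p)" for p by (simp add: T_def split_beta)
  have "linear T"
    unfolding T_def split_beta'
    by (intro linearI) (simp_all add: linear_add[OF f] linear_add[OF g] linear_scale[OF f]
        linear_scale[OF g] algebra_simps)
  moreover have "surj T"
  proof (rule surjI)
    fix p :: "'b \<times> 'a"
    show "T (snd p - g (f (snd p)) + g (fst p), f (snd p)) = p"
      by (cases p) (simp add: T_def linear_add[OF f] linear_diff[OF f] fg)
  qed
  moreover have "norm (T p) = norm p" for p
  proof -
    obtain x y where p: "p = (x, y)" by (cases p)
    have 1: "g a \<bullet> g b = a \<bullet> b" for a b
      by (metis adj fg)
    have 2: "x \<bullet> g y = f x \<bullet> y" "g y \<bullet> x = f x \<bullet> y" for x y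
      using adj by (simp_all add: inner_commute)
    have "T p \<bullet> T p = p \<bullet> p"
      by (simp add: p T_def inner_add_left inner_add_right inner_diff_left inner_diff_right 1 2
          inner_commute[of y "f x"] linear_add[OF f] linear_diff[OF f] fg)
    then show ?thesis by (simp add: norm_eq)
  qed
  ultimately have "distr std_gaussian borel T = std_gaussian"
    by (rule std_gaussian_isometry)
  have [measurable]: "f \<in> borel_measurable borel" "T \<in> borel_measurable borel"
    using f \<open>linear T\<close> by (simp_all add: linear_borel_measurable)
  have [measurable]: "(fst :: 'b \<times> 'a \<Rightarrow> 'b) \<in> borel_measurable borel" 
      "(fst :: 'a \<times> 'b \<Rightarrow> 'a) \<in> borel_measurable borel"
    by (simp_all add: borel_prod[symmetric])
  have fst: "distr (std_gaussian :: ('c::euclidean_space \<times> 'd::euclidean_space) measure) borel fst = std_gaussian"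
  proof (rule measure_eqI)
    fix A assume "A \<in> sets (distr (std_gaussian :: ('c \<times> 'd) measure) borel fst)"
    then have [measurable]: "A \<in> sets borel" by simp
    have "fst -` A = (A \<times> UNIV :: ('c \<times> 'd) set)" by auto
    moreover have "fst \<in> measurable (borel :: ('c \<times> 'd) measure) borel" by (simp add: borel_prod[symmetric])
    ultimately show "emeasure (distr (std_gaussian :: ('c \<times> 'd) measure) borel fst) A = emeasure std_gaussian A"
      by (simp add: emeasure_distr std_gaussian_prod[symmetric] std_gaussian.emeasure_pair_measure_Times
          prob_space.emeasure_space_1[OF prob_space_std_gaussian, simplified])
  qed simp
  have "std_gaussian = distr (distr std_gaussian borel T) borel fst"
    by (simp add: \<open>distr std_gaussian borel T = std_gaussian\<close> fst)
  also have "\<dots> = distr (distr (std_gaussian :: ('a \<times> 'b) measure) borel fst) borel f"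
    by (simp add: distr_distr comp_def T_fst)
  also have "\<dots> = distr std_gaussian borel f"
    by (simp add: fst)
  finally show ?thesis ..
qed

text \<open>The Laplace transform of the squared length of a projection. In the coordinates of an
  orthonormal basis extending \<open>B\<close> the vector is again standard, and each coordinate
  along \<open>B\<close>, having variance 1/2, contributes 1 / sqrt (1 + t).\<close>

lemma exp_orthonormal_std_gaussian:
  fixes B :: "'a::euclidean_space set"
  assumes orth: "pairwise orthogonal B" and one: "\<And>b. b \<in> B \<Longrightarrow> norm b = 1" and t: "t \<ge> 0"
  shows "(\<integral>\<^sup>+x. ennreal (exp (- (t * (\<Sum>b\<in>B. (x \<bullet> b)\<^sup>2)))) \<partial>std_gaussian) =
    ennreal ((1 / sqrt (1 + t)) ^ card B)"
proof -
  obtain U where U: "U \<inter> insert 0 B = {}" "pairwise orthogonal (B \<union> U)"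
      "span (B \<union> U) = span (B \<union> UNIV)"
    using orthogonal_extension_strong[OF orth, where T = UNIV] by blast
  have z: "0 \<notin> B \<union> U" using U(1) one by fastforce
  define C where "C = (\<lambda>u. u /\<^sub>R norm u) ` (B \<union> U)"
  have indBU: "independent (B \<union> U)"
    using U(2) z by (rule pairwise_orthogonal_independent)
  have inj: "inj_on (\<lambda>u. u /\<^sub>R norm u) (B \<union> U)"
  proof (rule inj_onI, rule ccontr)
    fix x y assume xy: "x \<in> B \<union> U" "y \<in> B \<union> U" "x /\<^sub>R norm x = y /\<^sub>R norm y" "x \<noteq> y"
    then have "x \<bullet> y = 0" using U(2) by (auto simp: pairwise_def orthogonal_def)
    then have "(x /\<^sub>R norm x) \<bullet> (x /\<^sub>R norm x) = 0"
      using xy(3) by (metis inner_scaleR_left inner_scaleR_right mult_zero_right)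
    then show False using xy z by auto
  qed
  have cardBU: "card (B \<union> U) = DIM('a)"
    using indBU U(3) by (metis dim_UNIV dim_span dim_eq_card_independent Un_UNIV_right)
  have cardC: "card C = DIM('a)" and finC: "finite C"
    using inj cardBU independent_imp_finite[OF indBU] by (simp_all add: C_def card_image)
  have BC: "B \<subseteq> C"
  proof
    fix b assume "b \<in> B" then show "b \<in> C"
      using one[of b] by (auto simp: C_def intro!: image_eqI[of _ _ b])
  qed
  have Corth: "pairwise orthogonal C"
  proof (rule pairwiseI)
    fix x y assume "x \<in> C" "y \<in> C" "x \<noteq> y"
    then obtain a b where "a \<in> B \<union> U" "b \<in> B \<union> U" "a \<noteq> b" "x = a /\<^sub>R norm a" "y = b /\<^sub>R norm b"
      by (auto simp: C_def)
    then show "orthogonal x y" using U(2) by (simp add: pairwise_def orthogonal_def)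
  qed
  have Cone: "norm c = 1" if cC: "c \<in> C" for c
  proof -
    obtain u where u: "u \<in> B \<union> U" "c = u /\<^sub>R norm u" using cC unfolding C_def by blast
    then have "norm u \<noteq> 0" using z by auto
    then show ?thesis using u(2) by simp
  qed
  obtain h where h: "bij_betw h (Basis :: 'a set) C"
    using finC cardC by (metis finite_Basis finite_same_card_bij)
  \<comment> \<open>\<open>F\<close> carries the orthonormal basis \<open>C\<close> to the standard
    basis; \<open>K\<close> is its adjoint and inverse.\<close>
  define F where "F = (\<lambda>x. \<Sum>i\<in>Basis. (x \<bullet> h i) *\<^sub>R i)"
  define K where "K = (\<lambda>y. \<Sum>i\<in>Basis. (y \<bullet> i) *\<^sub>R h i)"
  have hh: "h i \<bullet> h j = (if i = j then 1 else 0)" if "i \<in> Basis" "j \<in> Basis" for i j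
  proof -
    have "h i \<in> C" "h j \<in> C" "h i = h j \<longleftrightarrow> i = j"
      using h that by (auto simp: bij_betw_def inj_on_def)
    then show ?thesis
      using Corth Cone by (auto simp: norm_eq_1 pairwise_def orthogonal_def)
  qed
  have Fi: "F x \<bullet> i = x \<bullet> h i" if "i \<in> Basis" for x i
    using that by (simp add: F_def inner_sum_left inner_Basis if_distrib cong: if_cong)
  have "linear F" "linear K"
    unfolding F_def K_def
    by (auto intro!: linearI simp: inner_add_left scaleR_add_left sum.distrib scaleR_sum_right)
  moreover have "F (K y) = y" for y
  proof (rule euclidean_eqI)
    fix i :: 'a assume i: "i \<in> Basis"
    have "K y \<bullet> h i = (\<Sum>j\<in>Basis. (y \<bullet> j) * (h j \<bullet> h i))"
      by (simp add: K_def inner_sum_left)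
    also have "\<dots> = (\<Sum>j\<in>Basis. (y \<bullet> j) * (if j = i then 1 else 0))"
      using i by (intro sum.cong) (auto simp: hh)
    also have "\<dots> = y \<bullet> i" using i by (simp add: if_distrib cong: if_cong)
    finally show "F (K y) \<bullet> i = y \<bullet> i" using i by (simp add: Fi)
  qed
  moreover have "F x \<bullet> y = x \<bullet> K y" for x y
    by (simp add: F_def K_def inner_sum_left inner_sum_right inner_commute mult.commute)
  ultimately have F: "distr std_gaussian borel F = std_gaussian"
    by (intro std_gaussian_coisometry)
  have [measurable]: "F \<in> borel_measurable borel"
    using \<open>linear F\<close> by (rule linear_borel_measurable)
  define d where "d = {i\<in>Basis. h i \<in> B}"
  have hd: "bij_betw h d B"
  proof (rule bij_betwI')
    show "(h x = h y) = (x = y)" if "x \<in> d" "y \<in> d" for x y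
      using h that by (auto simp: d_def bij_betw_def inj_on_def)
    show "h x \<in> B" if "x \<in> d" for x using that by (simp add: d_def)
    show "\<exists>x\<in>d. y = h x" if "y \<in> B" for y
      using h that BC unfolding bij_betw_def d_def by (smt (verit) image_iff mem_Collect_eq subsetD)
  qed
  have d: "d \<subseteq> Basis" "card d = card B"
    using hd by (auto simp: d_def bij_betw_same_card)
  have eq: "(\<Sum>b\<in>B. (x \<bullet> b)\<^sup>2) = (\<Sum>i\<in>d. (F x \<bullet> i)\<^sup>2)" for x
    using sum.reindex_bij_betw[OF hd, of "\<lambda>b. (x \<bullet> b)\<^sup>2", symmetric] d(1)
    by (auto intro!: sum.cong simp: Fi)
  have "(\<integral>\<^sup>+x. ennreal (exp (- (t * (\<Sum>b\<in>B. (x \<bullet> b)\<^sup>2)))) \<partial>std_gaussian) =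
      (\<integral>\<^sup>+y. ennreal (exp (- (t * (\<Sum>i\<in>d. (y \<bullet> i)\<^sup>2)))) \<partial>distr std_gaussian borel F)"
    unfolding eq by (subst nn_integral_distr) auto
  also have "\<dots> = (\<integral>\<^sup>+y. ennreal (1 / sqrt pi ^ DIM('a)) *
      ennreal (exp (- (\<Sum>i\<in>Basis. (if i \<in> d then 1 + t else 1) * (y \<bullet> i)\<^sup>2))) \<partial>lborel)"
  proof (unfold F, subst nn_integral_std_gaussian, simp, rule nn_integral_cong)
    fix y :: 'a
    have "(\<Sum>i\<in>Basis. (if i \<in> d then 1 + t else 1) * (y \<bullet> i)\<^sup>2) =
      (\<Sum>i\<in>Basis. (y \<bullet> i)\<^sup>2 + t * (if i \<in> d then (y \<bullet> i)\<^sup>2 else 0))"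
      by (intro sum.cong) (auto simp: algebra_simps)
    also have "\<dots> = (norm y)\<^sup>2 + t * (\<Sum>i\<in>d. (y \<bullet> i)\<^sup>2)"
      using d(1) by (simp add: sum.distrib norm_sq_Basis sum_distrib_left[symmetric]
          sum.inter_restrict[symmetric] Int_absorb1)
    finally show "ennreal (exp (- (norm y)\<^sup>2) / sqrt pi ^ DIM('a)) *
        ennreal (exp (- (t * (\<Sum>i\<in>d. (y \<bullet> i)\<^sup>2)))) = ennreal (1 / sqrt pi ^ DIM('a)) *
      ennreal (exp (- (\<Sum>i\<in>Basis. (if i \<in> d then 1 + t else 1) * (y \<bullet> i)\<^sup>2)))"
      by (simp add: ennreal_mult'[symmetric] mult_exp_exp)
  qed
  also have "\<dots> = ennreal (1 / sqrt pi ^ DIM('a)) *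
      ennreal (\<Prod>i\<in>(Basis :: 'a set). sqrt (pi / (if i \<in> d then 1 + t else 1)))"
    using t by (subst nn_integral_cmult, simp, subst nn_integral_exp_minus_sum_sq) auto
  also have "(\<Prod>i\<in>(Basis :: 'a set). sqrt (pi / (if i \<in> d then 1 + t else 1))) =
      (\<Prod>i\<in>(Basis :: 'a set). sqrt pi * (if i \<in> d then 1 / sqrt (1 + t) else 1))"
    by (intro prod.cong) (auto simp: real_sqrt_divide)
  also have "\<dots> = sqrt pi ^ DIM('a) * (1 / sqrt (1 + t)) ^ card B"
    using d by (simp add: prod.distrib prod.If_cases Int_absorb1)
  finally show ?thesis
    using t by (simp add: ennreal_mult'[symmetric])
qed

lemma AE_std_gaussian_notin_subspace:
  fixes S :: "'a::euclidean_space set"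
  assumes "dim S < DIM('a)"
  shows "AE x in std_gaussian. x \<notin> S"
proof -
  have "negligible S" using assms by (rule negligible_lowdim)
  then have "AE x in lebesgue. x \<notin> S"
    by (simp add: negligible_iff_null_sets AE_not_in)
  then have "AE x in lborel. x \<notin> S"
    by (simp add: AE_completion_iff)
  then show ?thesis
    unfolding std_gaussian_def by (subst AE_density) auto
qed

section \<open>Vectors with independent standard Gaussian entries\<close>

lemma vec_lambda_measurable[measurable]:
  "vec_lambda \<in> measurable (\<Pi>\<^sub>M i\<in>UNIV. borel) (borel :: ('a::euclidean_space ^ 'm::finite) measure)"
proof (rule borel_measurable_euclidean_space[THEN iffD2], rule ballI)
  fix b :: "'a ^ 'm" assume "b \<in> Basis"
  then obtain i u where "b = axis i u" by (auto simp: Basis_vec_def)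
  then show "(\<lambda>x. vec_lambda x \<bullet> b) \<in> borel_measurable (\<Pi>\<^sub>M i\<in>UNIV. borel)"
    by (simp add: inner_axis)
qed

lemma Basis_vec_prod:
  "(\<Prod>b\<in>(Basis :: ('a::euclidean_space ^ 'm::finite) set). f b) = (\<Prod>i\<in>UNIV. \<Prod>u\<in>Basis. f (axis i u))"
proof -
  have "(\<Prod>b\<in>(Basis :: ('a ^ 'm) set). f b) = (\<Prod>p\<in>UNIV \<times> Basis. f (axis (fst p) (snd p)))"
    by (rule prod.reindex_bij_betw[symmetric], rule bij_betwI')
      (auto simp: axis_eq_axis Basis_vec_def, blast)
  then show ?thesis by (simp add: prod.cartesian_product split_beta)
qed

text \<open>Dividing the image of the product measure by the Gaussian density yields a measure that
  gives every box its volume, hence Lebesgue measure; multiplying by the density again recovers the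
  image.\<close>

lemma distr_PiM_std_gaussian:
  "distr (\<Pi>\<^sub>M i\<in>UNIV. std_gaussian) borel vec_lambda =
    (std_gaussian :: ('a::euclidean_space ^ 'm::finite) measure)"
proof -
  interpret product_sigma_finite "\<lambda>_::'m. std_gaussian :: 'a measure"
    by (intro product_sigma_finite.intro prob_space_imp_sigma_finite prob_space_std_gaussian)
  define d where "d = (\<lambda>x::'a. exp (- (norm x)\<^sup>2) / sqrt pi ^ DIM('a))"
  define D where "D = (\<lambda>x::'a^'m. exp (- (norm x)\<^sup>2) / sqrt pi ^ DIM('a^'m))"
  have pos: "d x > 0" "D y > 0" for x y by (simp_all add: d_def D_def)
  have Dd: "D (vec_lambda f) = (\<Prod>i\<in>UNIV. d (f i))" for f
  proof -
    have "(norm (vec_lambda f))\<^sup>2 = (\<Sum>i\<in>UNIV. (norm (f i))\<^sup>2)"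
      by (simp add: norm_vec_def L2_set_def sum_nonneg)
    then show ?thesis
      by (simp add: D_def d_def prod_dividef exp_sum sum_negf[symmetric] power_mult mult.commute)
  qed
  have [measurable]: "d \<in> borel_measurable borel" "D \<in> borel_measurable borel"
    by (simp_all add: d_def D_def)
  let ?\<nu> = "distr (\<Pi>\<^sub>M i\<in>UNIV. std_gaussian) borel vec_lambda :: ('a^'m) measure"
  have vm[measurable]: "vec_lambda \<in> measurable (\<Pi>\<^sub>M i\<in>UNIV. std_gaussian) (borel :: ('a^'m) measure)"
    using vec_lambda_measurable measurable_cong_sets[OF sets_PiM_cong[OF refl sets_std_gaussian] refl]
    by blast
  have "lborel = density ?\<nu> (\<lambda>x. ennreal (1 / D x))"
  proof (rule lborel_eqI)
    fix l u :: "'a^'m" assume lu: "\<And>b. b \<in> Basis \<Longrightarrow> l \<bullet> b \<le> u \<bullet> b"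
    have box: "vec_lambda f \<in> box l u \<longleftrightarrow> (\<forall>i. f i \<in> box (l $ i) (u $ i))" for f
      by (auto simp: mem_box Basis_vec_def inner_axis)
    have ind: "(\<Prod>i\<in>UNIV. indicator (box (l $ i) (u $ i)) (f i)) =
        (indicator (box l u) (vec_lambda f) :: ennreal)" for f
      by (simp add: indicator_def box prod_eq_1_iff)
    have lu': "l $ i \<bullet> b \<le> u $ i \<bullet> b" if "b \<in> Basis" for i b
      using lu[of "axis i b"] that by (simp add: inner_axis)
    have "emeasure (density ?\<nu> (\<lambda>x. ennreal (1 / D x))) (box l u) =
      (\<integral>\<^sup>+f. ennreal (1 / D (vec_lambda f)) * indicator (box l u) (vec_lambda f) \<partial>(\<Pi>\<^sub>M i\<in>UNIV. std_gaussian))"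
      by (simp add: emeasure_density nn_integral_distr)
    also have "\<dots> = (\<integral>\<^sup>+f. (\<Prod>i\<in>UNIV. ennreal (1 / d (f i)) * indicator (box (l $ i) (u $ i)) (f i))
        \<partial>(\<Pi>\<^sub>M i\<in>UNIV. std_gaussian))"
      using pos by (simp add: prod.distrib ind Dd prod_ennreal less_imp_le prod_dividef)
    also have "\<dots> = (\<Prod>i\<in>(UNIV::'m set). \<integral>\<^sup>+x. ennreal (1 / d x) * indicator (box (l $ i) (u $ i)) x \<partial>std_gaussian)"
      by (rule product_nn_integral_prod) auto
    also have "\<dots> = (\<Prod>i\<in>(UNIV::'m set). emeasure lborel (box (l $ i) (u $ i)))"
    proof (intro prod.cong refl)
      fix i
      have "(\<integral>\<^sup>+x. ennreal (1 / d x) * indicator (box (l $ i) (u $ i)) x \<partial>std_gaussian) =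
        (\<integral>\<^sup>+x. ennreal (d x) * (ennreal (1 / d x) * indicator (box (l $ i) (u $ i)) x) \<partial>lborel)"
        by (subst nn_integral_std_gaussian) (auto simp: d_def)
      also have "\<dots> = (\<integral>\<^sup>+x. indicator (box (l $ i) (u $ i)) x \<partial>lborel)"
        using pos(1) less_imp_neq[OF pos(1)] by (simp add: mult.assoc[symmetric] ennreal_mult'[symmetric] less_imp_le)
      finally show "(\<integral>\<^sup>+x. ennreal (1 / d x) * indicator (box (l $ i) (u $ i)) x \<partial>std_gaussian) =
        emeasure lborel (box (l $ i) (u $ i))" by simp
    qed
    also have "\<dots> = (\<Prod>i\<in>(UNIV::'m set). ennreal (\<Prod>b\<in>Basis. (u $ i - l $ i) \<bullet> b))"
      by (intro prod.cong refl emeasure_lborel_box) (rule lu')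
    also have "\<dots> = ennreal (\<Prod>b\<in>Basis. (u - l) \<bullet> b)"
      using lu' by (subst prod_ennreal) (auto simp: Basis_vec_prod inner_axis inner_diff_left intro!: prod_nonneg)
    finally show "emeasure (density ?\<nu> (\<lambda>x. ennreal (1 / D x))) (box l u) = ennreal (\<Prod>b\<in>Basis. (u - l) \<bullet> b)" .
  qed simp
  then have "std_gaussian = density (density ?\<nu> (\<lambda>x. ennreal (1 / D x))) (\<lambda>x. ennreal (D x))"
    by (simp add: std_gaussian_def D_def)
  also have "\<dots> = density ?\<nu> (\<lambda>x. ennreal (1 / D x) * ennreal (D x))"
    by (rule density_density_eq) auto
  also have "\<dots> = ?\<nu>"
    using pos(2) less_imp_neq[OF pos(2)] by (simp add: ennreal_mult'[symmetric] less_imp_le density_1)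
  finally show ?thesis ..
qed

lemma (in prob_space) distr_vec_std_gaussian:
  fixes X :: "'m::finite \<Rightarrow> 'a \<Rightarrow> 'b::euclidean_space"
  assumes indep: "indep_vars (\<lambda>_. borel) X UNIV"
    and std: "\<And>i. distr M borel (X i) = std_gaussian"
  shows "distr M borel (\<lambda>\<omega>. \<chi> i. X i \<omega>) = std_gaussian"
proof -
  have [measurable]: "X i \<in> borel_measurable M" for i
    using indep by (auto simp: indep_vars_def)
  have "distr M (\<Pi>\<^sub>M i\<in>UNIV. borel) (\<lambda>x. \<lambda>i\<in>UNIV. X i x) = (\<Pi>\<^sub>M i\<in>UNIV. std_gaussian)"
    using indep std by (subst (asm) indep_vars_iff_distr_eq_PiM) auto
  then have "std_gaussian = distr (distr M (\<Pi>\<^sub>M i\<in>UNIV. borel) (\<lambda>x. \<lambda>i\<in>UNIV. X i x)) borel vec_lambda"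
    using distr_PiM_std_gaussian[where 'a = 'b and 'm = 'm] by simp
  also have "\<dots> = distr M borel (\<lambda>\<omega>. \<chi> i. X i \<omega>)"
    by (subst distr_distr) (auto simp: comp_def restrict_UNIV space_PiM intro!: measurable_PiM_single')
  finally show ?thesis ..
qed

section \<open>Second moments of the standard Gaussian\<close>

lemma has_bochner_std_gaussian_real_sq:
  "has_bochner_integral std_gaussian (\<lambda>t::real. t\<^sup>2) (1 / 2)"
proof -
  have eq: "(std_gaussian :: real measure) = density lborel (\<lambda>t. ennreal (normal_density 0 (1 / sqrt 2) t))"
    by (simp add: std_gaussian_def normal_density_def power_divide)
  have "has_bochner_integral lborel (\<lambda>t. normal_density 0 (1 / sqrt 2) t * t\<^sup>2) (1 / 2)"
    using normal_moment_even[of "1 / sqrt 2" 0 1] by (simp add: power_divide)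
  then show ?thesis
    unfolding eq by (intro has_bochner_integral_density) auto
qed

lemma has_bochner_std_gaussian_inner_sq:
  fixes b :: "'a::euclidean_space"
  assumes "norm b = 1"
  shows "has_bochner_integral std_gaussian (\<lambda>x. (x \<bullet> b)\<^sup>2) (1 / 2)"
proof -
  have bb: "b \<bullet> b = 1" using assms by (simp add: norm_eq_1)
  have "distr std_gaussian borel (\<lambda>x. x \<bullet> b) = std_gaussian"
    by (rule std_gaussian_coisometry[where g = "\<lambda>t. t *\<^sub>R b"])
      (auto intro!: linearI simp: inner_add_left scaleR_add_left bb)
  then have "has_bochner_integral (distr std_gaussian borel (\<lambda>x. x \<bullet> b)) (\<lambda>t::real. t\<^sup>2) (1 / 2)"
    using has_bochner_std_gaussian_real_sq by simp
  then show ?thesis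
    by (simp add: has_bochner_integral_iff integrable_distr_eq integral_distr)
qed

text \<open>Polarization: (b + c) / sqrt 2 is again a unit vector, so the mixed moment is a
  combination of three equal second moments whose coefficients add up to 0.\<close>

lemma has_bochner_std_gaussian_inner_prod:
  fixes b c :: "'a::euclidean_space"
  assumes "norm b = 1" "norm c = 1" "b \<bullet> c = 0"
  shows "has_bochner_integral std_gaussian (\<lambda>x. (x \<bullet> b) * (x \<bullet> c)) 0"
proof -
  define d where "d = (1 / sqrt 2) *\<^sub>R (b + c)"
  have "norm d = 1"
    using assms by (simp add: d_def norm_eq_1 inner_add_left inner_add_right inner_commute[of c b]
      field_simps)
  then have "has_bochner_integral std_gaussian
      (\<lambda>x. (x \<bullet> d)\<^sup>2 - (1/2) * (x \<bullet> b)\<^sup>2 - (1/2) * (x \<bullet> c)\<^sup>2) (1/2 - (1/2) * (1/2) - (1/2) * (1/2))"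
    using assms by (intro has_bochner_integral_diff has_bochner_integral_mult_right
        has_bochner_std_gaussian_inner_sq)
  moreover have "(x \<bullet> d)\<^sup>2 - (1/2) * (x \<bullet> b)\<^sup>2 - (1/2) * (x \<bullet> c)\<^sup>2 = (x \<bullet> b) * (x \<bullet> c)" for x
    by (simp add: d_def inner_add_right power2_eq_square field_simps)
  ultimately show ?thesis by simp
qed

text \<open>\<open>circ_gaussian\<close> only asserts that some covariance exists. These moments
  later identify it with the one that the hypotheses on expectations prescribe.\<close>

lemma has_bochner_std_gaussian_covariance:
  "has_bochner_integral (std_gaussian :: (complex^'n) measure) (\<lambda>y. y $ i * cnj (y $ k)) (if i = k then 1 else 0)"
proof -
  let ?r = "\<lambda>j y::complex^'n. y \<bullet> axis j 1" and ?m = "\<lambda>j y::complex^'n. y \<bullet> axis j \<i>"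
  have eq: "y $ i * cnj (y $ k) = complex_of_real (?r i y * ?r k y + ?m i y * ?m k y) +
      \<i> * complex_of_real (?m i y * ?r k y - ?r i y * ?m k y)" for y :: "complex^'n"
    by (simp add: complex_eq_iff inner_axis inner_complex_def)
  have n: "norm (axis j (1::complex) :: complex^'n) = 1" "norm (axis j \<i> :: complex^'n) = 1" for j
    by (simp_all add: norm_eq_1 inner_axis_axis inner_complex_def)
  have o: "(axis j (1::complex) :: complex^'n) \<bullet> axis l \<i> = 0" "(axis j \<i> :: complex^'n) \<bullet> axis l 1 = 0"
     "j \<noteq> l \<Longrightarrow> (axis j x :: complex^'n) \<bullet> axis l x' = 0" for j l x x'
    by (simp_all add: inner_axis_axis inner_complex_def)
  note im = has_bochner_integral_diff[OF
      has_bochner_std_gaussian_inner_prod[OF n(2) n(1) o(2)] has_bochner_std_gaussian_inner_prod[OF n(1) n(2) o(1)], of i k i k]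
  have re: "has_bochner_integral std_gaussian (\<lambda>y. ?r i y * ?r k y + ?m i y * ?m k y) (if i = k then 1 else 0)"
  proof (cases "i = k")
    case True
    then show ?thesis
      using has_bochner_integral_add[OF has_bochner_std_gaussian_inner_sq[OF n(1)] has_bochner_std_gaussian_inner_sq[OF n(2)], of i i]
      by (simp add: power2_eq_square)
  next
    case False
    then show ?thesis
      using has_bochner_integral_add[OF has_bochner_std_gaussian_inner_prod[OF n(1) n(1) o(3)[OF False]]
          has_bochner_std_gaussian_inner_prod[OF n(2) n(2) o(3)[OF False]]]
      by simp
  qed
  have "has_bochner_integral std_gaussian (\<lambda>y. y $ i * cnj (y $ k))
      (complex_of_real (if i = k then 1 else 0) + \<i> * complex_of_real (0 - 0))"
    unfolding eq
    by (intro has_bochner_integral_add has_bochner_integral_mult_right has_bochner_integral_of_real re im)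
  then show ?thesis by (simp split: if_splits)
qed

subsection \<open>Hermitian forms\<close>

lemma ctranspose_nth[simp]: "A\<^sup>H $ i $ j = cnj (A $ j $ i)"
  by (simp add: ctranspose_def transpose_def map_matrix_def)

lemma ctranspose_mult: "(A ** B)\<^sup>H = B\<^sup>H ** A\<^sup>H"
  by (simp add: vec_eq_iff matrix_matrix_mult_def mult.commute)

lemma ctranspose_ctranspose[simp]: "(A\<^sup>H)\<^sup>H = A"
  by (simp add: vec_eq_iff)

lemma ctranspose_mat_1[simp]: "(mat 1 :: complex^'n^'n)\<^sup>H = mat 1"
  by (simp add: vec_eq_iff mat_def)

lemma cinner_add_right: "cinner x (y + z) = cinner x y + cinner x z"
  and cinner_scale_right: "cinner x (c *s y) = c * cinner x y"
  and cinner_scale_left: "cinner (c *s x) y = cnj c * cinner x y"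
  by (simp_all add: cinner_def algebra_simps sum.distrib sum_subtractf sum_distrib_left)

lemma cinner_zero[simp]: "cinner x 0 = 0" "cinner 0 x = 0"
  by (simp_all add: cinner_def)

lemma cnj_cinner: "cnj (cinner x y) = cinner y x"
  by (simp add: cinner_def mult.commute)

lemma cinner_self: "cinner x x = complex_of_real ((norm x)\<^sup>2)"
  by (simp add: cinner_def norm_vec_def L2_set_def sum_nonneg complex_norm_square mult.commute del: of_real_power)

lemma Re_cinner: "Re (cinner x y) = x \<bullet> y"
  by (simp add: cinner_def inner_vec_def inner_complex_def)

lemma cinner_ctranspose: "cinner (A *v x) y = cinner x (A\<^sup>H *v y)"
proof -
  have "cinner (A *v x) y = (\<Sum>i\<in>UNIV. \<Sum>j\<in>UNIV. cnj (A $ i $ j) * cnj (x $ j) * y $ i)"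
    by (simp add: cinner_def matrix_vector_mult_def sum_distrib_right)
  also have "\<dots> = (\<Sum>j\<in>UNIV. \<Sum>i\<in>UNIV. cnj (A $ i $ j) * cnj (x $ j) * y $ i)"
    by (rule sum.swap)
  also have "\<dots> = cinner x (A\<^sup>H *v y)"
    by (simp add: cinner_def matrix_vector_mult_def sum_distrib_left mult_ac)
  finally show ?thesis .
qed

lemma cinner_ctranspose': "cinner x (A *v y) = cinner (A\<^sup>H *v x) y"
  by (simp add: cinner_ctranspose)

lemma ctranspose_mult_nth: "(A\<^sup>H ** B) $ i $ j = cinner (column i A) (column j B)"
  by (simp add: matrix_matrix_mult_def cinner_def column_def)

lemma column_mult: "column j (A ** B) = A *v column j B"
  by (simp add: column_def matrix_matrix_mult_def matrix_vector_mult_def vec_eq_iff)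

lemma singular_kernel:
  fixes A :: "'a::field^'n^'n"
  assumes "\<not> invertible A"
  obtains x where "x \<noteq> 0" "A *v x = 0"
  using assms by (metis invertible_left_inverse matrix_left_invertible_ker)

text \<open>Gram--Schmidt for the sesquilinear form of \<open>P\<close>, started from a prescribed unit vector.\<close>

lemma posdef_orthonormal_basis:
  fixes P :: "complex^'n^'n" and k :: 'n
  assumes P: "hermitian_posdef P" and w: "cinner w (P *v w) = 1"
  obtains B where "B\<^sup>H ** P ** B = mat 1" "column k B = w"
proof -
  have herm: "P\<^sup>H = P" and pos: "x \<noteq> 0 \<Longrightarrow> Re (cinner x (P *v x)) > 0" for x
    using P by (auto simp: hermitian_posdef_def)
  have sym: "cinner x (P *v y) = cnj (cinner y (P *v x))" for x y
    by (metis cinner_ctranspose cnj_cinner herm)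
  have real: "cinner x (P *v x) = complex_of_real (Re (cinner x (P *v x)))" for x
    using sym[of x x] by (simp add: complex_eq_iff)
  have "\<exists>b. b k = w \<and> (\<forall>i\<in>insert k J. \<forall>j\<in>insert k J. cinner (b i) (P *v b j) = (if i = j then 1 else 0))"
    for J :: "'n set"
    using finite[of J]
  proof induction
    case empty
    show ?case using w by (intro exI[of _ "\<lambda>_. w"]) simp
  next
    case (insert a J)
    then obtain b where b: "b k = w"
      "\<And>i j. i \<in> insert k J \<Longrightarrow> j \<in> insert k J \<Longrightarrow> cinner (b i) (P *v b j) = (if i = j then 1 else 0)"
      by blast
    show ?case
    proof (cases "a \<in> insert k J")
      case True
      then show ?thesis using b by (intro exI[of _ b]) auto
    next
      case False
      define A :: "complex^'n^'n" where
        "A = (\<chi> i j. if i \<in> insert k J then cnj ((P *v b i) $ j) else 0)"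
      have A: "(A *v x) $ i = (if i \<in> insert k J then cinner (P *v b i) x else 0)" for x i
        by (simp add: A_def matrix_vector_mult_def cinner_def)
      \<comment> \<open>Row \<open>a\<close> of \<open>A\<close> is zero because index
        \<open>a\<close> has no vector yet. A kernel vector of \<open>A\<close> is orthogonal, for
        the form of \<open>P\<close>, to all vectors chosen so far.\<close>
      have "\<not> invertible A"
      proof
        assume "invertible A"
        then obtain A' where "A ** A' = mat 1" by (auto simp: invertible_def)
        then have "A *v (A' *v axis a 1) = axis a 1"
          by (simp add: matrix_vector_mul_assoc)
        then have "(A *v (A' *v axis a 1)) $ a = 1" by simp
        then show False using False A by auto
      qed
      then obtain x where x: "x \<noteq> 0" "A *v x = 0" by (rule singular_kernel)
      have bx: "cinner (b i) (P *v x) = 0" if "i \<in> insert k J" for i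
        using A[of x i] that x(2) by (simp add: cinner_ctranspose herm)
      define r where "r = sqrt (Re (cinner x (P *v x)))"
      have r: "r > 0" "r\<^sup>2 = Re (cinner x (P *v x))" using pos[OF x(1)] by (simp_all add: r_def)
      define y where "y = complex_of_real (1 / r) *s x"
      have y: "cinner y (P *v y) = 1"
      proof -
        have "cinner y (P *v y) = complex_of_real (1 / r) * complex_of_real (1 / r) * complex_of_real (r\<^sup>2)"
          using real[of x] r(2) by (simp add: y_def matrix_vector_mult_scaleR cinner_scale_left cinner_scale_right
              vector_scalar_commute)
        then show ?thesis using r(1) by (simp add: power2_eq_square)
      qed
      have yb: "cinner (b i) (P *v y) = 0" "cinner y (P *v b i) = 0" if "i \<in> insert k J" for i
      proof -
        show "cinner (b i) (P *v y) = 0"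
          using bx[OF that] by (simp add: y_def vector_scalar_commute cinner_scale_right)
        then show "cinner y (P *v b i) = 0" using sym[of y "b i"] by simp
      qed
      show ?thesis
        using b y yb False by (intro exI[of _ "b(a := y)"]) auto
    qed
  qed
  from this[of UNIV] obtain b where b: "b k = w" "\<And>i j. cinner (b i) (P *v b j) = (if i = j then 1 else 0)"
    by auto
  define B :: "complex^'n^'n" where "B = (\<chi> i j. b j $ i)"
  have col: "column j B = b j" for j by (simp add: B_def column_def)
  have "B\<^sup>H ** (P ** B) = mat 1"
    by (simp add: vec_eq_iff ctranspose_mult_nth column_mult col b mat_def)
  then show ?thesis using col b(1) by (intro that[of B]) (simp_all add: matrix_mul_assoc)
qed

lemma posdef_scale_unit:
  assumes "hermitian_posdef P" "v \<noteq> 0"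
  shows "cinner (complex_of_real (1 / sqrt (Re (cinner v (P *v v)))) *s v)
    (P *v (complex_of_real (1 / sqrt (Re (cinner v (P *v v)))) *s v)) = 1"
proof -
  have herm: "P\<^sup>H = P" and pos: "Re (cinner v (P *v v)) > 0"
    using assms by (auto simp: hermitian_posdef_def)
  let ?r = "Re (cinner v (P *v v))"
  have "cnj (cinner v (P *v v)) = cinner v (P *v v)"
    by (metis cinner_ctranspose cnj_cinner herm)
  then have "cinner v (P *v v) = complex_of_real ?r"
    by (simp add: complex_eq_iff)
  moreover have "cinner (c *s v) (P *v (c *s v)) = cnj c * c * cinner v (P *v v)" for c
    by (simp add: vector_scalar_commute cinner_scale_left cinner_scale_right)
  ultimately have "cinner (complex_of_real (1 / sqrt ?r) *s v) (P *v (complex_of_real (1 / sqrt ?r) *s v)) =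
     complex_of_real (1 / sqrt ?r * (1 / sqrt ?r) * ?r)"
    by (simp only: complex_cnj_complex_of_real of_real_mult)
  also have "1 / sqrt ?r * (1 / sqrt ?r) * ?r = 1" using pos by simp
  finally show ?thesis by simp
qed

section \<open>Inverses of positive definite matrices\<close>

lemma posdef_invertible:
  assumes "hermitian_posdef P"
  shows "invertible P"
proof (rule ccontr)
  assume "\<not> invertible P"
  then obtain x where "x \<noteq> 0" "P *v x = 0" by (rule singular_kernel)
  then show False using assms by (auto simp: hermitian_posdef_def)
qed

lemma matrix_inv_cancel:
  fixes A :: "'a::field^'n^'n"
  assumes "invertible A"
  shows "matrix_inv A ** A = mat 1" "A ** matrix_inv A = mat 1"
  using someI_ex[of "\<lambda>A'. A ** A' = mat 1 \<and> A' ** A = mat 1"] assms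
  by (auto simp: matrix_inv_def invertible_def)

lemma matrix_inv_eqI:
  fixes A :: "'a::field^'n^'n"
  assumes "B ** A = mat 1"
  shows "matrix_inv A = B"
proof -
  have "invertible A" using assms invertible_left_inverse by blast
  then show ?thesis
    by (metis assms matrix_inv_cancel(2) matrix_mul_assoc matrix_mul_lid matrix_mul_rid)
qed

lemma posdef_inverse:
  assumes "hermitian_posdef P"
  shows "hermitian_posdef (matrix_inv P)"
proof -
  have herm: "P\<^sup>H = P" and pos: "x \<noteq> 0 \<Longrightarrow> Re (cinner x (P *v x)) > 0" for x
    using assms by (auto simp: hermitian_posdef_def)
  note inv = matrix_inv_cancel[OF posdef_invertible[OF assms]]
  have "(matrix_inv P)\<^sup>H ** P = mat 1"
    using arg_cong[OF inv(2), of ctranspose] herm by (simp add: ctranspose_mult)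
  then have h: "(matrix_inv P)\<^sup>H = matrix_inv P" by (rule matrix_inv_eqI[symmetric])
  have "Re (cinner x (matrix_inv P *v x)) > 0" if "x \<noteq> 0" for x
  proof -
    let ?y = "matrix_inv P *v x"
    have x: "P *v ?y = x" by (simp only: matrix_vector_mul_assoc inv matrix_vector_mul_lid)
    then have "?y \<noteq> 0" using that matrix_vector_mult_0_right[of P] by auto
    then have "Re (cinner ?y (P *v ?y)) > 0" by (rule pos)
    also have "cinner ?y (P *v ?y) = cinner x ?y"
      unfolding x by (simp only: cinner_ctranspose h)
    finally show ?thesis .
  qed
  then show ?thesis using h by (simp add: hermitian_posdef_def)
qed

subsection \<open>Craig's formula\<close>

text \<open>The bridge between the gauge integral in which \<open>G_fun\<close> is written and the
  nonnegative Lebesgue integral in which averages are taken. Boundedness on a bounded set makes both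
  available.\<close>

lemma nn_integral_bounded_interval:
  fixes f :: "real \<Rightarrow> real"
  assumes [measurable]: "f \<in> borel_measurable borel"
    and S: "S \<subseteq> {a..b}" "S \<in> sets borel" and nn: "\<And>x. 0 \<le> f x" and le: "\<And>x. f x \<le> C"
  shows "f absolutely_integrable_on S"
    and "(\<integral>\<^sup>+x. ennreal (f x) * indicator S x \<partial>lborel) = ennreal (integral S f)"
proof -
  note S(2)[measurable]
  have fin: "emeasure lborel S < \<infinity>"
  proof -
    have "emeasure lborel S \<le> emeasure lborel {a..b}"
      using S by (intro emeasure_mono) auto
    also have "\<dots> < \<infinity>" by (cases "a \<le> b") auto
    finally show ?thesis .
  qed
  have "integrable lborel (\<lambda>x. indicator S x *\<^sub>R f x)"
    using fin nn le by (intro integrableI_bounded_set_indicator[where B = C]) auto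
  then show ai: "f absolutely_integrable_on S"
    by (simp add: set_integrable_def integrable_completion)
  then have "(f has_integral (integral S f)) S"
    using set_lebesgue_integral_eq_integral(1) by (blast intro: integrable_integral)
  then show "(\<integral>\<^sup>+x. ennreal (f x) * indicator S x \<partial>lborel) = ennreal (integral S f)"
    using nn by (intro nn_integral_has_integral_lebesgue')
qed

text \<open>Where sin \<theta> = 0 the quotient is 0 by convention and the exponential is 1. This
  concerns a null set only, and it keeps the integrand bounded by 1 everywhere.\<close>

definition craig :: "real \<Rightarrow> real \<Rightarrow> real \<Rightarrow> ennreal"
  where "craig t a b = (\<integral>\<^sup>+\<theta>. ennreal (exp (- (t\<^sup>2 / (sin \<theta>)\<^sup>2))) * indicator {a..b} \<theta> \<partial>lborel)"

lemma craig_open: "(\<integral>\<^sup>+\<theta>. ennreal (exp (- (t\<^sup>2 / (sin \<theta>)\<^sup>2))) * indicator {a<..<b} \<theta> \<partial>lborel) = craig t a b"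
  unfolding craig_def
proof (rule nn_integral_cong_AE)
  show "AE \<theta> in lborel. ennreal (exp (- (t\<^sup>2 / (sin \<theta>)\<^sup>2))) * indicator {a<..<b} \<theta> =
      ennreal (exp (- (t\<^sup>2 / (sin \<theta>)\<^sup>2))) * indicator {a..b} \<theta>"
    using AE_lborel_singleton[of a] AE_lborel_singleton[of b]
    by eventually_elim (auto simp: indicator_def)
qed

text \<open>Substitute \<theta> = pi / 2 - arctan s, the angle in (0, pi) with cotangent s: sin^2
  \<theta> = 1 / (1 + s^2), and the absolute derivative is 1 / (1 + s^2).\<close>

lemma craig_cot_substitution:
  assumes \<beta>: "0 < \<beta>" "\<beta> \<le> pi"
  shows "(\<integral>\<^sup>+s. ennreal (exp (- (t\<^sup>2 * (1 + s\<^sup>2))) / (1 + s\<^sup>2)) * indicator {s. pi / 2 - arctan s < \<beta>} s \<partial>lborel)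
    = craig t 0 \<beta>"
proof -
  define g where "g = (\<lambda>s. pi / 2 - arctan s)"
  define S where "S = {s. g s < \<beta>}"
  define f where "f = (\<lambda>\<theta>::real. exp (- (t\<^sup>2 / (sin \<theta>)\<^sup>2)))"
  have [measurable]: "(sin :: real \<Rightarrow> real) \<in> borel_measurable borel" "arctan \<in> borel_measurable borel"
    by (auto intro!: borel_measurable_continuous_onI continuous_intros)
  have [measurable]: "f \<in> borel_measurable borel" "g \<in> borel_measurable borel"
    unfolding f_def g_def by measurable
  then have S[measurable]: "S \<in> sets borel" unfolding S_def by measurable
  have gS: "g ` S = {0<..<\<beta>}"
  proof (intro equalityI subsetI)
    fix \<theta> assume "\<theta> \<in> {0<..<\<beta>}"
    then have "g (tan (pi / 2 - \<theta>)) = \<theta>"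
      using \<beta> by (simp add: g_def arctan_tan)
    then show "\<theta> \<in> g ` S"
      using \<open>\<theta> \<in> _\<close> by (intro image_eqI[where x = "tan (pi / 2 - \<theta>)"]) (auto simp: S_def)
  next
    fix \<theta> assume "\<theta> \<in> g ` S"
    then show "\<theta> \<in> {0<..<\<beta>}" using arctan_ubound by (auto simp: S_def g_def)
  qed
  have f01: "0 \<le> f x" "f x \<le> 1" for x by (simp_all add: f_def)
  have fi: "f absolutely_integrable_on (g ` S)"
    unfolding gS using f01 by (intro nn_integral_bounded_interval(1)[where a = 0 and b = \<beta> and C = 1]) auto
  have der: "(g has_field_derivative - inverse (1 + s\<^sup>2)) (at s within S)" for s
    unfolding g_def by (auto intro!: derivative_eq_intros DERIV_subset[OF DERIV_arctan])
  have inj: "inj_on g S"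
    by (auto simp: inj_on_def g_def arctan_eq_iff)
  have "(\<lambda>s. \<bar>- inverse (1 + s\<^sup>2)\<bar> * f (g s)) absolutely_integrable_on S \<and>
      integral S (\<lambda>s. \<bar>- inverse (1 + s\<^sup>2)\<bar> * f (g s)) = integral (g ` S) f"
    using has_absolute_integral_change_of_variables_1'[OF _ der inj, of f "integral (g ` S) f"] fi S
    by auto
  note subst = this
  have eq: "\<bar>- inverse (1 + s\<^sup>2)\<bar> * f (g s) = exp (- (t\<^sup>2 * (1 + s\<^sup>2))) / (1 + s\<^sup>2)" for s
  proof -
    have "0 < 1 + s\<^sup>2" by (simp add: add_pos_nonneg)
    have "sin (g s) = 1 / sqrt (1 + s\<^sup>2)"
      by (simp add: g_def sin_diff cos_arctan)
    then have "(sin (g s))\<^sup>2 = 1 / (1 + s\<^sup>2)"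
      using \<open>0 < 1 + s\<^sup>2\<close> by (simp add: power_divide)
    then show ?thesis
      using \<open>0 < 1 + s\<^sup>2\<close> by (simp add: f_def divide_inverse)
  qed
  have "((\<lambda>s. exp (- (t\<^sup>2 * (1 + s\<^sup>2))) / (1 + s\<^sup>2)) has_integral integral (g ` S) f) S"
  proof -
    have "(\<lambda>s. exp (- (t\<^sup>2 * (1 + s\<^sup>2))) / (1 + s\<^sup>2)) integrable_on S"
      using subst[unfolded eq] by (intro set_lebesgue_integral_eq_integral(1)) blast
    then show ?thesis using subst[unfolded eq] by (simp add: has_integral_integrable_integral)
  qed
  then have "(\<integral>\<^sup>+s. ennreal (exp (- (t\<^sup>2 * (1 + s\<^sup>2))) / (1 + s\<^sup>2)) * indicator S s \<partial>lborel) =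
      ennreal (integral (g ` S) f)"
    by (intro nn_integral_has_integral_lebesgue') (auto simp: add_nonneg_nonneg)
  also have "\<dots> = (\<integral>\<^sup>+\<theta>. ennreal (f \<theta>) * indicator {0<..<\<beta>} \<theta> \<partial>lborel)"
    unfolding gS using f01 by (intro nn_integral_bounded_interval(2)[symmetric, where a = 0 and b = \<beta> and C = 1]) auto
  also have "\<dots> = craig t 0 \<beta>"
    by (simp add: f_def craig_open)
  finally show ?thesis by (simp add: S_def g_def)
qed

lemma std_gaussian_Complex:
  "distr (std_gaussian \<Otimes>\<^sub>M std_gaussian) borel (\<lambda>(x, y). Complex x y) = std_gaussian"
proof -
  have "surj (\<lambda>(x, y). Complex x y)"
    by (rule surjI[where f = "\<lambda>z. (Re z, Im z)"]) simp
  then show ?thesis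
    unfolding std_gaussian_prod
    by (intro std_gaussian_isometry linearI)
       (auto simp: norm_Pair cmod_def split_beta plus_complex.ctr scaleR_complex.ctr)
qed

lemma measurable_Complex[measurable]:
  "f \<in> borel_measurable M \<Longrightarrow> g \<in> borel_measurable M \<Longrightarrow> (\<lambda>x. Complex (f x) (g x)) \<in> borel_measurable M"
  by (simp add: borel_measurable_complex_iff)

lemma emeasure_std_gaussian_complex:
  assumes [measurable]: "A \<in> sets borel"
  shows "emeasure std_gaussian A =
    (\<integral>\<^sup>+y. \<integral>\<^sup>+x. ennreal (exp (- (x\<^sup>2 + y\<^sup>2)) / pi) * indicator A (Complex x y) \<partial>lborel \<partial>lborel)"
proof -
  interpret G: pair_sigma_finite "std_gaussian :: real measure" "std_gaussian :: real measure"
    by (intro pair_sigma_finite.intro prob_space_imp_sigma_finite prob_space_std_gaussian)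
  have "emeasure std_gaussian A = emeasure (distr (std_gaussian \<Otimes>\<^sub>M std_gaussian) borel (\<lambda>(x, y). Complex x y)) A"
    by (simp add: std_gaussian_Complex)
  also have "\<dots> = (\<integral>\<^sup>+p. indicator A (Complex (fst p) (snd p)) \<partial>(std_gaussian \<Otimes>\<^sub>M std_gaussian))"
    by (subst nn_integral_indicator[symmetric], simp, subst nn_integral_distr)
      (auto simp: split_beta')
  also have "\<dots> = (\<integral>\<^sup>+y. \<integral>\<^sup>+x. indicator A (Complex x y) \<partial>std_gaussian \<partial>std_gaussian)"
    by (subst G.nn_integral_snd[symmetric]) (auto simp: split_beta')
  also have "\<dots> = (\<integral>\<^sup>+y. (\<integral>\<^sup>+x. ennreal (exp (- x\<^sup>2) / sqrt pi) * indicator A (Complex x y) \<partial>lborel) \<partial>std_gaussian)"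
    by (subst (2) nn_integral_std_gaussian) (auto simp: complex_eq_iff)
  also have "\<dots> = (\<integral>\<^sup>+y. \<integral>\<^sup>+x. ennreal (exp (- y\<^sup>2) / sqrt pi) * (ennreal (exp (- x\<^sup>2) / sqrt pi) * indicator A (Complex x y)) \<partial>lborel \<partial>lborel)"
    by (subst nn_integral_std_gaussian) (auto simp: nn_integral_cmult)
  also have "\<dots> = (\<integral>\<^sup>+y. \<integral>\<^sup>+x. ennreal (exp (- (x\<^sup>2 + y\<^sup>2)) / pi) * indicator A (Complex x y) \<partial>lborel \<partial>lborel)"
    by (intro nn_integral_cong)
      (simp add: mult.assoc[symmetric] ennreal_mult'[symmetric] mult_exp_exp add.commute)
  finally show ?thesis .
qed

text \<open>Craig's formula: polar coordinates, here in the slope coordinate \<open>s = x / y = cot \<theta>\<close>,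
  turn the Gaussian mass of a truncated sector into an integral over its angle.\<close>

lemma craig_sector:
  assumes t: "t > 0" and \<beta>: "0 < \<beta>" "\<beta> \<le> pi"
  shows "emeasure std_gaussian {z. t < Im z \<and> pi / 2 - arctan (Re z / Im z) < \<beta>} =
    ennreal (1 / (2 * pi)) * craig t 0 \<beta>"
proof -
  define C where "C = {s. pi / 2 - arctan s < \<beta>}"
  have [measurable]: "arctan \<in> borel_measurable borel"
    by (intro borel_measurable_continuous_onI continuous_intros)
  have [measurable]: "C \<in> sets borel" unfolding C_def by measurable
  have [measurable]: "Measurable.pred borel (\<lambda>s. s \<in> C)" by measurable
  \<comment> \<open>The substitution x = y s for fixed y > 0, with Jacobian y.\<close>
  have sub: "(\<integral>\<^sup>+x. ennreal (exp (- (x\<^sup>2 + y\<^sup>2)) / pi) * indicator C (x / y) \<partial>lborel) =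
     (\<integral>\<^sup>+s. ennreal (y * exp (- (y\<^sup>2 * (1 + s\<^sup>2))) / pi) * indicator C s \<partial>lborel)" if "y > 0" for y
  proof -
    have "(\<integral>\<^sup>+x. ennreal (exp (- (x\<^sup>2 + y\<^sup>2)) / pi) * indicator C (x / y) \<partial>lborel) =
       ennreal \<bar>y\<bar> * (\<integral>\<^sup>+s. ennreal (exp (- ((0 + y * s)\<^sup>2 + y\<^sup>2)) / pi) * indicator C ((0 + y * s) / y) \<partial>lborel)"
      using that by (intro nn_integral_real_affine) auto
    also have "\<dots> = (\<integral>\<^sup>+s. ennreal y * (ennreal (exp (- ((y * s)\<^sup>2 + y\<^sup>2)) / pi) * indicator C s) \<partial>lborel)"
      using that by (subst nn_integral_cmult) auto
    also have "\<dots> = (\<integral>\<^sup>+s. ennreal (y * exp (- (y\<^sup>2 * (1 + s\<^sup>2))) / pi) * indicator C s \<partial>lborel)"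
    proof (rule nn_integral_cong)
      fix s :: real
      have "(y * s)\<^sup>2 + y\<^sup>2 = y\<^sup>2 * (1 + s\<^sup>2)" by (simp add: power_mult_distrib distrib_left)
      then show "ennreal y * (ennreal (exp (- ((y * s)\<^sup>2 + y\<^sup>2)) / pi) * indicator C s) =
          ennreal (y * exp (- (y\<^sup>2 * (1 + s\<^sup>2))) / pi) * indicator C s"
        using that by (simp only:) (simp add: mult.assoc[symmetric] ennreal_mult'[symmetric] del: distrib_left)
    qed
    finally show ?thesis .
  qed
  define K where "K = (\<lambda>y s::real. ennreal (y * exp (- (y\<^sup>2 * (1 + s\<^sup>2))) / pi))"
  have [measurable]: "(\<lambda>x. K (f x) (g x)) \<in> borel_measurable N"
    if "f \<in> borel_measurable N" "g \<in> borel_measurable N" for f g and N :: "'z measure"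
    using that unfolding K_def by measurable
  \<comment> \<open>The Jacobian y makes the integrand an exact derivative. What remains is the
    integrand of \<open>craig_cot_substitution\<close>, up to the constant 1 / (2 pi).\<close>
  have inner: "(\<integral>\<^sup>+y. ennreal (y * exp (- (y\<^sup>2 * (1 + s\<^sup>2))) / pi) * indicator {t<..} y \<partial>lborel) =
     ennreal (exp (- (t\<^sup>2 * (1 + s\<^sup>2))) / (1 + s\<^sup>2)) * ennreal (1 / (2 * pi))" for s
  proof -
    have s: "0 < 1 + s\<^sup>2" by (simp add: add_pos_nonneg)
    let ?F = "\<lambda>y. - exp (- (y\<^sup>2 * (1 + s\<^sup>2))) / (2 * pi * (1 + s\<^sup>2))"
    have "(\<integral>\<^sup>+y. ennreal (y * exp (- (y\<^sup>2 * (1 + s\<^sup>2))) / pi) * indicator {t<..} y \<partial>lborel) =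
       (\<integral>\<^sup>+y. ennreal (y * exp (- (y\<^sup>2 * (1 + s\<^sup>2))) / pi) * indicator {t..} y \<partial>lborel)"
      by (rule nn_integral_cong_AE, use AE_lborel_singleton[of t] in eventually_elim) (auto simp: indicator_def)
    also have "\<dots> = ennreal (0 - ?F t)"
    proof (rule nn_integral_FTC_atLeast)
      show "DERIV ?F y :> y * exp (- (y\<^sup>2 * (1 + s\<^sup>2))) / pi" for y
      proof -
        have "DERIV (\<lambda>y. - exp (- (y\<^sup>2 * k)) / (2 * pi * k)) y :> y * exp (- (y\<^sup>2 * k)) / pi" if "k > 0" for k
          using that by (auto intro!: derivative_eq_intros simp: field_simps)
        then show ?thesis using s by blast
      qed
      have "LIM y at_top. y\<^sup>2 * (1 + s\<^sup>2) :> (at_top :: real filter)"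
        using s by (intro filterlim_at_top_mult_tendsto_pos[where c = "1 + s\<^sup>2"] tendsto_const
            filterlim_pow_at_top filterlim_ident) auto
      then have "((\<lambda>y. exp (- (y\<^sup>2 * (1 + s\<^sup>2)))) \<longlongrightarrow> 0) at_top"
        by (intro filterlim_compose[OF exp_at_bot]) (simp add: filterlim_uminus_at_bot)
      from tendsto_mult_left[OF this, of "- 1 / (2 * pi * (1 + s\<^sup>2))"]
      show "(?F \<longlongrightarrow> 0) at_top" by simp
    qed (use t in auto)
    also have "\<dots> = ennreal (exp (- (t\<^sup>2 * (1 + s\<^sup>2))) / (1 + s\<^sup>2)) * ennreal (1 / (2 * pi))"
      using s by (simp add: ennreal_mult'[symmetric] field_simps)
    finally show ?thesis .
  qed
  then have inner': "(\<integral>\<^sup>+y. K y s * indicator {t<..} y \<partial>lborel) =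
     ennreal (exp (- (t\<^sup>2 * (1 + s\<^sup>2))) / (1 + s\<^sup>2)) * ennreal (1 / (2 * pi))" for s
    by (simp add: K_def)
  have mA: "{z. t < Im z \<and> pi / 2 - arctan (Re z / Im z) < \<beta>} \<in> sets borel" by measurable
  have "emeasure std_gaussian {z. t < Im z \<and> pi / 2 - arctan (Re z / Im z) < \<beta>} =
    (\<integral>\<^sup>+y. (\<integral>\<^sup>+x. ennreal (exp (- (x\<^sup>2 + y\<^sup>2)) / pi) * indicator C (x / y) \<partial>lborel) * indicator {t<..} y \<partial>lborel)"
    by (subst emeasure_std_gaussian_complex[OF mA])
      (auto intro!: nn_integral_cong simp: indicator_def C_def nn_integral_multc split: if_splits)
  also have "\<dots> = (\<integral>\<^sup>+y. (\<integral>\<^sup>+s. K y s * indicator C s \<partial>lborel) * indicator {t<..} y \<partial>lborel)"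
  proof (rule nn_integral_cong)
    fix y
    show "(\<integral>\<^sup>+x. ennreal (exp (- (x\<^sup>2 + y\<^sup>2)) / pi) * indicator C (x / y) \<partial>lborel) * indicator {t<..} y =
      (\<integral>\<^sup>+s. K y s * indicator C s \<partial>lborel) * indicator {t<..} y"
      using t sub[of y] by (cases "t < y") (simp_all add: K_def)
  qed
  also have "\<dots> = (\<integral>\<^sup>+y. (\<integral>\<^sup>+s. K y s * indicator C s * indicator {t<..} y \<partial>lborel) \<partial>lborel)"
    by (simp add: nn_integral_multc)
  also have "\<dots> = (\<integral>\<^sup>+s. (\<integral>\<^sup>+y. K y s * indicator C s * indicator {t<..} y \<partial>lborel) \<partial>lborel)"
    by (rule lborel_pair.Fubini') measurable
  also have "\<dots> = (\<integral>\<^sup>+s. (\<integral>\<^sup>+y. K y s * indicator {t<..} y * indicator C s \<partial>lborel) \<partial>lborel)"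
    by (simp add: mult_ac)
  also have "\<dots> = (\<integral>\<^sup>+s. ennreal (exp (- (t\<^sup>2 * (1 + s\<^sup>2))) / (1 + s\<^sup>2)) * ennreal (1 / (2 * pi)) * indicator C s \<partial>lborel)"
    by (simp add: nn_integral_multc inner')
  also have "\<dots> = (\<integral>\<^sup>+s. ennreal (1 / (2 * pi)) * (ennreal (exp (- (t\<^sup>2 * (1 + s\<^sup>2))) / (1 + s\<^sup>2)) * indicator C s) \<partial>lborel)"
    by (simp add: mult_ac)
  also have "\<dots> = ennreal (1 / (2 * pi)) * craig t 0 \<beta>"
    by (subst nn_integral_cmult) (auto simp: C_def craig_cot_substitution[OF \<beta>])
  finally show ?thesis .
qed

section \<open>Symmetries and tails of the Gaussian on the complex plane\<close>

lemma measure_std_gaussian_vimage: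
  fixes f :: "'a::euclidean_space \<Rightarrow> 'b::euclidean_space"
  assumes f: "linear f" and g: "linear g" and fg: "\<And>y. f (g y) = y"
    and adj: "\<And>x y. f x \<bullet> y = x \<bullet> g y" and A: "A \<in> sets borel"
  shows "measure std_gaussian {x. f x \<in> A} = measure std_gaussian A"
proof -
  have "f \<in> borel_measurable borel" using f by (rule linear_borel_measurable)
  then have "measure (distr std_gaussian borel f) A = measure std_gaussian {x. f x \<in> A}"
    using A by (subst measure_distr) (auto simp: vimage_def)
  then show ?thesis
    by (simp add: std_gaussian_coisometry[OF f g fg adj])
qed

lemma measure_std_gaussian_unimodular:
  fixes u :: complex
  assumes u: "cmod u = 1" and A: "A \<in> sets borel"
  shows "measure std_gaussian {z. u * z \<in> A} = measure std_gaussian A"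
proof (rule measure_std_gaussian_vimage[where g = "\<lambda>z. cnj u * z", OF _ _ _ _ A])
  have "u * cnj u = 1" using complex_norm_square[of u] u by simp
  then show "u * (cnj u * y) = y" for y by (simp add: mult.assoc[symmetric])
  show "(u * x) \<bullet> y = x \<bullet> (cnj u * y)" for x y
    by (simp add: inner_complex_def algebra_simps)
qed (auto intro!: linearI simp: algebra_simps)

lemma measure_std_gaussian_cnj:
  assumes A: "A \<in> sets borel"
  shows "measure std_gaussian {z. cnj z \<in> A} = measure std_gaussian A"
  by (rule measure_std_gaussian_vimage[where g = cnj, OF _ _ _ _ A])
     (auto intro!: linearI simp: inner_complex_def)

lemma AE_std_gaussian_hyperplane:
  fixes a :: "'a::euclidean_space"
  assumes "a \<noteq> 0"
  shows "AE x in std_gaussian. a \<bullet> x \<noteq> b"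
proof -
  have "negligible {x. a \<bullet> x = b}" using assms by (intro negligible_hyperplane) auto
  then have "AE x in lebesgue. x \<notin> {x. a \<bullet> x = b}"
    by (simp only: negligible_iff_null_sets AE_not_in)
  then have "AE x in lborel. a \<bullet> x \<noteq> b"
    by (simp add: AE_completion_iff)
  then show ?thesis
    unfolding std_gaussian_def by (subst AE_density) auto
qed

definition craig_integral :: "real \<Rightarrow> real \<Rightarrow> real \<Rightarrow> real"
  where "craig_integral t a b = integral {a..b} (\<lambda>\<theta>. exp (- (t\<^sup>2 / (sin \<theta>)\<^sup>2)))"

lemma craig_integrand_integrable: "(\<lambda>\<theta>. exp (- (t\<^sup>2 / (sin \<theta>)\<^sup>2))) integrable_on {a..b::real}"
  by (intro set_lebesgue_integral_eq_integral(1) nn_integral_bounded_interval(1)[where a = a and b = b and C = 1]) auto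

lemma craig_eq_craig_integral: "craig t a b = ennreal (craig_integral t a b)"
  unfolding craig_def craig_integral_def
  by (intro nn_integral_bounded_interval(2)[where a = a and b = b and C = 1]) auto

lemma craig_integral_nonneg: "0 \<le> craig_integral t a b"
  unfolding craig_integral_def by (intro integral_nonneg craig_integrand_integrable) auto

lemma craig_integral_split:
  assumes "a \<le> c" "c \<le> b"
  shows "craig_integral t a b = craig_integral t a c + craig_integral t c b"
  unfolding craig_integral_def using assms
  by (intro Henstock_Kurzweil_Integration.integral_combine[symmetric] craig_integrand_integrable)

text \<open>The reflection \<theta> to pi - \<theta> leaves sin^2 \<theta> unchanged.\<close>

lemma craig_integral_pi: "craig_integral t 0 pi = 2 * craig_integral t 0 (pi / 2)"
proof -
  have "craig_integral t (pi / 2) pi = craig_integral t 0 (pi / 2)"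
  proof -
    have "craig t (pi / 2) pi = ennreal \<bar>-1\<bar> * (\<integral>\<^sup>+\<theta>. ennreal (exp (- (t\<^sup>2 / (sin (pi + -1 * \<theta>))\<^sup>2))) *
        indicator {pi / 2..pi} (pi + -1 * \<theta>) \<partial>lborel)"
      unfolding craig_def by (rule nn_integral_real_affine) auto
    also have "\<dots> = craig t 0 (pi / 2)"
      by (auto simp: craig_def indicator_def intro!: nn_integral_cong)
    finally show ?thesis
      by (simp add: craig_eq_craig_integral craig_integral_nonneg)
  qed
  then show ?thesis
    using craig_integral_split[of 0 "pi / 2" pi t] by simp
qed

text \<open>With variance 1/2 this is the Gaussian Q-function at sqrt 2 t, that is, half the
  complementary error function at t.\<close>

definition gauss_tail :: "real \<Rightarrow> real"
  where "gauss_tail t = measure std_gaussian {t<..}"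

lemma measure_craig_sector:
  assumes "t > 0" "0 < \<beta>" "\<beta> \<le> pi"
  shows "measure std_gaussian {z. t < Im z \<and> pi / 2 - arctan (Re z / Im z) < \<beta>} =
    craig_integral t 0 \<beta> / (2 * pi)"
  using craig_sector[OF assms] craig_integral_nonneg[of t 0 \<beta>]
  by (simp add: measure_def craig_eq_craig_integral ennreal_mult'[symmetric])

lemma measure_std_gaussian_Im: "A \<in> sets borel \<Longrightarrow> measure std_gaussian {z. Im z \<in> A} = measure std_gaussian A"
  and measure_std_gaussian_Re: "A \<in> sets borel \<Longrightarrow> measure std_gaussian {z. Re z \<in> A} = measure std_gaussian A"
  by (rule measure_std_gaussian_vimage[where g = "\<lambda>y. Complex 0 y"];
       simp add: linear_iff inner_complex_def complex_eq_iff)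
     (rule measure_std_gaussian_vimage[where g = "\<lambda>y. Complex y 0"];
       simp add: linear_iff inner_complex_def complex_eq_iff)

text \<open>A half plane is the truncated sector of full angle \<beta> = pi, since arctan stays
  above - pi / 2.\<close>

lemma gauss_tail_craig:
  assumes "t > 0"
  shows "gauss_tail t = craig_integral t 0 (pi / 2) / pi"
proof -
  have "{z. t < Im z \<and> pi / 2 - arctan (Re z / Im z) < pi} = {z. Im z \<in> {t<..}}"
  proof -
    have "pi / 2 - arctan x < pi" for x using arctan_lbound[of x] by simp
    then show ?thesis by auto
  qed
  then have "measure std_gaussian {z. Im z \<in> {t<..}} = craig_integral t 0 pi / (2 * pi)"
    using measure_craig_sector[OF assms, of pi] by simp
  then show ?thesis
    using measure_std_gaussian_Im[of "{t<..}"] by (simp add: gauss_tail_def craig_integral_pi)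
qed

lemma measure_std_gaussian_Re_Im:
  assumes [measurable]: "A \<in> sets borel" "B \<in> sets borel"
  shows "measure std_gaussian {z. Re z \<in> A \<and> Im z \<in> B} = measure std_gaussian A * measure std_gaussian B"
proof -
  have "emeasure std_gaussian {z. Re z \<in> A \<and> Im z \<in> B} =
     emeasure (distr (std_gaussian \<Otimes>\<^sub>M std_gaussian) borel (\<lambda>(x, y). Complex x y)) {z. Re z \<in> A \<and> Im z \<in> B}"
    by (simp add: std_gaussian_Complex)
  also have "\<dots> = emeasure (std_gaussian \<Otimes>\<^sub>M std_gaussian) (A \<times> B)"
  proof (subst emeasure_distr)
    show "emeasure (std_gaussian \<Otimes>\<^sub>M std_gaussian)
        ((\<lambda>(x, y). Complex x y) -` {z. Re z \<in> A \<and> Im z \<in> B} \<inter> space (std_gaussian \<Otimes>\<^sub>M std_gaussian)) =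
      emeasure (std_gaussian \<Otimes>\<^sub>M std_gaussian) (A \<times> B)"
      by (rule arg_cong[where f = "emeasure _"]) (auto simp: space_pair_measure)
  qed (simp_all add: split_beta')
  also have "\<dots> = emeasure std_gaussian A * emeasure std_gaussian B"
    by (rule std_gaussian.emeasure_pair_measure_Times) auto
  finally show ?thesis by (simp add: measure_def enn2real_mult)
qed

text \<open>By independence the square is the mass of the quadrant in which both coordinates exceed
  t. The diagonal, a null set, cuts the quadrant into two mirror images, each a truncated sector of
  angle pi / 4.\<close>

lemma gauss_tail_sq_craig:
  assumes t: "t > 0"
  shows "(gauss_tail t)\<^sup>2 = craig_integral t 0 (pi / 4) / pi"
proof -
  define A where "A = {z. t < Im z \<and> pi / 2 - arctan (Re z / Im z) < pi / 4}"
  have A: "A = {z. t < Im z \<and> Im z < Re z}"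
  proof -
    have "pi / 2 - arctan x < pi / 4 \<longleftrightarrow> 1 < x" for x
    proof -
      have "arctan 1 < arctan x \<longleftrightarrow> 1 < x" by (rule arctan_less_iff)
      then show ?thesis unfolding arctan_one by linarith
    qed
    moreover have "1 < Re z / Im z \<longleftrightarrow> Im z < Re z" if "t < Im z" for z
      using t that by (intro less_divide_eq_1_pos) simp
    ultimately show ?thesis by (auto simp: A_def)
  qed
  define A' where "A' = {z. t < Re z \<and> Re z < Im z}"
  have [measurable]: "A \<in> sets borel" "A' \<in> sets borel" unfolding A A'_def by measurable
  have sw: "measure std_gaussian A' = measure std_gaussian A"
  proof -
    \<comment> \<open>The map z to \<open>\<i> * cnj z\<close> exchanges real and imaginary
      parts.\<close>
    have "A' = {z. cnj z \<in> {z. \<i> * z \<in> A}}" by (auto simp: A A'_def)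
    moreover have "{z. \<i> * z \<in> A} \<in> sets borel" by measurable
    ultimately have "measure std_gaussian A' = measure std_gaussian {z. \<i> * z \<in> A}"
      using measure_std_gaussian_cnj by blast
    then show ?thesis
      using measure_std_gaussian_unimodular[of \<i> A] by simp
  qed
  have "(gauss_tail t)\<^sup>2 = measure std_gaussian {z. Re z \<in> {t<..} \<and> Im z \<in> {t<..}}"
    by (subst measure_std_gaussian_Re_Im) (auto simp: gauss_tail_def power2_eq_square)
  also have "\<dots> = measure std_gaussian (A \<union> A')"
  proof (rule std_gaussian.finite_measure_eq_AE)
    have "AE z in std_gaussian. Complex 1 (-1) \<bullet> z \<noteq> 0"
      by (rule AE_std_gaussian_hyperplane) (simp add: complex_eq_iff)
    then show "AE z in std_gaussian. (z \<in> {z. Re z \<in> {t<..} \<and> Im z \<in> {t<..}}) = (z \<in> A \<union> A')"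
    proof eventually_elim
      fix z assume "Complex 1 (-1) \<bullet> z \<noteq> 0"
      then have "Re z \<noteq> Im z" by (simp add: inner_complex_def)
      then show "(z \<in> {z. Re z \<in> {t<..} \<and> Im z \<in> {t<..}}) = (z \<in> A \<union> A')"
        unfolding A A'_def by (simp, linarith)
    qed
  qed (simp_all)
  also have "\<dots> = measure std_gaussian A + measure std_gaussian A'"
    by (rule std_gaussian.finite_measure_Union) (auto simp: A A'_def)
  also have "\<dots> = craig_integral t 0 (pi / 4) / pi"
    using measure_craig_sector[OF t, of "pi / 4", folded A_def] by (simp add: sw)
  finally show ?thesis .
qed

subsection \<open>Nearest-point decisions\<close>

lemma decide_mem:
  assumes "finite S" "S \<noteq> {}"
  shows "decide S z \<in> S" and "c \<in> S \<Longrightarrow> cmod (z - decide S z) \<le> cmod (z - c)"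
proof -
  show "decide S z \<in> S"
    unfolding decide_def using assms by (rule arg_min_if_finite(1))
  assume "c \<in> S"
  then have "(cmod (z - decide S z))\<^sup>2 \<le> (cmod (z - c))\<^sup>2"
    unfolding decide_def using assms by (intro arg_min_least)
  then show "cmod (z - decide S z) \<le> cmod (z - c)"
    by (rule power2_le_imp_le) simp
qed

text \<open>The choice in \<^const>\<open>arg_min_on\<close> depends on \<open>z\<close> only through the set of nearest points.\<close>

lemma decide_borel_measurable:
  assumes "finite S"
  shows "{z. decide S z = c} \<in> sets borel"
proof -
  define N where "N = (\<lambda>z. {a\<in>S. \<forall>b\<in>S. cmod (z - a) \<le> cmod (z - b)})"
  have dec: "decide S z = (SOME a. a \<in> N z)" for z
    by (auto simp: decide_def arg_min_on_def arg_min_def is_arg_min_linorder N_def Ball_def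
        intro!: arg_cong[where f = Eps])
  have "{z. N z = A} \<in> sets borel" if "A \<subseteq> S" for A
  proof -
    have "{z. N z = A} = {z. \<forall>a\<in>S. (a \<in> A) = (\<forall>b\<in>S. cmod (z - a) \<le> cmod (z - b))}"
      using that unfolding N_def by blast
    also have "\<dots> \<in> sets borel"
      using assms by measurable
    finally show ?thesis .
  qed
  then have "(\<Union>A\<in>{A. A \<subseteq> S \<and> (SOME a. a \<in> A) = c}. {z. N z = A}) \<in> sets borel"
    using assms by (intro sets.finite_UN) auto
  also have "(\<Union>A\<in>{A. A \<subseteq> S \<and> (SOME a. a \<in> A) = c}. {z. N z = A}) = {z. decide S z = c}"
    unfolding dec by (auto simp: N_def)
  finally show ?thesis .
qed

text \<open>A tie between \<open>c\<close> and another point confines the noise to a line, hence to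
  a null set. Off these finitely many lines the choice inside \<open>decide\<close> has no influence
  on whether \<open>c\<close> is chosen.\<close>

lemma measure_decide_error:
  assumes S: "finite S" "c \<in> S" and r: "r > 0"
  shows "measure std_gaussian {z. decide S (c + complex_of_real r * z) \<noteq> c} =
    measure std_gaussian {z. \<exists>c'\<in>S. cmod (c - c' + complex_of_real r * z) < cmod (complex_of_real r * z)}"
proof (rule std_gaussian.finite_measure_eq_AE)
  have "(\<lambda>z. c + complex_of_real r * z) -` {z. decide S z = c} \<inter> space borel \<in> sets borel"
    by (rule measurable_sets[OF _ decide_borel_measurable[OF S(1)]]) measurable
  then have "{z. decide S (c + complex_of_real r * z) = c} \<in> sets borel" by (simp add: vimage_def)
  then have "- {z. decide S (c + complex_of_real r * z) = c} \<in> sets borel" by simp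
  then show "{z. decide S (c + complex_of_real r * z) \<noteq> c} \<in> sets std_gaussian"
    by (simp add: Compl_eq)
  show "{z. \<exists>c'\<in>S. cmod (c - c' + complex_of_real r * z) < cmod (complex_of_real r * z)} \<in> sets std_gaussian"
    using S(1) by (simp, measurable)
  have "AE z in std_gaussian. \<forall>c'\<in>S. c' \<noteq> c \<longrightarrow>
     cmod (c - c' + complex_of_real r * z) \<noteq> cmod (complex_of_real r * z)"
  proof (rule AE_finite_allI[OF S(1)])
    fix c' assume "c' \<in> S"
    show "AE z in std_gaussian. c' \<noteq> c \<longrightarrow>
       cmod (c - c' + complex_of_real r * z) \<noteq> cmod (complex_of_real r * z)"
    proof (cases "c' = c")
      case False
      then have "(2 * r) *\<^sub>R (c - c') \<noteq> 0" using r by simp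
      then have "AE z in std_gaussian. ((2 * r) *\<^sub>R (c - c')) \<bullet> z \<noteq> - ((cmod (c - c'))\<^sup>2)"
        by (rule AE_std_gaussian_hyperplane)
      then show ?thesis
      proof eventually_elim
        case (elim z)
        \<comment> \<open>The quadratic terms in z agree on both sides, so equidistance is an affine
          condition on z.\<close>
        have "(cmod (c - c' + complex_of_real r * z))\<^sup>2 =
          (cmod (c - c'))\<^sup>2 + ((2 * r) *\<^sub>R (c - c')) \<bullet> z + (cmod (complex_of_real r * z))\<^sup>2"
          unfolding cmod_power2 by (simp add: inner_complex_def power2_eq_square algebra_simps)
        then show ?case using elim by auto
      qed
    qed simp
  qed
  then show "AE z in std_gaussian. (z \<in> {z. decide S (c + complex_of_real r * z) \<noteq> c}) =
     (z \<in> {z. \<exists>c'\<in>S. cmod (c - c' + complex_of_real r * z) < cmod (complex_of_real r * z)})"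
  proof eventually_elim
    case (elim z)
    let ?w = "c + complex_of_real r * z"
    have ne: "S \<noteq> {}" using S by auto
    have eq: "?w - c' = c - c' + complex_of_real r * z" for c' by simp
    note d = decide_mem[OF S(1) ne, where z = ?w, unfolded eq]
    show ?case
    proof (intro iffI; clarsimp)
      assume "decide S ?w \<noteq> c"
      then show "\<exists>c'\<in>S. cmod (c - c' + complex_of_real r * z) < cmod (complex_of_real r * z)"
        using d(1) d(2)[OF S(2)] elim by (intro bexI[of _ "decide S ?w"]) auto
    next
      fix c' assume "decide S ?w = c" "c' \<in> S" "cmod (c - c' + complex_of_real r * z) < cmod (complex_of_real r * z)"
      then show False using d(2)[of c'] by simp
    qed
  qed
qed

text \<open>Squares turn a comparison of planar distances into one of sums over the two coordinates,
  which is the form needed for PAM and QAM.\<close>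

lemma measure_decide_error_mult:
  assumes S: "finite S" "c \<in> S" and r: "r > 0"
  shows "measure std_gaussian {z. decide S (c + complex_of_real r * z) \<noteq> c} =
    measure std_gaussian {z. \<exists>c'\<in>S. (cmod (c - c' + complex_of_real r * z))\<^sup>2 < (cmod (complex_of_real r * z))\<^sup>2}"
proof -
  have "cmod a < cmod b \<longleftrightarrow> (cmod a)\<^sup>2 < (cmod b)\<^sup>2" for a b
    using power_strict_mono[of "cmod a" "cmod b" 2] power_less_imp_less_base[of "cmod a" 2 "cmod b"] by auto
  then show ?thesis
    unfolding measure_decide_error[OF assms] by simp
qed

subsection \<open>Equidistant levels\<close>

text \<open>The one-dimensional grid, of spacing 2 \<delta>, behind both PAM and each coordinate of
  QAM; the index runs from 1 to \<open>q\<close>.\<close>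

definition level :: "nat \<Rightarrow> real \<Rightarrow> nat \<Rightarrow> real"
  where "level q \<delta> i = \<delta> * (2 * real i - 1 - real q)"

definition level_error :: "nat \<Rightarrow> real \<Rightarrow> real \<Rightarrow> nat \<Rightarrow> real set"
  where "level_error q \<delta> r i = {x. \<exists>j\<in>{1..q}. (level q \<delta> i - level q \<delta> j + r * x)\<^sup>2 < (r * x)\<^sup>2}"

text \<open>For k = i - j the difference of the two squares is 4 \<delta> k (\<delta> k + r x). If
  it is negative for some k, then it is already negative for the neighbour on the same side, k = 1
  or k = -1. The outermost levels lack one neighbour, hence the two conditions.\<close>

lemma level_error_eq:
  assumes \<delta>: "\<delta> > 0" and i: "i \<in> {1..q}" and r: "r > 0"
  shows "level_error q \<delta> r i = (if i < q then {\<delta> / r<..} else {}) \<union> (if 1 < i then {..< - (\<delta> / r)} else {})"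
proof (intro equalityI subsetI)
  fix x assume "x \<in> level_error q \<delta> r i"
  then obtain j where j: "j \<in> {1..q}" "(level q \<delta> i - level q \<delta> j + r * x)\<^sup>2 < (r * x)\<^sup>2"
    by (auto simp: level_error_def)
  define k where "k = real i - real j"
  have "level q \<delta> i - level q \<delta> j = 2 * \<delta> * k"
    by (simp add: level_def k_def algebra_simps)
  then have "4 * \<delta> * (k * (\<delta> * k + r * x)) < 0"
    using j(2) by (simp add: power2_eq_square algebra_simps)
  then have neg: "k * (\<delta> * k + r * x) < 0"
    using \<delta> by (simp add: mult_less_0_iff)
  consider "i < j" | "j < i" using neg by (cases i j rule: linorder_cases) (auto simp: k_def)
  then show "x \<in> (if i < q then {\<delta> / r<..} else {}) \<union> (if 1 < i then {..< - (\<delta> / r)} else {})"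
  proof cases
    case 1
    then have "k \<le> -1" by (simp add: k_def)
    then have "\<delta> * k \<le> \<delta> * (-1)" using \<delta> by (intro mult_left_mono) auto
    moreover have "\<delta> * k + r * x > 0" using neg \<open>k \<le> -1\<close> by (simp add: mult_less_0_iff)
    ultimately have "\<delta> < r * x" by simp
    then show ?thesis using 1 j(1) r by (auto simp: field_simps)
  next
    case 2
    then have "k \<ge> 1" by (simp add: k_def)
    then have "\<delta> * k \<ge> \<delta> * 1" using \<delta> by (intro mult_left_mono) auto
    moreover have "\<delta> * k + r * x < 0" using neg \<open>k \<ge> 1\<close> by (simp add: mult_less_0_iff)
    ultimately have "r * x < - \<delta>" by simp
    then show ?thesis using 2 j(1) r by (auto simp: field_simps)
  qed
next
  fix x assume x: "x \<in> (if i < q then {\<delta> / r<..} else {}) \<union> (if 1 < i then {..< - (\<delta> / r)} else {})"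
  then consider "i < q" "\<delta> < r * x" | "1 < i" "r * x < - \<delta>"
    using r by (auto split: if_splits simp: field_simps)
  then show "x \<in> level_error q \<delta> r i"
  proof cases
    case 1
    have "level q \<delta> i - level q \<delta> (Suc i) = - 2 * \<delta>" by (simp add: level_def algebra_simps)
    moreover have "4 * \<delta> * (\<delta> - r * x) < 0" using 1 \<delta> by (simp add: mult_less_0_iff)
    moreover have "(- 2 * \<delta> + r * x)\<^sup>2 = (r * x)\<^sup>2 + 4 * \<delta> * (\<delta> - r * x)"
      by (simp add: power2_eq_square algebra_simps)
    ultimately have "(level q \<delta> i - level q \<delta> (Suc i) + r * x)\<^sup>2 < (r * x)\<^sup>2"
      by (simp only:)
    then show ?thesis using 1 by (auto simp: level_error_def intro!: bexI[of _ "Suc i"])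
  next
    case 2
    have "level q \<delta> i - level q \<delta> (i - 1) = 2 * \<delta>" using 2 by (simp add: level_def of_nat_diff algebra_simps)
    moreover have "4 * \<delta> * (\<delta> + r * x) < 0" using 2 \<delta> by (simp add: mult_less_0_iff)
    moreover have "(2 * \<delta> + r * x)\<^sup>2 = (r * x)\<^sup>2 + 4 * \<delta> * (\<delta> + r * x)"
      by (simp add: power2_eq_square algebra_simps)
    ultimately have "(level q \<delta> i - level q \<delta> (i - 1) + r * x)\<^sup>2 < (r * x)\<^sup>2"
      by (simp only:)
    then show ?thesis using 2 i by (auto simp: level_error_def intro!: bexI[of _ "i - 1"])
  qed
qed

lemma measure_std_gaussian_lower_tail:
  "measure (std_gaussian :: real measure) {..< - t} = gauss_tail t"
proof -
  have "measure std_gaussian {x::real. - x \<in> {t<..}} = measure std_gaussian {t<..}"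
    by (rule measure_std_gaussian_vimage[where g = uminus]) (auto intro: linearI)
  also have "{x::real. - x \<in> {t<..}} = {..< - t}" by auto
  finally show ?thesis by (simp add: gauss_tail_def)
qed

lemma level_error_borel:
  assumes "\<delta> > 0" "i \<in> {1..q}" "r > 0"
  shows "level_error q \<delta> r i \<in> sets borel"
  using assms by (simp add: level_error_eq)

lemma measure_level_error:
  assumes "\<delta> > 0" "i \<in> {1..q}" "r > 0"
  shows "measure std_gaussian (level_error q \<delta> r i) =
    (if i < q then gauss_tail (\<delta> / r) else 0) + (if 1 < i then gauss_tail (\<delta> / r) else 0)"
proof -
  have "measure std_gaussian ({\<delta> / r<..} \<union> {..< - (\<delta> / r)}) =
      measure std_gaussian {\<delta> / r<..} + measure std_gaussian {..< - (\<delta> / r)}"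
  proof (intro std_gaussian.finite_measure_Union)
    have "0 < \<delta> / r" using assms by simp
    then show "{\<delta> / r<..} \<inter> {..< - (\<delta> / r)} = {}" by (auto dest: less_trans)
  qed simp_all
  then show ?thesis
    using assms by (auto simp: level_error_eq gauss_tail_def measure_std_gaussian_lower_tail[unfolded gauss_tail_def])
qed

text \<open>Exactly q - 1 levels have an upper neighbour and q - 1 have a lower one, and each
  neighbour costs one tail.\<close>

lemma sum_measure_level_error:
  assumes "\<delta> > 0" "r > 0" "q \<ge> 1"
  shows "(\<Sum>i=1..q. measure std_gaussian (level_error q \<delta> r i)) = 2 * (real q - 1) * gauss_tail (\<delta> / r)"
proof -
  let ?Q = "gauss_tail (\<delta> / r)"
  have "(\<Sum>i=1..q. measure std_gaussian (level_error q \<delta> r i)) =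
     (\<Sum>i=1..q. (if i < q then ?Q else 0) + (if 1 < i then ?Q else 0))"
    using assms by (intro sum.cong) (auto simp: measure_level_error)
  also have "\<dots> = (\<Sum>i\<in>{1..<q}. ?Q) + (\<Sum>i\<in>{1<..q}. ?Q)"
    unfolding sum.distrib using assms
    by (intro arg_cong2[where f = "(+)"] sum.mono_neutral_cong_right) auto
  also have "\<dots> = 2 * (real q - 1) * ?Q"
    using assms by (simp add: of_nat_diff)
  finally show ?thesis .
qed

subsection \<open>Symbol error probabilities over the additive noise channel\<close>

text \<open>Together with \<open>mod_gain\<close> this brings the three modulations to the single
  form of a weighted integral over \<theta>, so that conditioning, averaging and convexity are
  treated once. The two QAM intervals overlap only in the point pi / 4.\<close>

fun mod_weight :: "modulation \<Rightarrow> nat \<Rightarrow> real \<Rightarrow> real"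
  where
    "mod_weight PAM M \<theta> = 2 * (real M - 1) / (real M * pi) * indicator {0..pi/2} \<theta>"
  | "mod_weight PSK M \<theta> = 1 / pi * indicator {0..(real M - 1) * pi / real M} \<theta>"
  | "mod_weight QAM M \<theta> = 4 * (sqrt (real M) - 1) / (sqrt (real M) * pi) * indicator {pi/4..pi/2} \<theta>
      + 4 * (sqrt (real M) - 1) / (real M * pi) * indicator {0..pi/4} \<theta>"

text \<open>In all three cases this is the squared half distance of neighbouring constellation
  points: \<delta>^2 for the two grids, sin^2 (pi / M) on the circle.\<close>

fun mod_gain :: "modulation \<Rightarrow> nat \<Rightarrow> real"
  where
    "mod_gain PAM M = 3 / ((real M)\<^sup>2 - 1)"
  | "mod_gain PSK M = (sin (pi / real M))\<^sup>2"
  | "mod_gain QAM M = 3 / (2 * (real M - 1))"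

lemma valid_order_ge_2: "valid_order md M \<Longrightarrow> M \<ge> 2"
proof (cases md)
  case QAM
  assume "valid_order md M"
  then obtain q where "q \<ge> 2" "M = q\<^sup>2" using QAM by auto
  then show ?thesis using power_mono[of 2 q 2] by simp
qed simp_all

lemma mod_gain_pos:
  assumes "valid_order md M"
  shows "mod_gain md M > 0"
proof -
  have M: "real M \<ge> 2" using valid_order_ge_2[OF assms] by simp
  have "(real M)\<^sup>2 \<ge> 2\<^sup>2" using M by (intro power_mono) auto
  moreover have "sin (pi / real M) > 0"
    using M by (intro sin_gt_zero) (auto simp: field_simps)
  ultimately show ?thesis using M by (cases md) auto
qed

lemma mod_weight_nonneg:
  assumes "valid_order md M"
  shows "mod_weight md M \<theta> \<ge> 0"
  using valid_order_ge_2[OF assms] by (cases md) (auto intro!: add_nonneg_nonneg mult_nonneg_nonneg)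

lemma mod_weight_borel_measurable[measurable]: "mod_weight md M \<in> borel_measurable borel"
  by (cases md) (simp_all add: fun_eq_iff[symmetric] cong: measurable_cong)

lemma measure_std_gaussian_Compl:
  "A \<in> sets borel \<Longrightarrow> measure (std_gaussian :: 'a::euclidean_space measure) (- A) = 1 - measure std_gaussian A"
  using std_gaussian.prob_compl[of A] by (simp add: Compl_eq_Diff_UNIV)

lemma inj_level: "\<delta> > 0 \<Longrightarrow> inj_on (level q \<delta>) A"
  by (auto simp: inj_on_def level_def)

lemma constellation_PAM:
  "constellation PAM M = (\<lambda>i. complex_of_real (level M (sqrt (3 / ((real M)\<^sup>2 - 1))) i)) ` {1..M}"
  by (auto simp: Let_def level_def)

lemma constellation_QAM:
  assumes "M = q\<^sup>2"
  shows "constellation QAM M = (\<lambda>(i, j). Complex (level q (sqrt (3 / (2 * (real M - 1)))) i)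
    (level q (sqrt (3 / (2 * (real M - 1)))) j)) ` ({1..q} \<times> {1..q})"
proof -
  have "sqrt (real M) = real q" using assms by simp
  then show ?thesis
    unfolding constellation.simps Let_def level_def
    by (auto simp: image_iff Bex_def; blast)
qed

text \<open>The constellation is real, so the imaginary part of the noise adds the same amount to
  all squared distances and only its real part decides.\<close>

lemma sum_decide_error_PAM:
  fixes M :: nat
  assumes \<delta>: "\<delta> > 0" and M: "M \<ge> 1" and r: "r > 0"
  defines "S \<equiv> (\<lambda>i. complex_of_real (level M \<delta> i)) ` {1..M}"
  shows "(\<Sum>c\<in>S. measure std_gaussian {z. decide S (c + complex_of_real r * z) \<noteq> c}) =
    2 * (real M - 1) * gauss_tail (\<delta> / r)"
proof -
  have fin: "finite S" by (simp add: S_def)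
  have inj: "inj_on (\<lambda>i. complex_of_real (level M \<delta> i)) {1..M}"
    using inj_level[OF \<delta>] by (auto simp: inj_on_def)
  have "(\<Sum>c\<in>S. measure std_gaussian {z. decide S (c + complex_of_real r * z) \<noteq> c}) =
    (\<Sum>i=1..M. measure std_gaussian {z. decide S (complex_of_real (level M \<delta> i) + complex_of_real r * z) \<noteq> complex_of_real (level M \<delta> i)})"
    unfolding S_def by (subst sum.reindex[OF inj]) simp
  also have "\<dots> = (\<Sum>i=1..M. measure std_gaussian (level_error M \<delta> r i))"
  proof (rule sum.cong[OF refl])
    fix i assume i: "i \<in> {1..M}"
    then have iS: "complex_of_real (level M \<delta> i) \<in> S" by (auto simp: S_def)
    have "{z. \<exists>c'\<in>S. (cmod (complex_of_real (level M \<delta> i) - c' + complex_of_real r * z))\<^sup>2 < (cmod (complex_of_real r * z))\<^sup>2}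
      = {z. Re z \<in> level_error M \<delta> r i}"
      by (auto simp: S_def level_error_def cmod_power2)
    then show "measure std_gaussian {z. decide S (complex_of_real (level M \<delta> i) + complex_of_real r * z) \<noteq> complex_of_real (level M \<delta> i)}
      = measure std_gaussian (level_error M \<delta> r i)"
      using measure_std_gaussian_Re[OF level_error_borel[OF \<delta> i r]]
      by (simp add: measure_decide_error_mult[OF fin iS r])
  qed
  also have "\<dots> = 2 * (real M - 1) * gauss_tail (\<delta> / r)"
    using \<delta> r M by (rule sum_measure_level_error)
  finally show ?thesis .
qed

text \<open>A decision is correct iff it is correct in both coordinates, and these are independent.
  An error thus has probability 1 - (1 - p i) (1 - p j), and summing over the grid leaves only the
  sum of the p i.\<close>

lemma sum_decide_error_QAM:
  fixes q :: nat
  assumes \<delta>: "\<delta> > 0" and q: "q \<ge> 1" and r: "r > 0"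
  defines "S \<equiv> (\<lambda>(i, j). Complex (level q \<delta> i) (level q \<delta> j)) ` ({1..q} \<times> {1..q})"
  shows "(\<Sum>c\<in>S. measure std_gaussian {z. decide S (c + complex_of_real r * z) \<noteq> c}) =
    4 * real q * (real q - 1) * gauss_tail (\<delta> / r) - (2 * (real q - 1) * gauss_tail (\<delta> / r))\<^sup>2"
proof -
  have fin: "finite S" by (simp add: S_def)
  have inj: "inj_on (\<lambda>(i, j). Complex (level q \<delta> i) (level q \<delta> j)) ({1..q} \<times> {1..q})"
    using inj_level[OF \<delta>] by (auto simp: inj_on_def)
  define p where "p i = measure std_gaussian (level_error q \<delta> r i)" for i
  have "(\<Sum>c\<in>S. measure std_gaussian {z. decide S (c + complex_of_real r * z) \<noteq> c}) =
    (\<Sum>(i, j)\<in>{1..q}\<times>{1..q}. measure std_gaussian {z. decide S (Complex (level q \<delta> i) (level q \<delta> j) + complex_of_real r * z) \<noteq> Complex (level q \<delta> i) (level q \<delta> j)})"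
    unfolding S_def by (subst sum.reindex[OF inj]) (simp add: split_beta)
  also have "\<dots> = (\<Sum>(i, j)\<in>{1..q}\<times>{1..q}. p i + p j - p i * p j)"
  proof (intro sum.cong refl, clarify)
    fix i j assume ij: "i \<in> {1..q}" "j \<in> {1..q}"
    let ?c = "Complex (level q \<delta> i) (level q \<delta> j)"
    have cS: "?c \<in> S" using ij by (auto simp: S_def)
    let ?E = "level_error q \<delta> r"
    have mE[measurable]: "?E i \<in> sets borel" "?E j \<in> sets borel"
      using level_error_borel[OF \<delta> _ r] ij by auto
    have "{z. \<exists>c'\<in>S. (cmod (?c - c' + complex_of_real r * z))\<^sup>2 < (cmod (complex_of_real r * z))\<^sup>2} =
        - {z. Re z \<in> - ?E i \<and> Im z \<in> - ?E j}"
    proof (intro equalityI subsetI)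
      fix z assume "z \<in> {z. \<exists>c'\<in>S. (cmod (?c - c' + complex_of_real r * z))\<^sup>2 < (cmod (complex_of_real r * z))\<^sup>2}"
      then obtain i' j' where "i' \<in> {1..q}" "j' \<in> {1..q}"
        "(level q \<delta> i - level q \<delta> i' + r * Re z)\<^sup>2 + (level q \<delta> j - level q \<delta> j' + r * Im z)\<^sup>2
          < (r * Re z)\<^sup>2 + (r * Im z)\<^sup>2"
        by (auto simp: S_def cmod_power2)
      then have "(level q \<delta> i - level q \<delta> i' + r * Re z)\<^sup>2 < (r * Re z)\<^sup>2 \<or>
          (level q \<delta> j - level q \<delta> j' + r * Im z)\<^sup>2 < (r * Im z)\<^sup>2"
        by linarith
      then show "z \<in> - {z. Re z \<in> - ?E i \<and> Im z \<in> - ?E j}"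
        using \<open>i' \<in> _\<close> \<open>j' \<in> _\<close> by (auto simp: level_error_def)
    next
      \<comment> \<open>A better level in one coordinate gives a better point of the grid when the
        other coordinate is kept.\<close>
      fix z assume "z \<in> - {z. Re z \<in> - ?E i \<and> Im z \<in> - ?E j}"
      then consider i' where "i' \<in> {1..q}" "(level q \<delta> i - level q \<delta> i' + r * Re z)\<^sup>2 < (r * Re z)\<^sup>2"
        | j' where "j' \<in> {1..q}" "(level q \<delta> j - level q \<delta> j' + r * Im z)\<^sup>2 < (r * Im z)\<^sup>2"
        by (auto simp: level_error_def)
      then show "z \<in> {z. \<exists>c'\<in>S. (cmod (?c - c' + complex_of_real r * z))\<^sup>2 < (cmod (complex_of_real r * z))\<^sup>2}"
      proof cases
        case 1
        then have "Complex (level q \<delta> i') (level q \<delta> j) \<in> S" using ij by (auto simp: S_def)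
        then show ?thesis using 1 by (auto simp: cmod_power2 intro!: bexI[of _ "Complex (level q \<delta> i') (level q \<delta> j)"])
      next
        case 2
        then have "Complex (level q \<delta> i) (level q \<delta> j') \<in> S" using ij by (auto simp: S_def)
        then show ?thesis using 2 by (auto simp: cmod_power2 intro!: bexI[of _ "Complex (level q \<delta> i) (level q \<delta> j')"])
      qed
    qed
    then have "measure std_gaussian {z. decide S (?c + complex_of_real r * z) \<noteq> ?c} =
        measure std_gaussian (- {z. Re z \<in> - ?E i \<and> Im z \<in> - ?E j})"
      by (simp add: measure_decide_error_mult[OF fin cS r])
    also have "\<dots> = 1 - measure std_gaussian {z. Re z \<in> - ?E i \<and> Im z \<in> - ?E j}"
      by (rule measure_std_gaussian_Compl) measurable
    also have "\<dots> = 1 - (1 - p i) * (1 - p j)"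
      using mE by (subst measure_std_gaussian_Re_Im) (auto simp: measure_std_gaussian_Compl p_def)
    finally show "measure std_gaussian {z. decide S (?c + complex_of_real r * z) \<noteq> ?c} = p i + p j - p i * p j"
      by (simp add: algebra_simps)
  qed
  also have "\<dots> = (\<Sum>i=1..q. \<Sum>j=1..q. p i + p j - p i * p j)"
    by (simp add: sum.cartesian_product)
  also have "\<dots> = 2 * real q * (\<Sum>i=1..q. p i) - (\<Sum>i=1..q. p i)\<^sup>2"
    by (simp add: sum.distrib sum_subtractf sum_distrib_left[symmetric] sum_distrib_right[symmetric] power2_eq_square)
  also have "(\<Sum>i=1..q. p i) = 2 * (real q - 1) * gauss_tail (\<delta> / r)"
    unfolding p_def using \<delta> r q by (rule sum_measure_level_error)
  finally show ?thesis by (simp add: power2_eq_square algebra_simps)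
qed

text \<open>A direction between two directions less than pi apart is a nonnegative combination of
  them, with weights proportional to sin (b - \<alpha>) and sin (\<alpha> - a). A functional that is
  positive at the middle direction is therefore positive at one of the two outer ones.\<close>

lemma sin_cis_halfplane_combination:
  fixes u :: complex
  assumes "a \<le> \<alpha>" "\<alpha> \<le> b" "a < b" "b - a < pi" "Im (u * cis (- \<alpha>)) > 0"
  shows "Im (u * cis (- a)) > 0 \<or> Im (u * cis (- b)) > 0"
proof (rule ccontr)
  assume neg: "\<not> ?thesis"
  have "sin (b - a) * Im (u * cis (- \<alpha>)) =
      sin (b - \<alpha>) * Im (u * cis (- a)) + sin (\<alpha> - a) * Im (u * cis (- b))"
    by (simp add: sin_diff algebra_simps)
  moreover have "sin (b - a) > 0" using assms by (intro sin_gt_zero) auto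
  moreover have "sin (b - \<alpha>) \<ge> 0" "sin (\<alpha> - a) \<ge> 0" using assms by (auto intro!: sin_ge_zero)
  ultimately show False
    using neg assms(5) by (smt (verit) mult_nonneg_nonpos mult_pos_pos)
qed

lemma Re_minus_rotated: "Re u - Re (u * cis (- (2 * \<alpha>))) = - 2 * sin \<alpha> * Im (u * cis (- \<alpha>))"
proof -
  have "Re (u * cis (- (2 * \<alpha>))) = Re u * (1 - 2 * (sin \<alpha>)\<^sup>2) + Im u * (2 * sin \<alpha> * cos \<alpha>)"
    by (simp flip: sin_double cos_double_sin)
  then show ?thesis by (simp add: power2_eq_square algebra_simps)
qed

text \<open>The points nearer to another constellation point than to \<open>1\<close>: of the \<open>M - 1\<close> half planes
  only the two of the neighbours matter.\<close>

lemma psk_error_region: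
  assumes M: "M \<ge> 2"
  shows "(\<exists>j<M. cmod (u - cis (2 * pi * real j / real M)) < cmod (u - 1)) \<longleftrightarrow>
    Im (u * cis (- (pi / real M))) > 0 \<or> Im (cnj u * cis (- (pi / real M))) > 0"
proof -
  have near: "cmod (u - cis (2 * pi * real j / real M)) < cmod (u - 1) \<longleftrightarrow>
     sin (pi * real j / real M) * Im (u * cis (- (pi * real j / real M))) > 0" for j
  proof -
    let ?a = "pi * real j / real M"
    have "cmod (u - cis (2 * ?a)) < cmod (u - 1) \<longleftrightarrow> (cmod (u - cis (2 * ?a)))\<^sup>2 < (cmod (u - 1))\<^sup>2"
      using power_strict_mono[of "cmod (u - cis (2 * ?a))" "cmod (u - 1)" 2]
        power_less_imp_less_base[of "cmod (u - cis (2 * ?a))" 2 "cmod (u - 1)"] by auto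
    also have "\<dots> \<longleftrightarrow> Re u - Re (u * cis (- (2 * ?a))) < 0"
    proof -
      have dist: "(cmod (u - cis x))\<^sup>2 = (cmod u)\<^sup>2 + 1 - 2 * Re (u * cis (- x))" for x
      proof -
        have "(cos x)\<^sup>2 + (sin x)\<^sup>2 = 1" by simp
        then show ?thesis
          unfolding cmod_power2 by (simp add: power2_eq_square algebra_simps)
      qed
      note e1 = dist[of "2 * ?a"]
      have e2: "(cmod (u - 1))\<^sup>2 = (cmod u)\<^sup>2 + 1 - 2 * Re u" using dist[of 0] by simp
      show ?thesis unfolding e1 e2 by linarith
    qed
    also have "\<dots> \<longleftrightarrow> sin ?a * Im (u * cis (- ?a)) > 0"
      unfolding Re_minus_rotated by (simp add: mult.assoc)
    finally show ?thesis by (simp add: mult.assoc)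
  qed
  \<comment> \<open>The last point is the neighbour of 1 on the other side, so its half plane is the
    complex conjugate of the first one.\<close>
  have conj: "Im (u * cis (- (pi * real (M - 1) / real M))) = Im (cnj u * cis (- (pi / real M)))"
  proof -
    have "pi * real (M - 1) / real M = pi - pi / real M"
      using M by (simp add: of_nat_diff field_simps)
    then show ?thesis by simp
  qed
  have sinpos: "sin (pi * real j / real M) > 0" if "0 < j" "j < M" for j
    using that by (intro sin_gt_zero) (auto simp: field_simps)
  show ?thesis
  proof
    assume "\<exists>j<M. cmod (u - cis (2 * pi * real j / real M)) < cmod (u - 1)"
    then obtain j where j: "j < M" "sin (pi * real j / real M) * Im (u * cis (- (pi * real j / real M))) > 0"
      unfolding near by blast
    then have "j > 0" by (cases j) auto
    then have Im: "Im (u * cis (- (pi * real j / real M))) > 0"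
      using j sinpos[of j] by (simp add: zero_less_mult_iff)
    show "Im (u * cis (- (pi / real M))) > 0 \<or> Im (cnj u * cis (- (pi / real M))) > 0"
    \<comment> \<open>For M = 2 both neighbours are the same point and the interval of angles
      degenerates.\<close>
    proof (cases "M = 2")
      case True
      then have "j = 1" using j(1) \<open>j > 0\<close> by simp
      then show ?thesis using Im by simp
    next
      case False
      have "Im (u * cis (- (pi / real M))) > 0 \<or> Im (u * cis (- (pi * real (M - 1) / real M))) > 0"
      proof (rule sin_cis_halfplane_combination[OF _ _ _ _ Im])
        show "pi / real M \<le> pi * real j / real M"
          using \<open>j > 0\<close> M by (intro divide_right_mono) auto
        show "pi * real j / real M \<le> pi * real (M - 1) / real M"
          using j(1) M by (intro divide_right_mono mult_left_mono) auto
        show "pi / real M < pi * real (M - 1) / real M"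
          using False M by (intro divide_strict_right_mono) auto
        have "pi * real (M - 1) / real M - pi / real M = pi * (1 - 2 / real M)"
          using M by (simp add: of_nat_diff field_simps)
        also have "\<dots> < pi" using M by simp
        finally show "pi * real (M - 1) / real M - pi / real M < pi" .
      qed
      then show ?thesis unfolding conj .
    qed
  next
    assume "Im (u * cis (- (pi / real M))) > 0 \<or> Im (cnj u * cis (- (pi / real M))) > 0"
    then show "\<exists>j<M. cmod (u - cis (2 * pi * real j / real M)) < cmod (u - 1)"
    proof
      assume "Im (u * cis (- (pi / real M))) > 0"
      then show ?thesis using sinpos[of 1] M unfolding near
        by (intro exI[of _ 1]) auto
    next
      assume "Im (cnj u * cis (- (pi / real M))) > 0"
      then show ?thesis using sinpos[of "M - 1"] M unfolding near conj[symmetric]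
        by (intro exI[of _ "M - 1"]) (auto intro!: mult_pos_pos)
    qed
  qed
qed

text \<open>The error region is a union of two half planes exchanged by conjugation. Off the real
  axis it splits into its upper part \<open>A\<close> and the mirror image of \<open>A\<close>.
  Rotating \<open>A\<close> by - pi / M turns its straight edge horizontal and makes it a truncated
  sector of angle pi - pi / M.\<close>

lemma psk_error_prob:
  assumes M: "M \<ge> 2" and r: "r > 0"
  shows "measure std_gaussian {z. \<exists>j<M. cmod (1 - cis (2 * pi * real j / real M) + complex_of_real r * z)
      < cmod (complex_of_real r * z)} =
    craig_integral (sin (pi / real M) / r) 0 ((real M - 1) * pi / real M) / pi"
proof -
  let ?a = "pi / real M"
  have a: "0 < ?a" "?a \<le> pi / 2" using M by (auto simp: field_simps)
  have sa: "sin ?a > 0" using a pi_gt_zero by (intro sin_gt_zero) linarith+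
  have ca: "cos ?a \<ge> 0" using a by (intro cos_ge_zero) linarith+
  define t where "t = sin ?a / r"
  have t: "t > 0" using sa r by (simp add: t_def)
  define A where "A = {z. t < Im (z * cis (- ?a)) \<and> 0 < Im z}"
  have [measurable]: "A \<in> sets borel"
    unfolding A_def by measurable
  have half: "Im ((1 + complex_of_real r * z) * cis (- ?a)) > 0 \<longleftrightarrow> t < Im (z * cis (- ?a))" for z
  proof -
    have "Im ((1 + complex_of_real r * z) * cis (- ?a)) = r * Im (z * cis (- ?a)) - sin ?a"
      by (simp add: algebra_simps)
    then show ?thesis using r by (simp add: t_def field_simps)
  qed
  \<comment> \<open>Since cos (pi / M) \<ge> 0, the conjugate half plane adds nothing to the first
    one above the real axis.\<close>
  have up: "t < Im (z * cis (- ?a))" if "0 < Im z" "t < Im (cnj z * cis (- ?a))" for z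
  proof -
    have "Im (z * cis (- ?a)) - Im (cnj z * cis (- ?a)) = 2 * cos ?a * Im z"
      by (simp add: algebra_simps)
    also have "\<dots> \<ge> 0" using ca that by simp
    finally show ?thesis using that by simp
  qed
  let ?E = "{z. \<exists>j<M. cmod (1 - cis (2 * pi * real j / real M) + complex_of_real r * z) < cmod (complex_of_real r * z)}"
  have E: "?E = {z. t < Im (z * cis (- ?a)) \<or> t < Im (cnj z * cis (- ?a))}"
  proof -
    have "(\<exists>j<M. cmod (1 - cis (2 * pi * real j / real M) + complex_of_real r * z) < cmod (complex_of_real r * z))
      \<longleftrightarrow> t < Im (z * cis (- ?a)) \<or> t < Im (cnj z * cis (- ?a))" for z
      using psk_error_region[OF M, of "1 + complex_of_real r * z"] half[of z] half[of "cnj z"]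
      by (simp add: algebra_simps)
    then show ?thesis by blast
  qed
  have "measure std_gaussian ?E = measure std_gaussian (A \<union> {z. cnj z \<in> A})"
  proof (rule std_gaussian.finite_measure_eq_AE)
    have "AE z in std_gaussian. \<i> \<bullet> z \<noteq> 0"
      by (rule AE_std_gaussian_hyperplane) simp
    then show "AE z in std_gaussian. (z \<in> ?E) = (z \<in> A \<union> {z. cnj z \<in> A})"
    proof eventually_elim
      fix z assume "\<i> \<bullet> z \<noteq> 0"
      then have "Im z \<noteq> 0" by (simp add: inner_complex_def)
      then consider "Im z > 0" | "Im z < 0" by linarith
      then show "(z \<in> ?E) = (z \<in> A \<union> {z. cnj z \<in> A})"
        unfolding E using up[of z] up[of "cnj z"] by cases (auto simp: A_def simp del: times_complex.sel)
    qed
    show "?E \<in> sets std_gaussian" unfolding E by (simp, measurable)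
    show "A \<union> {z. cnj z \<in> A} \<in> sets std_gaussian" unfolding A_def by (simp, measurable)
  qed
  also have "\<dots> = measure std_gaussian A + measure std_gaussian {z. cnj z \<in> A}"
  proof (rule std_gaussian.finite_measure_Union)
    show "{z. cnj z \<in> A} \<in> sets std_gaussian" unfolding A_def by (simp, measurable)
  qed (auto simp: A_def)
  also have "measure std_gaussian {z. cnj z \<in> A} = measure std_gaussian A"
    by (rule measure_std_gaussian_cnj) simp
  also have "measure std_gaussian A = craig_integral t 0 ((real M - 1) * pi / real M) / (2 * pi)"
  proof -
    let ?b = "(real M - 1) * pi / real M"
    have b: "?b = pi - ?a" using M by (simp add: field_simps)
    define B where "B = {z. t < Im z \<and> pi / 2 - arctan (Re z / Im z) < ?b}"
    have [measurable]: "B \<in> sets borel" unfolding B_def by measurable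
    have "A = {z. cis (- ?a) * z \<in> B}"
    proof -
      \<comment> \<open>For w in the upper half plane, an argument below pi - pi / M means that
        rotating w by pi / M does not leave that half plane.\<close>
      have "pi / 2 - arctan (Re w / Im w) < ?b \<longleftrightarrow> 0 < Im (w * cis ?a)" if "t < Im w" for w
      proof -
        have "Im w > 0" using that t by simp
        have "pi / 2 - arctan (Re w / Im w) < ?b \<longleftrightarrow> ?a - pi / 2 < arctan (Re w / Im w)"
          unfolding b by linarith
        also have "\<dots> \<longleftrightarrow> tan (?a - pi / 2) < Re w / Im w"
        proof -
          have "arctan (tan (?a - pi / 2)) = ?a - pi / 2" using a by (intro arctan_tan) linarith+
          then show ?thesis using arctan_less_iff[of "tan (?a - pi / 2)"] by simp
        qed
        also have "tan (?a - pi / 2) = - (cos ?a / sin ?a)"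
          by (simp add: tan_def sin_diff cos_diff)
        also have "- (cos ?a / sin ?a) < Re w / Im w \<longleftrightarrow> 0 < Im (w * cis ?a)"
          using sa \<open>Im w > 0\<close> by (simp add: field_simps, arith)
        finally show ?thesis .
      qed
      note this[of "cis (- ?a) * z" for z]
      moreover have "cis (- ?a) * z * cis ?a = z" for z
        by (simp add: mult.commute[of _ z] mult.assoc cis_mult)
      ultimately show ?thesis
        by (auto simp: A_def B_def mult.commute[of _ "cis (- ?a)"] simp del: times_complex.sel)
    qed
    then have "measure std_gaussian A = measure std_gaussian B"
      by (simp only:) (rule measure_std_gaussian_unimodular; simp)
    also have "\<dots> = craig_integral t 0 ?b / (2 * pi)"
      unfolding B_def using t a b by (intro measure_craig_sector) linarith+
    finally show ?thesis .
  qed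
  finally show ?thesis by (simp add: t_def)
qed

lemma constellation_PSK: "constellation PSK M = (\<lambda>i. cis (2 * pi * real i / real M)) ` {..<M}"
  by (auto simp: cis_conv_exp mult_ac)

lemma cis_inj_lessThan:
  assumes "M > 0"
  shows "inj_on (\<lambda>i. cis (2 * pi * real i / real M)) {..<M}"
proof (rule inj_onI)
  fix i j assume ij: "i \<in> {..<M}" "j \<in> {..<M}" "cis (2 * pi * real i / real M) = cis (2 * pi * real j / real M)"
  then obtain n :: int where "2 * pi * real i / real M = 2 * pi * real j / real M + 2 * pi * of_int n"
    using sin_cos_eq_iff[of "2 * pi * real i / real M" "2 * pi * real j / real M"]
    by (auto simp: complex_eq_iff)
  then have "pi * real i = pi * (real j + of_int n * real M)"
    using assms by (simp add: field_simps)
  then have "real_of_int (int i) = real_of_int (int j + n * int M)" by simp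
  then have "int i = int j + n * int M" by (simp only: of_int_eq_iff)
  then have "int i mod int M = int j mod int M" by simp
  then show "i = j" using ij by simp
qed

text \<open>The constellation is the group of M-th roots of unity, and multiplication by
  \<open>cnj c\<close> preserves the noise law. Every point therefore has the error probability of
  the point 1.\<close>

lemma sum_decide_error_PSK:
  assumes M: "M \<ge> 2" and r: "r > 0"
  defines "S \<equiv> (\<lambda>i. cis (2 * pi * real i / real M)) ` {..<M}"
  shows "(\<Sum>c\<in>S. measure std_gaussian {z. decide S (c + complex_of_real r * z) \<noteq> c}) =
    real M * (craig_integral (sin (pi / real M) / r) 0 ((real M - 1) * pi / real M) / pi)"
proof -
  have fin: "finite S" by (simp add: S_def)
  have card: "card S = M" using M unfolding S_def by (subst card_image[OF cis_inj_lessThan]) auto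
  have rot: "(\<lambda>c'. c' * c) ` S = S" if cS: "c \<in> S" for c
  proof (rule card_subset_eq[OF fin])
    obtain i where i: "i < M" "c = cis (2 * pi * real i / real M)" using cS by (auto simp: S_def)
    show "(\<lambda>c'. c' * c) ` S \<subseteq> S"
    proof
      fix x assume "x \<in> (\<lambda>c'. c' * c) ` S"
      then obtain j where j: "j < M" "x = cis (2 * pi * real j / real M) * c" by (auto simp: S_def)
      have "cis (2 * pi * real (i + j) / real M) = cis (2 * pi * real ((i + j) mod M) / real M)"
      proof -
        have "real (i + j) = real M * real ((i + j) div M) + real ((i + j) mod M)"
          by (metis mult_div_mod_eq of_nat_add of_nat_mult)
        then have "2 * pi * real (i + j) / real M = 2 * pi * real ((i + j) mod M) / real M + 2 * pi * real ((i + j) div M)"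
          using M by (simp add: field_simps)
        then show ?thesis by (simp flip: cis_mult)
      qed
      then have "x = cis (2 * pi * real ((i + j) mod M) / real M)"
        unfolding j(2) i(2) cis_mult by (simp add: add_divide_distrib distrib_left add.commute)
      then show "x \<in> S" using M by (auto simp: S_def)
    qed
    have "c \<noteq> 0" using i by simp
    then show "card ((\<lambda>c'. c' * c) ` S) = card S" by (intro card_image) (simp add: inj_on_def)
  qed
  have err: "measure std_gaussian {z. decide S (c + complex_of_real r * z) \<noteq> c} =
      craig_integral (sin (pi / real M) / r) 0 ((real M - 1) * pi / real M) / pi" if c: "c \<in> S" for c
  proof -
    have cm: "cmod c = 1" using c by (auto simp: S_def)
    then have cc: "cnj c * c = 1" "c * cnj c = 1" using complex_norm_square[of c] by (simp_all add: mult.commute)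
    let ?E = "{z. \<exists>j<M. cmod (1 - cis (2 * pi * real j / real M) + complex_of_real r * z) < cmod (complex_of_real r * z)}"
    have scale: "cmod (c - c' * c + complex_of_real r * z) = cmod (1 - c' + complex_of_real r * (cnj c * z))" for c' z
    proof -
      have "c - c' * c + complex_of_real r * z = c * (1 - c' + complex_of_real r * (cnj c * z))"
      proof -
        have "c * (complex_of_real r * (cnj c * z)) = complex_of_real r * (c * cnj c * z)"
          by (simp add: mult_ac)
        then show ?thesis using cc(2) by (simp add: ring_distribs mult.commute[of c'])
      qed
      then show ?thesis using cm by (simp add: norm_mult)
    qed
    have "{z. \<exists>c'\<in>S. cmod (c - c' + complex_of_real r * z) < cmod (complex_of_real r * z)} =
        {z. \<exists>c'\<in>(\<lambda>c'. c' * c) ` S. cmod (c - c' + complex_of_real r * z) < cmod (complex_of_real r * z)}"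
      by (simp only: rot[OF c])
    also have "\<dots> = {z. cnj c * z \<in> ?E}"
      using cm by (auto simp: scale norm_mult S_def)
    finally have "measure std_gaussian {z. decide S (c + complex_of_real r * z) \<noteq> c} =
        measure std_gaussian {z. cnj c * z \<in> ?E}"
      by (simp only: measure_decide_error[OF fin c r])
    also have "\<dots> = measure std_gaussian ?E"
      by (rule measure_std_gaussian_unimodular) (use cm in simp, measurable)
    finally show ?thesis using psk_error_prob[OF M r] by simp
  qed
  show ?thesis by (simp add: err card)
qed

lemma finite_constellation: "valid_order md M \<Longrightarrow> finite (constellation md M)"
proof (cases md)
  case QAM
  assume "valid_order md M"
  then obtain q where "M = q\<^sup>2" using QAM by auto
  then show ?thesis unfolding QAM by (subst constellation_QAM) auto
next
  case PAM
  show ?thesis unfolding PAM constellation_PAM by simp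
next
  case PSK
  show ?thesis unfolding PSK constellation_PSK by simp
qed

lemma card_constellation:
  assumes "valid_order md M"
  shows "card (constellation md M) = M"
proof (cases md)
  case PAM
  let ?d = "sqrt (3 / ((real M)\<^sup>2 - 1))"
  have "0 < ?d" using mod_gain_pos[OF assms] unfolding PAM mod_gain.simps by (rule real_sqrt_gt_zero)
  then have "inj_on (level M ?d) {1..M}" by (rule inj_level)
  then have "inj_on (\<lambda>i. complex_of_real (level M ?d i)) {1..M}"
    unfolding inj_on_def of_real_eq_iff .
  from card_image[OF this] show ?thesis unfolding PAM constellation_PAM by (simp only: card_atLeastAtMost diff_Suc_1 One_nat_def)
next
  case PSK
  have "M > 0" using valid_order_ge_2[OF assms] by simp
  from card_image[OF cis_inj_lessThan[OF this]] show ?thesis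
    unfolding PSK constellation_PSK by (simp only: card_lessThan)
next
  case QAM
  then obtain q where q: "M = q\<^sup>2" using assms by auto
  let ?d = "sqrt (3 / (2 * (real M - 1)))"
  have "0 < ?d" using mod_gain_pos[OF assms] unfolding QAM mod_gain.simps by (rule real_sqrt_gt_zero)
  then have "inj_on (level q ?d) {1..q}" by (rule inj_level)
  then have "inj_on (\<lambda>(i, j). Complex (level q ?d i) (level q ?d j)) ({1..q} \<times> {1..q})"
    by (rule_tac inj_onI) (clarsimp simp only: split_beta complex.inject mem_Times_iff inj_on_def prod_eq_iff fst_conv snd_conv, blast)
  from card_image[OF this] show ?thesis
    unfolding QAM constellation_QAM[OF q] by (simp only: card_cartesian_product card_atLeastAtMost diff_Suc_1 diff_Suc_Suc diff_zero One_nat_def q power2_eq_square)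
qed

lemma nn_integral_weight_Icc:
  assumes "w \<ge> 0"
  shows "(\<integral>\<^sup>+\<theta>. ennreal (w * indicator {a..b} \<theta>) * ennreal (exp (- (t\<^sup>2 / (sin \<theta>)\<^sup>2))) \<partial>lborel) =
    ennreal (w * craig_integral t a b)"
proof -
  have "(\<integral>\<^sup>+\<theta>. ennreal (w * indicator {a..b} \<theta>) * ennreal (exp (- (t\<^sup>2 / (sin \<theta>)\<^sup>2))) \<partial>lborel) =
     (\<integral>\<^sup>+\<theta>. ennreal w * (ennreal (exp (- (t\<^sup>2 / (sin \<theta>)\<^sup>2))) * indicator {a..b} \<theta>) \<partial>lborel)"
    by (intro nn_integral_cong) (auto simp: indicator_def)
  also have "\<dots> = ennreal w * craig t a b"
    by (subst nn_integral_cmult) (auto simp: craig_def)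
  finally show ?thesis
    using assms by (simp add: craig_eq_craig_integral ennreal_mult')
qed

text \<open>The common form of the three computations. The number \<open>t\<close> below is the half
  distance of neighbouring points in units of the noise amplitude \<open>r\<close>. The sum over the
  constellation is kept, since the points of a grid do not share one error probability.\<close>

lemma sum_decide_error:
  assumes v: "valid_order md M" and r: "r > 0"
  defines "S \<equiv> constellation md M"
  shows "(\<Sum>c\<in>S. ennreal (measure std_gaussian {z. decide S (c + complex_of_real r * z) \<noteq> c})) =
    ennreal (real M) * (\<integral>\<^sup>+\<theta>. ennreal (mod_weight md M \<theta>) *
      ennreal (exp (- (mod_gain md M / r\<^sup>2 / (sin \<theta>)\<^sup>2))) \<partial>lborel)"
proof -
  have M: "M \<ge> 2" using v by (rule valid_order_ge_2)
  have sum: "(\<Sum>c\<in>S. ennreal (measure std_gaussian {z. decide S (c + complex_of_real r * z) \<noteq> c})) =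
     ennreal (\<Sum>c\<in>S. measure std_gaussian {z. decide S (c + complex_of_real r * z) \<noteq> c})"
    by (simp add: sum_ennreal)
  define t where "t = sqrt (mod_gain md M) / r"
  have g: "mod_gain md M > 0" using v by (rule mod_gain_pos)
  have t: "t > 0" "mod_gain md M / r\<^sup>2 = t\<^sup>2" using g r by (simp_all add: t_def power_divide)
  show ?thesis
  proof (cases md)
    case PAM
    have "(\<Sum>c\<in>S. measure std_gaussian {z. decide S (c + complex_of_real r * z) \<noteq> c}) =
       2 * (real M - 1) * gauss_tail t"
      using sum_decide_error_PAM[of "sqrt (3 / ((real M)\<^sup>2 - 1))" M r] g M r
      by (simp add: S_def PAM constellation_PAM t_def del: constellation.simps)
    also have "\<dots> = real M * (2 * (real M - 1) / (real M * pi) * craig_integral t 0 (pi / 2))"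
      using M t by (simp add: gauss_tail_craig)
    finally have eq: "(\<Sum>c\<in>S. measure std_gaussian {z. decide S (c + complex_of_real r * z) \<noteq> c}) = \<dots>" .
    have W: "(\<integral>\<^sup>+\<theta>. ennreal (mod_weight md M \<theta>) * ennreal (exp (- (t\<^sup>2 / (sin \<theta>)\<^sup>2))) \<partial>lborel) =
        ennreal (2 * (real M - 1) / (real M * pi) * craig_integral t 0 (pi / 2))"
      unfolding PAM mod_weight.simps by (rule nn_integral_weight_Icc) (use M in simp)
    show ?thesis
      unfolding sum t(2) eq W by (simp only: ennreal_mult' of_nat_0_le_iff)
  next
    case PSK
    have s: "sin (pi / real M) > 0" using M by (intro sin_gt_zero) (auto simp: field_simps)
    have eq: "(\<Sum>c\<in>S. measure std_gaussian {z. decide S (c + complex_of_real r * z) \<noteq> c}) =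
       real M * (1 / pi * craig_integral t 0 ((real M - 1) * pi / real M))"
      using sum_decide_error_PSK[OF M r] s
      by (simp add: S_def PSK constellation_PSK t_def del: constellation.simps)
    have W: "(\<integral>\<^sup>+\<theta>. ennreal (mod_weight md M \<theta>) * ennreal (exp (- (t\<^sup>2 / (sin \<theta>)\<^sup>2))) \<partial>lborel) =
        ennreal (1 / pi * craig_integral t 0 ((real M - 1) * pi / real M))"
      unfolding PSK mod_weight.simps by (rule nn_integral_weight_Icc) simp
    show ?thesis
      unfolding sum t(2) eq W by (simp only: ennreal_mult' of_nat_0_le_iff)
  next
    case QAM
    then obtain q where q: "M = q\<^sup>2" "q \<ge> 2" using v by auto
    have sq: "sqrt (real M) = real q" using q by simp
    let ?C0 = "craig_integral t 0 (pi / 4)" and ?C1 = "craig_integral t (pi / 4) (pi / 2)"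
    have "(\<Sum>c\<in>S. measure std_gaussian {z. decide S (c + complex_of_real r * z) \<noteq> c}) =
       4 * real q * (real q - 1) * gauss_tail t - (2 * (real q - 1) * gauss_tail t)\<^sup>2"
      using sum_decide_error_QAM[of "sqrt (3 / (2 * (real M - 1)))" q r] g q r
      unfolding S_def QAM constellation_QAM[OF q(1)] t_def by simp
    also have "\<dots> = 4 * real q * (real q - 1) * ((?C0 + ?C1) / pi) - 4 * (real q - 1)\<^sup>2 * (?C0 / pi)"
    proof -
      have "(2 * (real q - 1) * gauss_tail t)\<^sup>2 = 4 * (real q - 1)\<^sup>2 * (gauss_tail t)\<^sup>2"
        by (simp only: power_mult_distrib) simp
      moreover have "gauss_tail t = (?C0 + ?C1) / pi"
        using gauss_tail_craig[OF t(1)] craig_integral_split[of 0 "pi / 4" "pi / 2" t] by simp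
      ultimately show ?thesis using gauss_tail_sq_craig[OF t(1)] by (simp only:)
    qed
    \<comment> \<open>On [0, pi / 4] the coefficients combine to 4 q (q - 1) - 4 (q - 1)^2 = 4 (q -
      1); on [pi / 4, pi / 2] the factor 4 q (q - 1) remains. Dividing by M = q^2 gives the two QAM
      weights.\<close>
    also have "\<dots> = real M * (4 * (sqrt (real M) - 1) / (sqrt (real M) * pi) * ?C1
       + 4 * (sqrt (real M) - 1) / (real M * pi) * ?C0)"
      unfolding sq using q by (simp add: field_simps power2_eq_square)
    finally have eq: "(\<Sum>c\<in>S. measure std_gaussian {z. decide S (c + complex_of_real r * z) \<noteq> c}) = \<dots>" .
    have w: "4 * (sqrt (real M) - 1) / (sqrt (real M) * pi) \<ge> 0" "4 * (sqrt (real M) - 1) / (real M * pi) \<ge> 0"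
      unfolding sq using q by auto
    have "(\<integral>\<^sup>+\<theta>. ennreal (mod_weight md M \<theta>) * ennreal (exp (- (t\<^sup>2 / (sin \<theta>)\<^sup>2))) \<partial>lborel) =
      (\<integral>\<^sup>+\<theta>. ennreal (4 * (sqrt (real M) - 1) / (sqrt (real M) * pi) * indicator {pi/4..pi/2} \<theta>) * ennreal (exp (- (t\<^sup>2 / (sin \<theta>)\<^sup>2))) +
         ennreal (4 * (sqrt (real M) - 1) / (real M * pi) * indicator {0..pi/4} \<theta>) * ennreal (exp (- (t\<^sup>2 / (sin \<theta>)\<^sup>2))) \<partial>lborel)"
      using w by (intro nn_integral_cong) (simp add: QAM distrib_right[symmetric] ennreal_plus[symmetric] del: ennreal_plus times_divide_eq_left)
    also have "\<dots> = ennreal (4 * (sqrt (real M) - 1) / (sqrt (real M) * pi) * ?C1) + ennreal (4 * (sqrt (real M) - 1) / (real M * pi) * ?C0)"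
      using w by (subst nn_integral_add) (simp_all only: nn_integral_weight_Icc, measurable)
    also have "\<dots> = ennreal (4 * (sqrt (real M) - 1) / (sqrt (real M) * pi) * ?C1
       + 4 * (sqrt (real M) - 1) / (real M * pi) * ?C0)"
      using w by (intro ennreal_plus[symmetric] mult_nonneg_nonneg craig_integral_nonneg)
    finally show ?thesis
      unfolding sum t(2) eq by (simp only: ennreal_mult'[symmetric] of_nat_0_le_iff)
  qed
qed

lemma borel_measurable_vec_nth[measurable]:
  "f \<in> borel_measurable M \<Longrightarrow> (\<lambda>x. (f x :: 'a::euclidean_space ^ 'n) $ i) \<in> borel_measurable M"
  by (rule borel_measurable_continuous_on[of "\<lambda>x. x $ i"]) (intro continuous_intros)

lemma borel_measurable_vecI:
  fixes f :: "'b \<Rightarrow> 'a::euclidean_space ^ 'n"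
  assumes "\<And>i. (\<lambda>x. f x $ i) \<in> borel_measurable M"
  shows "f \<in> borel_measurable M"
proof (rule borel_measurable_euclidean_space[THEN iffD2], rule ballI)
  fix b :: "'a ^ 'n" assume "b \<in> Basis"
  then obtain i u where "b = axis i u" by (auto simp: Basis_vec_def)
  then show "(\<lambda>x. f x \<bullet> b) \<in> borel_measurable M"
    using assms by (simp add: inner_axis)
qed

subsection \<open>Resampling a column of a Gaussian matrix\<close>

definition set_column :: "'n \<Rightarrow> 'a ^ 'm \<Rightarrow> 'a ^ 'n ^ 'm \<Rightarrow> 'a ^ 'n ^ 'm"
  where "set_column k w Z = (\<chi> i j. if j = k then w $ i else Z $ i $ j)"

text \<open>Overwriting a column is a coisometry: its adjoint splits a matrix into the matrix with
  that column cleared and the column itself.\<close>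

lemma std_gaussian_set_column:
  "distr std_gaussian borel (\<lambda>(Z, w). set_column k w Z) =
    (std_gaussian :: (complex ^ 'n ^ 'm) measure)"
proof (rule std_gaussian_coisometry[where g = "\<lambda>Z. (set_column k 0 Z, column k Z)"])
  show "linear (\<lambda>(Z, w). set_column k w Z :: complex ^ 'n ^ 'm)"
    by (intro linearI) (auto simp: set_column_def vec_eq_iff)
  show "linear (\<lambda>Z :: complex ^ 'n ^ 'm. (set_column k 0 Z, column k Z))"
    by (intro linearI) (auto simp: set_column_def column_def vec_eq_iff)
  show "(case (set_column k 0 Y, column k Y) of (Z, w) \<Rightarrow> set_column k w Z) = Y" for Y :: "complex ^ 'n ^ 'm"
    by (auto simp: set_column_def column_def vec_eq_iff)
  show "(case X of (Z, w) \<Rightarrow> set_column k w Z) \<bullet> Y = X \<bullet> (set_column k 0 Y, column k Y)"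
    for X :: "(complex ^ 'n ^ 'm) \<times> (complex ^ 'm)" and Y
  proof -
    have "(\<Sum>j\<in>UNIV. (if j = k then a else f j) \<bullet> g j) = (\<Sum>j\<in>UNIV. f j \<bullet> (if j = k then 0 else g j)) + a \<bullet> g k"
      for a :: complex and f g :: "'n \<Rightarrow> complex"
      by (simp add: sum.remove[of UNIV k])
    then show ?thesis
      by (simp add: split_beta set_column_def column_def inner_prod_def inner_vec_def sum.distrib cong: if_cong)
  qed
qed

lemma measurable_set_column[measurable]:
  "(\<lambda>(Z, w). set_column k w Z :: complex ^ 'n ^ 'm) \<in> borel_measurable (borel \<Otimes>\<^sub>M borel)"
  unfolding borel_prod
  by (rule linear_borel_measurable, intro linearI) (auto simp: set_column_def vec_eq_iff)

text \<open>This plays the role of conditioning on the columns other than \<open>k\<close>: the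
  inner integral averages over a fresh column \<open>w\<close> while the others stay fixed.\<close>

lemma nn_integral_set_column:
  assumes f[measurable]: "f \<in> borel_measurable (borel :: (complex ^ 'n ^ 'm) measure)"
  shows "(\<integral>\<^sup>+Z. f Z \<partial>std_gaussian) = (\<integral>\<^sup>+Z. \<integral>\<^sup>+w. f (set_column k w Z) \<partial>std_gaussian \<partial>std_gaussian)"
proof -
  have m: "(\<lambda>(Z, w). set_column k w Z :: complex ^ 'n ^ 'm) \<in> borel_measurable (borel \<Otimes>\<^sub>M borel)"
    by (rule measurable_set_column)
  have "(\<integral>\<^sup>+Z. f Z \<partial>std_gaussian) = (\<integral>\<^sup>+Z. f Z \<partial>distr (std_gaussian \<Otimes>\<^sub>M std_gaussian) borel (\<lambda>(Z, w). set_column k w Z))"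
    by (simp add: std_gaussian_set_column std_gaussian_prod)
  also have "\<dots> = (\<integral>\<^sup>+p. f (set_column k (snd p) (fst p)) \<partial>(std_gaussian \<Otimes>\<^sub>M std_gaussian))"
    by (subst nn_integral_distr) (auto simp: split_beta' measurable_cong_sets[OF sets_pair_measure_cong[OF sets_std_gaussian sets_std_gaussian] refl] m[unfolded split_beta'])
  also have "\<dots> = (\<integral>\<^sup>+Z. \<integral>\<^sup>+w. f (set_column k w Z) \<partial>std_gaussian \<partial>std_gaussian)"
    using m[unfolded split_beta'] by (subst std_gaussian.nn_integral_fst[symmetric]) auto
  finally show "(\<integral>\<^sup>+Z. f Z \<partial>std_gaussian) = (\<integral>\<^sup>+Z. \<integral>\<^sup>+w. f (set_column k w Z) \<partial>std_gaussian \<partial>std_gaussian)" .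
qed

lemma set_column_mult:
  fixes Z :: "'a::comm_ring_1 ^ 'n ^ 'm"
  shows "set_column k w Z *v v = v $ k *s w + Z *v (\<chi> j. if j = k then 0 else v $ j)"
proof (rule vec_eq_iff[THEN iffD2], rule allI)
  fix i
  show "(set_column k w Z *v v) $ i = (v $ k *s w + Z *v (\<chi> j. if j = k then 0 else v $ j)) $ i"
    by (simp add: set_column_def matrix_vector_mult_def sum.remove[of UNIV k] mult.commute)
qed

lemma linear_matrix_vector_mult_complex: "linear (\<lambda>v. (Z :: complex ^ 'n ^ 'm) *v v)"
  by (intro linearI) (simp_all add: matrix_vector_right_distrib matrix_vector_mult_def vec_eq_iff scaleR_sum_right sum.distrib distrib_left)

lemma dim_vanishing_coordinate:
  "dim {v :: complex ^ 'n. v $ k = 0} = 2 * CARD('n) - 2"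
proof -
  let ?d = "(Basis :: (complex ^ 'n) set) - {axis k 1, axis k \<i>}"
  have "{v :: complex ^ 'n. v $ k = 0} = {x. \<forall>i\<in>Basis. i \<notin> ?d \<longrightarrow> x \<bullet> i = 0}"
    by (auto simp: inner_axis inner_complex_def complex_eq_iff Basis_complex_def)
  moreover have "card ?d = 2 * CARD('n) - 2"
    by (subst card_Diff_subset) (auto simp: axis_eq_axis Basis_complex_def)
  ultimately show ?thesis using dim_substandard[of ?d] by auto
qed

text \<open>Linear independence of the columns indexed by \<open>J\<close>, expressed through kernel
  vectors supported in \<open>J\<close> so that columns can be added one at a time.\<close>

definition full_rank_on :: "'n set \<Rightarrow> complex ^ 'n ^ 'm \<Rightarrow> bool"
  where "full_rank_on J Z \<longleftrightarrow> (\<forall>v. (\<forall>i. i \<notin> J \<longrightarrow> v $ i = 0) \<longrightarrow> Z *v v = 0 \<longrightarrow> v = 0)"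

text \<open>Normalized kernel vectors range over the compact unit sphere, so the rank-deficient
  matrices are the projection of a closed set along a compact factor. Openness supplies
  measurability.\<close>

lemma open_full_rank_on: "open {Z :: complex ^ 'n ^ 'm. full_rank_on J Z}"
proof -
  have "closed {Z :: complex ^ 'n ^ 'm. \<exists>v. v \<in> sphere 0 1 \<and> (v, Z) \<in> {p. (\<forall>i. i \<notin> J \<longrightarrow> fst p $ i = 0) \<and> snd p *v fst p = 0}}"
  proof (rule closed_compact_projection)
    show "closed {p :: (complex ^ 'n) \<times> (complex ^ 'n ^ 'm). (\<forall>i. i \<notin> J \<longrightarrow> fst p $ i = 0) \<and> snd p *v fst p = 0}"
    proof (intro closed_Collect_conj closed_Collect_all closed_Collect_imp open_Collect_const closed_Collect_eq continuous_intros)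
      have "continuous_on UNIV (\<lambda>p :: (complex ^ 'n) \<times> (complex ^ 'n ^ 'm). \<chi> i. \<Sum>j\<in>UNIV. snd p $ i $ j * fst p $ j)"
        by (intro continuous_intros)
      then show "continuous_on UNIV (\<lambda>p :: (complex ^ 'n) \<times> (complex ^ 'n ^ 'm). snd p *v fst p)"
        by (simp add: matrix_vector_mult_def)
    qed
  qed simp
  moreover have "- {Z. full_rank_on J Z} = {Z :: complex ^ 'n ^ 'm. \<exists>v. v \<in> sphere 0 1 \<and> (v, Z) \<in> {p. (\<forall>i. i \<notin> J \<longrightarrow> fst p $ i = 0) \<and> snd p *v fst p = 0}}"
  proof (intro equalityI subsetI)
    fix Z :: "complex ^ 'n ^ 'm" assume "Z \<in> - {Z. full_rank_on J Z}"
    then obtain v where v: "\<forall>i. i \<notin> J \<longrightarrow> v $ i = 0" "Z *v v = 0" "v \<noteq> 0"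
      by (auto simp: full_rank_on_def)
    have "Z *v (v /\<^sub>R norm v) = 0"
      using linear_scale[OF linear_matrix_vector_mult_complex, of Z "inverse (norm v)" v] v(2) by simp
    then show "Z \<in> {Z. \<exists>v. v \<in> sphere 0 1 \<and> (v, Z) \<in> {p. (\<forall>i. i \<notin> J \<longrightarrow> fst p $ i = 0) \<and> snd p *v fst p = 0}}"
      using v by (auto intro!: exI[of _ "v /\<^sub>R norm v"])
  next
    fix Z :: "complex ^ 'n ^ 'm" assume "Z \<in> {Z. \<exists>v. v \<in> sphere 0 1 \<and> (v, Z) \<in> {p. (\<forall>i. i \<notin> J \<longrightarrow> fst p $ i = 0) \<and> snd p *v fst p = 0}}"
    then obtain v where "norm v = 1" "\<forall>i. i \<notin> J \<longrightarrow> v $ i = 0" "Z *v v = 0" by auto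
    then show "Z \<in> - {Z. full_rank_on J Z}" by (auto simp: full_rank_on_def)
  qed
  ultimately show ?thesis by (simp add: open_closed)
qed

lemma full_rank_on_set_column:
  assumes Z: "full_rank_on J Z" and w: "w \<notin> (\<lambda>v. Z *v v) ` {v. v $ j = 0}"
  shows "full_rank_on (insert j J) (set_column j w Z)"
proof -
  have "v = 0" if v: "\<forall>i. i \<notin> insert j J \<longrightarrow> v $ i = 0" "set_column j w Z *v v = 0" for v
  proof -
    let ?v = "\<chi> i. if i = j then 0 else v $ i"
    have eq: "v $ j *s w + Z *v ?v = 0" using v(2) by (simp add: set_column_mult)
    have "v $ j = 0"
    proof (rule ccontr)
      assume nz: "v $ j \<noteq> 0"
      have "v $ j *s w = - (Z *v ?v)" using eq by (simp add: eq_neg_iff_add_eq_0)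
      then have "(1 / v $ j) *s (v $ j *s w) = (1 / v $ j) *s (- (Z *v ?v))" by simp
      then have "w = Z *v ((- 1 / v $ j) *s ?v)"
        using nz by (simp add: vector_scalar_commute linear_neg[OF linear_matrix_vector_mult_complex])
      moreover have "((- 1 / v $ j) *s ?v) $ j = 0" by simp
      ultimately show False using w by blast
    qed
    moreover from this have "?v = v" by (simp add: vec_eq_iff)
    ultimately show "v = 0" using eq Z v(1) by (auto simp: full_rank_on_def)
  qed
  then show ?thesis by (auto simp: full_rank_on_def)
qed

text \<open>Induction over the columns. With the others fixed, a fresh column has to avoid the image
  of the vectors vanishing at \<open>j\<close>, whose real dimension is at most 2 n - 2 and hence
  below 2 m.\<close>

lemma AE_full_rank_on:
  assumes "CARD('n) \<le> CARD('m)"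
  shows "AE Z in (std_gaussian :: (complex ^ 'n ^ 'm) measure). full_rank_on J Z"
  using finite[of J]
proof induction
  case empty
  show ?case by (simp add: full_rank_on_def vec_eq_iff)
next
  case (insert j J)
  have m: "(\<lambda>(Z, w). set_column j w Z :: complex ^ 'n ^ 'm) \<in> borel_measurable (std_gaussian \<Otimes>\<^sub>M std_gaussian)"
    using measurable_set_column[of j] by (simp add: measurable_cong_sets[OF sets_pair_measure_cong[OF sets_std_gaussian sets_std_gaussian] refl])
  have b: "{Z :: complex ^ 'n ^ 'm. full_rank_on (insert j J) Z} \<in> sets borel"
    by (intro borel_open open_full_rank_on)
  interpret G: pair_sigma_finite "std_gaussian :: (complex ^ 'n ^ 'm) measure" "std_gaussian :: (complex ^ 'm) measure"
    by (intro pair_sigma_finite.intro prob_space_imp_sigma_finite prob_space_std_gaussian)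
  have "AE p in std_gaussian \<Otimes>\<^sub>M std_gaussian. full_rank_on (insert j J) (set_column j (snd p) (fst p) :: complex ^ 'n ^ 'm)"
  proof (rule G.AE_pair_measure)
    show "{p \<in> space (std_gaussian \<Otimes>\<^sub>M std_gaussian). full_rank_on (insert j J) (set_column j (snd p) (fst p) :: complex ^ 'n ^ 'm)}
       \<in> sets (std_gaussian \<Otimes>\<^sub>M std_gaussian)"
      using measurable_sets[OF m b] by (simp add: vimage_def Int_def split_beta' conj_commute)
    show "AE Z in std_gaussian. AE w in std_gaussian. full_rank_on (insert j J) (set_column j (snd (Z, w)) (fst (Z, w)) :: complex ^ 'n ^ 'm)"
      using insert.IH
    proof eventually_elim
      fix Z :: "complex ^ 'n ^ 'm" assume Z: "full_rank_on J Z"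
      let ?V = "(\<lambda>v. Z *v v) ` {v. v $ j = 0}"
      have "dim ?V \<le> dim {v :: complex ^ 'n. v $ j = 0}"
        using linear_matrix_vector_mult_complex by (rule dim_image_le)
      also have "\<dots> < DIM(complex ^ 'm)"
        unfolding dim_vanishing_coordinate DIM_cart DIM_complex
        using assms zero_less_card_finite[where 'a = 'n] by linarith
      finally have "AE w in std_gaussian. w \<notin> ?V" by (rule AE_std_gaussian_notin_subspace)
      then show "AE w in std_gaussian. full_rank_on (insert j J) (set_column j (snd (Z, w)) (fst (Z, w)))"
        by eventually_elim (use full_rank_on_set_column[OF Z] in simp)
    qed
  qed
  then have "AE Z in distr (std_gaussian \<Otimes>\<^sub>M std_gaussian) borel (\<lambda>(Z, w). set_column j w Z :: complex ^ 'n ^ 'm). full_rank_on (insert j J) Z"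
    using b by (subst AE_distr_iff[OF m]) (auto simp: split_beta')
  then show ?case unfolding std_gaussian_prod std_gaussian_set_column .
qed

lemma orthonormal_basis_complement:
  fixes V :: "'a::euclidean_space set"
  assumes V: "subspace V"
  obtains B where "pairwise orthogonal B" "\<And>b. b \<in> B \<Longrightarrow> norm b = 1" "finite B"
    "card B + dim V = DIM('a)" "\<And>b x. b \<in> B \<Longrightarrow> x \<in> V \<Longrightarrow> b \<bullet> x = 0"
    "\<And>w. w - (\<Sum>b\<in>B. (w \<bullet> b) *\<^sub>R b) \<in> V"
proof -
  define V' where "V' = {y. \<forall>x\<in>V. orthogonal x y}"
  have sub: "subspace V'" unfolding V'_def by (rule subspace_orthogonal_to_vectors)
  obtain B where B: "B \<subseteq> V'" "pairwise orthogonal B" "\<And>x. x \<in> B \<Longrightarrow> norm x = 1"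
      "independent B" "card B = dim V'" "span B = V'"
    using orthonormal_basis_subspace[OF sub] by blast
  have fin: "finite B" using B(4) by (rule independent_imp_finite)
  have dim: "dim V' + dim V = DIM('a)"
    using dim_subspace_orthogonal_to_vectors[OF V subspace_UNIV] by (simp add: V'_def)
  have mem: "w - (\<Sum>b\<in>B. (w \<bullet> b) *\<^sub>R b) \<in> V" for w
  proof -
    let ?P = "\<Sum>b\<in>B. (w \<bullet> b) *\<^sub>R b"
    have "c \<bullet> (w - ?P) = 0" if c: "c \<in> B" for c
    proof -
      have "c \<bullet> ?P = (\<Sum>b\<in>B. (w \<bullet> b) * (if b = c then 1 else 0))"
        unfolding inner_sum_right inner_scaleR_right
      proof (intro sum.cong refl arg_cong2[where f = "(*)"])
        fix b assume "b \<in> B"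
        then show "c \<bullet> b = (if b = c then 1 else 0)"
          using B(2) B(3)[of c] c by (auto simp: pairwise_def orthogonal_def norm_eq_1)
      qed
      also have "\<dots> = w \<bullet> c" using fin c by (simp add: if_distrib cong: if_cong)
      finally show ?thesis by (simp add: inner_diff_right inner_commute)
    qed
    then have "orthogonal (w - ?P) c" if "c \<in> B" for c
      using that by (simp add: orthogonal_def inner_commute)
    then have "orthogonal (w - ?P) y" if "y \<in> V'" for y
      using orthogonal_to_span[of y B "w - ?P"] that B(6) by auto
    then have "w - ?P \<in> orthogonal_comp (orthogonal_comp V)"
      by (auto simp: orthogonal_comp_def V'_def orthogonal_commute)
    then show ?thesis using orthogonal_comp_self[OF V] by simp
  qed
  show ?thesis
  proof (rule that[of B])
    show "b \<bullet> x = 0" if "b \<in> B" "x \<in> V" for b x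
      using that B(1) by (auto simp: V'_def orthogonal_def inner_commute)
  qed (use B fin dim mem in auto)
qed

section \<open>The zero-forcing inverse of a matrix of full column rank\<close>

lemma full_rank_UNIV: "full_rank_on UNIV Z \<longleftrightarrow> (\<forall>v. Z *v v = 0 \<longrightarrow> v = 0)"
  by (simp add: full_rank_on_def)

lemma invertible_gram:
  assumes "full_rank_on UNIV Z"
  shows "invertible (Z\<^sup>H ** Z)"
proof (rule ccontr)
  assume "\<not> invertible (Z\<^sup>H ** Z)"
  then obtain x where x: "x \<noteq> 0" "(Z\<^sup>H ** Z) *v x = 0" by (rule singular_kernel)
  then have "cinner x (Z\<^sup>H *v (Z *v x)) = 0" by (simp add: matrix_vector_mul_assoc)
  then have "cinner (Z *v x) (Z *v x) = 0" by (simp add: cinner_ctranspose)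
  then have "Z *v x = 0" by (simp add: cinner_self)
  then show False using assms x(1) by (simp add: full_rank_UNIV)
qed

lemma zf_inverse_left:
  assumes "full_rank_on UNIV Z"
  shows "zf_inverse Z ** Z = mat 1"
  unfolding zf_inverse_def matrix_mul_assoc[symmetric]
  by (rule matrix_inv_cancel(1)[OF invertible_gram[OF assms]])

lemma zf_inverse_normal_equations:
  assumes "full_rank_on UNIV Z"
  shows "Z\<^sup>H *v (Z *v (zf_inverse Z *v e)) = Z\<^sup>H *v e"
proof -
  have "Z\<^sup>H *v (Z *v (zf_inverse Z *v e)) = ((Z\<^sup>H ** Z) ** matrix_inv (Z\<^sup>H ** Z)) *v (Z\<^sup>H *v e)"
    by (simp add: zf_inverse_def matrix_vector_mul_assoc matrix_mul_assoc)
  then show ?thesis by (simp add: matrix_inv_cancel(2)[OF invertible_gram[OF assms]])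
qed

text \<open>The vector q = \<open>Z *v u\<close> is column k minus its projection onto the span of
  the others. Pairing the normal equations with \<open>u\<close> leaves only the component along q,
  so row k of the pseudo-inverse is q^H / |q|^2.\<close>

lemma zf_inverse_component:
  assumes Z: "full_rank_on UNIV Z" and u: "u $ k = 1"
    and orth: "\<And>v. v $ k = 0 \<Longrightarrow> cinner (Z *v u) (Z *v v) = 0"
  shows "(zf_inverse Z *v e) $ k = cinner (Z *v u) e / complex_of_real ((norm (Z *v u))\<^sup>2)"
    and "Z *v u \<noteq> 0"
proof -
  have "u \<noteq> 0" using u by auto
  then show nz: "Z *v u \<noteq> 0" using Z by (auto simp: full_rank_UNIV)
  define y where "y = zf_inverse Z *v e"
  let ?q = "Z *v u"
  have "cinner ?q e = cinner u (Z\<^sup>H *v e)" by (simp add: cinner_ctranspose)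
  also have "\<dots> = cinner ?q (Z *v y)"
    unfolding y_def zf_inverse_normal_equations[OF Z, of e, symmetric] by (simp add: cinner_ctranspose)
  also have "Z *v y = y $ k *s ?q + Z *v (y - y $ k *s u)"
    by (simp add: matrix_vector_mult_diff_distrib vector_scalar_commute)
  also have "cinner ?q \<dots> = y $ k * complex_of_real ((norm ?q)\<^sup>2)"
    using orth[of "y - y $ k *s u"] u by (simp add: cinner_add_right cinner_scale_right cinner_self)
  finally show "(zf_inverse Z *v e) $ k = cinner ?q e / complex_of_real ((norm ?q)\<^sup>2)"
    using nz by (simp add: y_def)
qed

lemma scaleR_eq_scale: "r *\<^sub>R b = complex_of_real r *s (b :: complex ^ 'n)"
  by (simp only: vec_eq_iff vector_scaleR_component vector_smult_component) (simp add: scaleR_conv_of_real)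

text \<open>The inner product with the unit vector in direction \<open>q\<close> is a coisometry
  onto the complex numbers, so only the length of \<open>q\<close> survives in the law.\<close>

lemma measure_std_gaussian_cinner:
  fixes q :: "complex ^ 'm"
  assumes q: "q \<noteq> 0" and A: "A \<in> sets borel"
  shows "measure std_gaussian {e. cinner q e / complex_of_real ((norm q)\<^sup>2) \<in> A} =
    measure std_gaussian {z. z / complex_of_real (norm q) \<in> A}"
proof -
  define f where "f e = cinner q e / complex_of_real (norm q)" for e
  have nq: "norm q \<noteq> 0" using q by simp
  have m: "{z. z / complex_of_real (norm q) \<in> A} \<in> sets borel"
  proof -
    have "(\<lambda>z. z / complex_of_real (norm q)) -` A \<inter> space borel \<in> sets borel"
      by (rule measurable_sets[OF _ A]) measurable
    then show ?thesis by (simp add: vimage_def)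
  qed
  have "measure std_gaussian {e. f e \<in> {z. z / complex_of_real (norm q) \<in> A}} =
      measure std_gaussian {z. z / complex_of_real (norm q) \<in> A}"
  proof (rule measure_std_gaussian_vimage[where g = "\<lambda>z. (z / complex_of_real (norm q)) *s q", OF _ _ _ _ m])
    show "linear f"
      by (intro linearI) (auto simp: f_def cinner_add_right add_divide_distrib scaleR_eq_scale cinner_scale_right scaleR_conv_of_real)
    show "linear (\<lambda>z. (z / complex_of_real (norm q)) *s q)"
      by (intro linearI) (auto simp: vec_eq_iff add_divide_distrib distrib_right divide_inverse)
    show "f ((y / complex_of_real (norm q)) *s q) = y" for y
    proof -
      have "f ((y / complex_of_real (norm q)) *s q) =
          y / complex_of_real (norm q) * (complex_of_real (norm q) * complex_of_real (norm q)) / complex_of_real (norm q)"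
        by (simp only: f_def cinner_scale_right cinner_self of_real_mult power2_eq_square)
      also have "\<dots> = y" using nq by (simp add: field_simps)
      finally show ?thesis .
    qed
    show "f x \<bullet> y = x \<bullet> ((y / complex_of_real (norm q)) *s q)" for x y
    proof -
      have "f x \<bullet> y = Re (cnj (f x) * y)" by (simp add: inner_complex_def)
      also have "cnj (f x) = cinner x q / complex_of_real (norm q)" by (simp add: f_def cnj_cinner)
      also have "Re (cinner x q / complex_of_real (norm q) * y) = Re (cinner x ((y / complex_of_real (norm q)) *s q))"
        by (simp add: cinner_scale_right mult.commute)
      finally show ?thesis by (simp only: Re_cinner)
    qed
  qed
  then show ?thesis by (simp add: f_def power2_eq_square)
qed

section \<open>Measurability of the receiver\<close>

lemma continuous_on_det:
  "continuous_on S (\<lambda>A :: complex ^ 'n ^ 'n. det A)"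
proof -
  have "continuous_on S (\<lambda>A :: complex ^ 'n ^ 'n.
      \<Sum>p\<in>{p. p permutes UNIV}. of_int (sign p) * (\<Prod>i\<in>UNIV. A $ i $ p i))"
    by (intro continuous_on_sum continuous_on_mult continuous_on_const continuous_on_prod continuous_on_component continuous_on_id)
  then show ?thesis unfolding det_def .
qed

text \<open>By Cramer's rule the inverse is a quotient of determinants where the determinant is
  nonzero; elsewhere it is a constant.\<close>

lemma matrix_inv_borel_measurable:
  "(matrix_inv :: complex ^ 'n ^ 'n \<Rightarrow> _) \<in> borel_measurable borel"
proof -
  \<comment> \<open>The value of \<open>matrix_inv\<close> at every singular matrix, where the
    defining choice ranges over the empty predicate.\<close>
  define c :: "complex ^ 'n ^ 'n" where "c = (SOME A. False)"
  define cof :: "complex ^ 'n ^ 'n \<Rightarrow> complex ^ 'n ^ 'n" where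
    "cof A = (\<chi> i j. det (\<chi> a b. if b = i then axis j 1 $ a else A $ a $ b) / det A)" for A
  have eq: "matrix_inv A = (if det A \<noteq> 0 then cof A else c)" for A :: "complex ^ 'n ^ 'n"
  proof (cases "det A = 0")
    case True
    then have "\<not> (A ** A' = mat 1 \<and> A' ** A = mat 1)" for A'
      using invertible_det_nz[of A] by (auto simp: invertible_def)
    then have "(\<lambda>A'. A ** A' = mat 1 \<and> A' ** A = mat 1) = (\<lambda>_. False)" by blast
    then show ?thesis using True by (simp only: matrix_inv_def c_def) simp
  next
    case False
    then have inv: "invertible A" by (simp add: invertible_det_nz)
    have "column j (matrix_inv A) = (\<chi> i. det (\<chi> a b. if b = i then axis j 1 $ a else A $ a $ b) / det A)" for j
    proof -
      have "A *v column j (matrix_inv A) = axis j 1"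
        unfolding column_mult[symmetric] matrix_inv_cancel(2)[OF inv]
        by (simp add: column_def mat_def axis_def vec_eq_iff)
      then show ?thesis using cramer[OF False] by simp
    qed
    then show ?thesis using False by (simp add: cof_def column_def vec_eq_iff)
  qed
  have det[measurable]: "det \<in> borel_measurable (borel :: (complex ^ 'n ^ 'n) measure)"
    by (intro borel_measurable_continuous_onI continuous_on_det)
  have [measurable]: "cof \<in> borel_measurable borel"
    unfolding cof_def
  proof (intro borel_measurable_vecI, simp, intro borel_measurable_divide det)
    fix i j
    have "continuous_on UNIV (\<lambda>A :: complex ^ 'n ^ 'n. (\<chi> a b. if b = i then axis j 1 $ a else A $ a $ b) :: complex ^ 'n ^ 'n)"
    proof (intro continuous_on_vec_lambda)
      show "continuous_on UNIV (\<lambda>A :: complex ^ 'n ^ 'n. if b = i then axis j 1 $ a else A $ a $ b)" for a b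
        by (cases "b = i") (simp_all add: continuous_on_component)
    qed
    from continuous_on_compose[OF this continuous_on_det]
    show "(\<lambda>A :: complex ^ 'n ^ 'n. det (\<chi> a b. if b = i then axis j 1 $ a else A $ a $ b)) \<in> borel_measurable borel"
      by (intro borel_measurable_continuous_onI) (simp add: comp_def)
  qed
  then show ?thesis
    unfolding eq[abs_def] by measurable
qed

lemma borel_measurable_matrix_vector_mult[measurable]:
  fixes f :: "'b \<Rightarrow> complex ^ 'n ^ 'm" and g :: "'b \<Rightarrow> complex ^ 'n"
  assumes [measurable]: "f \<in> borel_measurable M" "g \<in> borel_measurable M"
  shows "(\<lambda>x. f x *v g x) \<in> borel_measurable M"
proof (rule borel_measurable_vecI)
  show "(\<lambda>x. (f x *v g x) $ i) \<in> borel_measurable M" for i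
    unfolding matrix_vector_mult_def vec_lambda_beta by measurable
qed

lemma borel_measurable_matrix_matrix_mult[measurable]:
  fixes f :: "'b \<Rightarrow> complex ^ 'n ^ 'm" and g :: "'b \<Rightarrow> complex ^ 'k ^ 'n"
  assumes [measurable]: "f \<in> borel_measurable M" "g \<in> borel_measurable M"
  shows "(\<lambda>x. f x ** g x) \<in> borel_measurable M"
proof (intro borel_measurable_vecI)
  show "(\<lambda>x. (f x ** g x) $ i $ j) \<in> borel_measurable M" for i j
    unfolding matrix_matrix_mult_def vec_lambda_beta by measurable
qed

lemma borel_measurable_ctranspose[measurable]:
  fixes f :: "'b \<Rightarrow> complex ^ 'n ^ 'm"
  assumes [measurable]: "f \<in> borel_measurable M"
  shows "(\<lambda>x. (f x)\<^sup>H) \<in> borel_measurable M"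
proof (intro borel_measurable_vecI)
  show "(\<lambda>x. (f x)\<^sup>H $ i $ j) \<in> borel_measurable M" for i j
    by (simp add: borel_measurable_complex_iff)
qed

lemma borel_measurable_zf_inverse[measurable]:
  fixes f :: "'b \<Rightarrow> complex ^ 'n ^ 'm"
  assumes [measurable]: "f \<in> borel_measurable M"
  shows "(\<lambda>x. zf_inverse (f x)) \<in> borel_measurable M"
proof -
  have "(\<lambda>x. matrix_inv ((f x)\<^sup>H ** f x)) \<in> borel_measurable M"
    by (rule measurable_compose[OF _ matrix_inv_borel_measurable]) measurable
  then show ?thesis
    unfolding zf_inverse_def by (rule borel_measurable_matrix_matrix_mult) measurable
qed

section \<open>Averaging the error over the channel\<close>

text \<open>For fixed other columns the error depends on the fresh column \<open>w\<close> only
  through its distance to their span \<open>V\<close>. Craig's form has this squared distance in an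
  exponent, so exchanging the two integrals turns the average over \<open>w\<close> into a Laplace
  transform, evaluated separately for each \<theta>.\<close>

lemma sum_column_error_given_column_space:
  fixes Z :: "complex ^ 'n ^ 'm"
  assumes v: "valid_order md M" and \<rho>: "\<rho> > 0" and nm: "CARD('n) \<le> CARD('m)"
    and Z: "full_rank_on UNIV Z"
  defines "S \<equiv> constellation md M"
  shows "(\<integral>\<^sup>+w. (\<Sum>c\<in>S. emeasure std_gaussian
      {e. decide S (c + complex_of_real \<rho> * (zf_inverse (set_column k w Z) *v e) $ k) \<noteq> c}) \<partial>std_gaussian) =
    ennreal (real M) * (\<integral>\<^sup>+\<theta>. ennreal (mod_weight md M \<theta>) *
      ennreal ((1 / (1 + mod_gain md M / \<rho>\<^sup>2 / (sin \<theta>)\<^sup>2)) ^ (CARD('m) - CARD('n) + 1)) \<partial>lborel)"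
proof -
  interpret P: pair_sigma_finite "std_gaussian :: (complex ^ 'm) measure" "lborel :: real measure"
    by (rule pair_sigma_finite.intro[OF prob_space_imp_sigma_finite[OF prob_space_std_gaussian]
        lborel.sigma_finite_measure_axioms])
  define p where "p c Z' = emeasure std_gaussian {e. decide S (c + complex_of_real \<rho> * (zf_inverse Z' *v e) $ k) \<noteq> c}"
    for c and Z' :: "complex ^ 'n ^ 'm"
  define V where "V = (\<lambda>v. Z *v v) ` {v. v $ k = 0}"
  note lin = linear_matrix_vector_mult_complex[of Z]
  have "subspace {v :: complex ^ 'n. v $ k = 0}" by (auto simp: subspace_def)
  then have sub: "subspace V" unfolding V_def using lin by (rule linear_subspace_image[rotated])
  have inj: "inj (\<lambda>v. Z *v v)"
    using Z by (intro linear_injective_0[THEN iffD2, OF lin]) (auto simp: full_rank_UNIV)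
  have dimV: "dim V = 2 * CARD('n) - 2"
    unfolding V_def dim_vanishing_coordinate[of k, symmetric]
    by (rule dim_image_eq[OF lin]) (rule inj_on_subset[OF inj], simp)
  obtain B where B: "pairwise orthogonal B" "\<And>b. b \<in> B \<Longrightarrow> norm b = 1" "finite B"
    "card B + dim V = DIM(complex ^ 'm)" "\<And>b x. b \<in> B \<Longrightarrow> x \<in> V \<Longrightarrow> b \<bullet> x = 0"
    "\<And>w. w - (\<Sum>b\<in>B. (w \<bullet> b) *\<^sub>R b) \<in> V"
    by (rule orthonormal_basis_complement[OF sub], rule that)
  have npos: "0 < CARD('n)" by simp
  \<comment> \<open>Real dimensions: 2 m for the whole space minus 2 n - 2 for the span of the
    remaining n - 1 columns.\<close>
  have cardB: "card B = 2 * (CARD('m) - CARD('n) + 1)"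
  proof -
    obtain a where a: "CARD('n) = Suc a" using npos gr0_implies_Suc by blast
    obtain e where e: "CARD('m) = CARD('n) + e" using nm le_Suc_ex by blast
    show ?thesis using B(4) unfolding dimV DIM_cart DIM_complex e a by simp
  qed
  have "dim V < DIM(complex ^ 'm)"
  proof -
    have "0 < card B" by (simp add: cardB)
    then show ?thesis using B(4) by simp
  qed
  then have AEw: "AE w in std_gaussian. w \<notin> V" by (rule AE_std_gaussian_notin_subspace)
  define q where "q w = (\<Sum>b\<in>B. (w \<bullet> b) *\<^sub>R b)" for w
  have normq: "(norm (q w))\<^sup>2 = (\<Sum>b\<in>B. (w \<bullet> b)\<^sup>2)" for w
  proof -
    have "(norm (q w))\<^sup>2 = (\<Sum>b\<in>B. (norm ((w \<bullet> b) *\<^sub>R b))\<^sup>2)"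
      unfolding q_def using B(1,3)
      by (intro norm_sum_Pythagorean) (auto simp: pairwise_def orthogonal_def)
    also have "\<dots> = (\<Sum>b\<in>B. (w \<bullet> b)\<^sup>2)"
      using B(2) by (intro sum.cong) auto
    finally show ?thesis .
  qed
  have fin: "finite S" unfolding S_def using v by (rule finite_constellation)
  let ?t = "\<lambda>\<theta>. mod_gain md M / \<rho>\<^sup>2 / (sin \<theta>)\<^sup>2"
  have t0: "?t \<theta> \<ge> 0" for \<theta> using mod_gain_pos[OF v] by simp
  have inner: "(\<Sum>c\<in>S. p c (set_column k w Z)) = ennreal (real M) *
      (\<integral>\<^sup>+\<theta>. ennreal (mod_weight md M \<theta>) * ennreal (exp (- (?t \<theta> * (\<Sum>b\<in>B. (w \<bullet> b)\<^sup>2)))) \<partial>lborel)"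
    if w: "w \<notin> V" for w
  proof -
    define Z' where "Z' = set_column k w Z"
    have Z': "full_rank_on UNIV Z'"
      using full_rank_on_set_column[OF Z, of w k] w by (simp add: V_def Z'_def)
    have "w - q w \<in> V" using B(6) by (simp add: q_def)
    then obtain v0 where v0: "v0 $ k = 0" "w - q w = Z *v v0" by (auto simp: V_def)
    have Z'v: "Z' *v x = Z *v x" if "x $ k = 0" for x
    proof -
      have "(\<chi> j. if j = k then 0 else x $ j) = x" using that by (simp add: vec_eq_iff)
      then show ?thesis using that by (simp add: Z'_def set_column_mult)
    qed
    \<comment> \<open>Subtracting the coefficients \<open>v0\<close> of the projection of
      \<open>w\<close> onto \<open>V\<close> makes \<open>Z' *v u\<close> the residual
      \<open>q w\<close>.\<close>
    define u where "u = axis k 1 - v0"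
    have u: "u $ k = 1" using v0(1) by (simp add: u_def)
    have "(\<chi> j. if j = k then 0 else u $ j) = - v0"
      using v0(1) by (simp add: vec_eq_iff u_def axis_def)
    then have "Z' *v u = w - Z *v v0"
      using u by (simp add: Z'_def set_column_mult linear_neg[OF lin])
    then have q: "Z' *v u = q w" by (simp flip: v0(2))
    have qV: "q w \<bullet> x = 0" if "x \<in> V" for x
      using B(5)[OF _ that] by (simp add: q_def inner_sum_left)
    \<comment> \<open>\<open>V\<close> is closed under multiplication by \<i>, so real orthogonality
      to \<open>V\<close> already gives complex orthogonality: the imaginary part is tested with
      \<open>\<i> *s x\<close>.\<close>
    have orth: "cinner (Z' *v u) (Z' *v x) = 0" if x: "x $ k = 0" for x
    proof (rule complex_eqI)
      have "Z *v x \<in> V" using x by (auto simp: V_def)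
      then show "Re (cinner (Z' *v u) (Z' *v x)) = Re 0"
        using qV by (simp add: q Z'v[OF x] Re_cinner)
      have "Z *v (\<i> *s x) \<in> V" using x by (auto simp: V_def)
      from qV[OF this] have "Re (cinner (q w) (\<i> *s (Z *v x))) = 0"
        by (simp add: Re_cinner vector_scalar_commute)
      then show "Im (cinner (Z' *v u) (Z' *v x)) = Im 0"
        by (simp add: q Z'v[OF x] cinner_scale_right)
    qed
    note comp = zf_inverse_component[OF Z' u orth, unfolded q]
    have q0: "q w \<noteq> 0" using comp(2) .
    define r where "r = \<rho> / norm (q w)"
    have r: "r > 0" using \<rho> q0 by (simp add: r_def)
    have "p c Z' = ennreal (measure std_gaussian {z. decide S (c + complex_of_real r * z) \<noteq> c})" for c
    proof -
      define A where "A = {\<nu>. decide S (c + complex_of_real \<rho> * \<nu>) \<noteq> c}"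
      have A: "A \<in> sets borel"
      proof -
        have "(\<lambda>\<nu>. c + complex_of_real \<rho> * \<nu>) -` {z. decide S z = c} \<inter> space borel \<in> sets borel"
          by (rule measurable_sets[OF _ decide_borel_measurable[OF fin]]) measurable
        then have "- ((\<lambda>\<nu>. c + complex_of_real \<rho> * \<nu>) -` {z. decide S z = c}) \<in> sets borel" by simp
        also have "- ((\<lambda>\<nu>. c + complex_of_real \<rho> * \<nu>) -` {z. decide S z = c}) = A"
          by (auto simp: A_def)
        finally show ?thesis .
      qed
      have "p c Z' = emeasure std_gaussian {e. cinner (q w) e / complex_of_real ((norm (q w))\<^sup>2) \<in> A}"
        by (simp add: p_def A_def comp(1))
      also have "\<dots> = ennreal (measure std_gaussian {e. cinner (q w) e / complex_of_real ((norm (q w))\<^sup>2) \<in> A})"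
        by (rule std_gaussian.emeasure_eq_measure)
      also have "\<dots> = ennreal (measure std_gaussian {z. z / complex_of_real (norm (q w)) \<in> A})"
        by (simp only: measure_std_gaussian_cinner[OF q0 A])
      also have "{z. z / complex_of_real (norm (q w)) \<in> A} = {z. decide S (c + complex_of_real r * z) \<noteq> c}"
        by (simp add: A_def r_def)
      finally show ?thesis .
    qed
    then have "(\<Sum>c\<in>S. p c Z') = (\<Sum>c\<in>S. ennreal (measure std_gaussian {z. decide S (c + complex_of_real r * z) \<noteq> c}))"
      by simp
    also have "\<dots> = ennreal (real M) * (\<integral>\<^sup>+\<theta>. ennreal (mod_weight md M \<theta>) *
        ennreal (exp (- (mod_gain md M / r\<^sup>2 / (sin \<theta>)\<^sup>2))) \<partial>lborel)"
      unfolding S_def by (rule sum_decide_error[OF v r])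
    also have "\<dots> = ennreal (real M) *
      (\<integral>\<^sup>+\<theta>. ennreal (mod_weight md M \<theta>) * ennreal (exp (- (?t \<theta> * (\<Sum>b\<in>B. (w \<bullet> b)\<^sup>2)))) \<partial>lborel)"
    proof -
      have "mod_gain md M / r\<^sup>2 / (sin \<theta>)\<^sup>2 = ?t \<theta> * (\<Sum>b\<in>B. (w \<bullet> b)\<^sup>2)" for \<theta>
        by (simp add: r_def power_divide normq)
      then show ?thesis by (simp only:)
    qed
    finally show ?thesis unfolding Z'_def .
  qed
  have "(\<integral>\<^sup>+w. (\<Sum>c\<in>S. p c (set_column k w Z)) \<partial>std_gaussian) = (\<integral>\<^sup>+w. ennreal (real M) *
      (\<integral>\<^sup>+\<theta>. ennreal (mod_weight md M \<theta>) * ennreal (exp (- (?t \<theta> * (\<Sum>b\<in>B. (w \<bullet> b)\<^sup>2)))) \<partial>lborel) \<partial>std_gaussian)"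
    using AEw by (intro nn_integral_cong_AE) (auto elim!: eventually_mono simp: inner)
  also have "\<dots> = ennreal (real M) * (\<integral>\<^sup>+w. \<integral>\<^sup>+\<theta>. ennreal (mod_weight md M \<theta>) *
      ennreal (exp (- (?t \<theta> * (\<Sum>b\<in>B. (w \<bullet> b)\<^sup>2)))) \<partial>lborel \<partial>std_gaussian)"
    by (rule nn_integral_cmult) measurable
  also have "(\<integral>\<^sup>+w. \<integral>\<^sup>+\<theta>. ennreal (mod_weight md M \<theta>) *
      ennreal (exp (- (?t \<theta> * (\<Sum>b\<in>B. (w \<bullet> b)\<^sup>2)))) \<partial>lborel \<partial>std_gaussian) =
     (\<integral>\<^sup>+\<theta>. \<integral>\<^sup>+w. ennreal (mod_weight md M \<theta>) *
      ennreal (exp (- (?t \<theta> * (\<Sum>b\<in>B. (w \<bullet> b)\<^sup>2)))) \<partial>std_gaussian \<partial>lborel)"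
    by (rule P.Fubini'[symmetric]) measurable
  also have "\<dots> = (\<integral>\<^sup>+\<theta>. ennreal (mod_weight md M \<theta>) *
      ennreal ((1 / (1 + ?t \<theta>)) ^ (CARD('m) - CARD('n) + 1)) \<partial>lborel)"
  proof (rule nn_integral_cong)
    fix \<theta>
    have "(\<integral>\<^sup>+w. ennreal (mod_weight md M \<theta>) * ennreal (exp (- (?t \<theta> * (\<Sum>b\<in>B. (w \<bullet> b)\<^sup>2)))) \<partial>std_gaussian) =
      ennreal (mod_weight md M \<theta>) * (\<integral>\<^sup>+w. ennreal (exp (- (?t \<theta> * (\<Sum>b\<in>B. (w \<bullet> b)\<^sup>2)))) \<partial>std_gaussian)"
      by (rule nn_integral_cmult) measurable
    also have "(\<integral>\<^sup>+w. ennreal (exp (- (?t \<theta> * (\<Sum>b\<in>B. (w \<bullet> b)\<^sup>2)))) \<partial>std_gaussian) = ennreal ((1 / sqrt (1 + ?t \<theta>)) ^ card B)"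
      by (rule exp_orthonormal_std_gaussian[OF B(1,2) t0])
    \<comment> \<open>Two real coordinates per complex dimension: the square roots pair up into the
      exponent m - n + 1.\<close>
    also have "(1 / sqrt (1 + ?t \<theta>)) ^ card B = (1 / (1 + ?t \<theta>)) ^ (CARD('m) - CARD('n) + 1)"
    proof -
      have "(1 / sqrt (1 + ?t \<theta>))\<^sup>2 = 1 / (1 + ?t \<theta>)"
        unfolding power_divide using t0[of \<theta>] by simp
      then show ?thesis unfolding cardB power_mult by (simp only:)
    qed
    finally show "(\<integral>\<^sup>+w. ennreal (mod_weight md M \<theta>) * ennreal (exp (- (?t \<theta> * (\<Sum>b\<in>B. (w \<bullet> b)\<^sup>2)))) \<partial>std_gaussian) =
      ennreal (mod_weight md M \<theta>) * ennreal ((1 / (1 + ?t \<theta>)) ^ (CARD('m) - CARD('n) + 1))" .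
  qed
  finally show ?thesis by (simp only: p_def)
qed

text \<open>For almost every choice of the other columns the inner average is the same number, so
  the outer integral runs over a constant.\<close>

lemma expected_decide_error:
  fixes k :: "'n::finite"
  assumes v: "valid_order md M" and \<rho>: "\<rho> > 0" and nm: "CARD('n) \<le> CARD('m::finite)"
  defines "S \<equiv> constellation md M"
  shows "(\<Sum>c\<in>S. emeasure (std_gaussian \<Otimes>\<^sub>M std_gaussian)
      {p :: (complex ^ 'n ^ 'm) \<times> (complex ^ 'm). decide S (c + complex_of_real \<rho> * (zf_inverse (fst p) *v snd p) $ k) \<noteq> c}) =
    ennreal (real M) * (\<integral>\<^sup>+\<theta>. ennreal (mod_weight md M \<theta>) *
      ennreal ((1 / (1 + mod_gain md M / \<rho>\<^sup>2 / (sin \<theta>)\<^sup>2)) ^ (CARD('m) - CARD('n) + 1)) \<partial>lborel)"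
proof -
  have fin: "finite S" unfolding S_def using v by (rule finite_constellation)
  define E where "E c = {p :: (complex ^ 'n ^ 'm) \<times> (complex ^ 'm).
      decide S (c + complex_of_real \<rho> * (zf_inverse (fst p) *v snd p) $ k) \<noteq> c}" for c
  have E[measurable]: "E c \<in> sets (borel \<Otimes>\<^sub>M borel)" for c
  proof -
    let ?f = "\<lambda>p :: (complex ^ 'n ^ 'm) \<times> (complex ^ 'm). c + complex_of_real \<rho> * (zf_inverse (fst p) *v snd p) $ k"
    have "?f \<in> borel_measurable (borel \<Otimes>\<^sub>M borel)" by measurable
    from sets.compl_sets[OF measurable_sets[OF this decide_borel_measurable[OF fin, of c]]]
    have "- (?f -` {z. decide S z = c}) \<in> sets (borel \<Otimes>\<^sub>M borel)"
      by (simp add: space_pair_measure Compl_eq_Diff_UNIV)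
    also have "- (?f -` {z. decide S z = c}) = E c" by (auto simp: E_def)
    finally show ?thesis .
  qed
  then have E': "E c \<in> sets (std_gaussian \<Otimes>\<^sub>M std_gaussian)" for c
    by (simp add: sets_pair_measure_cong[OF sets_std_gaussian sets_std_gaussian])
  define p where "p c Z' = emeasure std_gaussian {e. decide S (c + complex_of_real \<rho> * (zf_inverse Z' *v e) $ k) \<noteq> c}" for c and Z' :: "complex ^ 'n ^ 'm"
  have p: "p c Z = emeasure std_gaussian (Pair Z -` E c)" for c Z
    by (simp add: p_def E_def vimage_def)
  have pm: "p c \<in> borel_measurable borel" for c
    unfolding p[abs_def] using std_gaussian.measurable_emeasure_Pair[OF E', of c]
    by (simp add: measurable_cong_sets[OF sets_std_gaussian refl])
  have "(\<Sum>c\<in>S. emeasure (std_gaussian \<Otimes>\<^sub>M std_gaussian) (E c)) = (\<Sum>c\<in>S. \<integral>\<^sup>+Z. p c Z \<partial>std_gaussian)"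
    by (simp add: std_gaussian.emeasure_pair_measure_alt[OF E'] p)
  also have "\<dots> = (\<integral>\<^sup>+Z. (\<Sum>c\<in>S. p c Z) \<partial>std_gaussian)"
    using pm by (intro nn_integral_sum[symmetric]) (simp add: measurable_cong_sets[OF sets_std_gaussian refl])
  also have "\<dots> = (\<integral>\<^sup>+Z. \<integral>\<^sup>+w. (\<Sum>c\<in>S. p c (set_column k w Z)) \<partial>std_gaussian \<partial>std_gaussian)"
    using pm by (intro nn_integral_set_column) measurable
  also have "\<dots> = (\<integral>\<^sup>+Z. ennreal (real M) * (\<integral>\<^sup>+\<theta>. ennreal (mod_weight md M \<theta>) *
      ennreal ((1 / (1 + mod_gain md M / \<rho>\<^sup>2 / (sin \<theta>)\<^sup>2)) ^ (CARD('m) - CARD('n) + 1)) \<partial>lborel)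
      \<partial>(std_gaussian :: (complex ^ 'n ^ 'm) measure))"
  proof (rule nn_integral_cong_AE)
    show "AE Z in (std_gaussian :: (complex ^ 'n ^ 'm) measure).
      (\<integral>\<^sup>+w. (\<Sum>c\<in>S. p c (set_column k w Z)) \<partial>std_gaussian) =
       ennreal (real M) * (\<integral>\<^sup>+\<theta>. ennreal (mod_weight md M \<theta>) *
      ennreal ((1 / (1 + mod_gain md M / \<rho>\<^sup>2 / (sin \<theta>)\<^sup>2)) ^ (CARD('m) - CARD('n) + 1)) \<partial>lborel)"
      using AE_full_rank_on[OF nm, of UNIV]
    proof eventually_elim
      fix Z :: "complex ^ 'n ^ 'm" assume "full_rank_on UNIV Z"
      from sum_column_error_given_column_space[OF v \<rho> nm this, of k]
      show "(\<integral>\<^sup>+w. (\<Sum>c\<in>S. p c (set_column k w Z)) \<partial>std_gaussian) =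
       ennreal (real M) * (\<integral>\<^sup>+\<theta>. ennreal (mod_weight md M \<theta>) *
      ennreal ((1 / (1 + mod_gain md M / \<rho>\<^sup>2 / (sin \<theta>)\<^sup>2)) ^ (CARD('m) - CARD('n) + 1)) \<partial>lborel)"
        by (simp add: p_def S_def)
    qed
  qed
  also have "\<dots> = ennreal (real M) * (\<integral>\<^sup>+\<theta>. ennreal (mod_weight md M \<theta>) *
      ennreal ((1 / (1 + mod_gain md M / \<rho>\<^sup>2 / (sin \<theta>)\<^sup>2)) ^ (CARD('m) - CARD('n) + 1)) \<partial>lborel)"
    by (simp add: std_gaussian.emeasure_space_1[simplified])
  finally show ?thesis by (simp add: E_def)
qed

subsection \<open>Whitening\<close>

lemma linear_matrix_bij:
  fixes B :: "complex ^ 'n ^ 'n"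
  assumes "invertible B"
  shows "bij (\<lambda>v. B *v v)"
proof (rule bijI')
  note inv = matrix_inv_cancel[OF assms]
  show "(B *v x = B *v y) = (x = y)" for x y
  proof
    assume "B *v x = B *v y"
    then have "(matrix_inv B ** B) *v x = (matrix_inv B ** B) *v y"
      by (simp only: matrix_vector_mul_assoc[symmetric])
    then show "x = y" by (simp only: inv matrix_vector_mul_lid)
  qed simp
  show "\<exists>x. y = B *v x" for y
    by (rule exI[of _ "matrix_inv B *v y"]) (simp only: matrix_vector_mul_assoc inv matrix_vector_mul_lid)
qed

text \<open>In the coordinates y with z = B y the exponent of the density becomes - |y|^2. The
  normalizing constant and the Jacobian of \<open>B\<close> enter only through one common factor,
  which cancels because both laws have mass 1.\<close>

lemma (in prob_space) distr_whitened_gaussian: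
  fixes X :: "'a \<Rightarrow> complex ^ 'n" and B :: "complex ^ 'n ^ 'n"
  assumes D: "distributed M lborel X (\<lambda>z. ennreal (circ_gaussian_density C z))"
    and B: "B\<^sup>H ** matrix_inv C ** B = mat 1"
  shows "distr M borel (\<lambda>\<omega>. matrix_inv B *v X \<omega>) = std_gaussian"
proof -
  define d where "d z = ennreal (circ_gaussian_density C z)" for z :: "complex ^ 'n"
  have inv: "invertible B" by (rule invertible_left_inverse[THEN iffD2, OF exI, OF B])
  note invB = matrix_inv_cancel[OF inv]
  have lin: "linear (\<lambda>v. B *v v)" by (rule linear_matrix_vector_mult_complex)
  have bij: "bij (\<lambda>v. B *v v)" using inv by (rule linear_matrix_bij)
  have BB: "matrix_inv B *v (B *v y) = y" for y
    by (simp only: matrix_vector_mul_assoc invB matrix_vector_mul_lid)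
  define K where "K = pi ^ CARD('n) * Re (det C)"
  have dB: "d (B *v y) = ennreal (exp (- (norm y)\<^sup>2) / K)" for y
  proof -
    have "cinner (B *v y) (matrix_inv C *v (B *v y)) = cinner y ((B\<^sup>H ** matrix_inv C ** B) *v y)"
      by (simp only: cinner_ctranspose matrix_vector_mul_assoc matrix_mul_assoc)
    then show ?thesis by (simp add: d_def circ_gaussian_density_def B cinner_self K_def)
  qed
  have [measurable]: "X \<in> borel_measurable M"
    using distributed_measurable[OF D] by simp
  have [measurable]: "d \<in> borel_measurable borel"
    using distributed_borel_measurable[OF D] by (simp add: d_def[abs_def])
  have [measurable]: "(\<lambda>z. matrix_inv B *v z) \<in> borel_measurable borel"
    by (rule linear_borel_measurable) (rule linear_matrix_vector_mult_complex)
  have dist: "distr M lborel X = density lborel d"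
    using distributed_distr_eq_density[OF D] by (simp add: d_def[abs_def])
  have law: "(\<integral>\<^sup>+\<omega>. f (X \<omega>) \<partial>M) = (\<integral>\<^sup>+z. d z * f z \<partial>lborel)" if [measurable]: "f \<in> borel_measurable borel" for f
  proof -
    have "(\<integral>\<^sup>+\<omega>. f (X \<omega>) \<partial>M) = (\<integral>\<^sup>+z. f z \<partial>distr M lborel X)"
      by (subst nn_integral_distr) auto
    then show ?thesis by (simp add: dist nn_integral_density)
  qed
  have d1: "(\<integral>\<^sup>+z. d z \<partial>lborel) = 1"
    using law[of "\<lambda>_. 1"] by (simp add: emeasure_space_1)
  \<comment> \<open>The sign of the determinant is read off from the mass: for K \<le> 0 the density
    is truncated to 0 by \<open>ennreal\<close> (or divided by 0) and cannot integrate to 1.\<close>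
  have K: "K > 0"
  proof (rule ccontr)
    assume "\<not> K > 0"
    then have "d (B *v y) = 0" for y
      by (simp add: dB ennreal_neg divide_nonneg_nonpos)
    moreover have "\<exists>y. z = B *v y" for z using bij by (metis bij_pointE)
    ultimately have "d z = 0" for z by metis
    then show False using d1 by simp
  qed
  let ?s = "sqrt pi ^ DIM(complex ^ 'n)"
  have dB': "d (B *v y) = ennreal (?s / K) * ennreal (exp (- (norm y)\<^sup>2) / ?s)" for y
    using K unfolding dB by (simp add: ennreal_mult'[symmetric])
  have "0 < ?s / K" using K by (intro divide_pos_pos zero_less_power) simp_all
  then have cd: "ennreal (?s / K) \<noteq> 0" "ennreal (?s / K) \<noteq> \<infinity>"
    by (simp_all only: ennreal_eq_0_iff not_le ennreal_neq_top infinity_ennreal_def simp_thms)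
  show ?thesis
  proof (rule measure_eqI)
    fix A assume "A \<in> sets (distr M borel (\<lambda>\<omega>. matrix_inv B *v X \<omega>))"
    then have A[measurable]: "A \<in> sets borel" by simp
    let ?I = "\<integral>\<^sup>+z. d z * indicator A (matrix_inv B *v z) \<partial>lborel"
    have "emeasure (distr M borel (\<lambda>\<omega>. matrix_inv B *v X \<omega>)) A = (\<integral>\<^sup>+x. indicator A x \<partial>distr M borel (\<lambda>\<omega>. matrix_inv B *v X \<omega>))"
      by simp
    also have "\<dots> = (\<integral>\<^sup>+\<omega>. indicator A (matrix_inv B *v X \<omega>) \<partial>M)"
      by (rule nn_integral_distr) auto
    also have "\<dots> = ?I"
      by (rule law) measurable
    finally have 1: "emeasure (distr M borel (\<lambda>\<omega>. matrix_inv B *v X \<omega>)) A = ?I" .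
    have "ennreal (?s / K) * emeasure std_gaussian A =
        ennreal (?s / K) * (\<integral>\<^sup>+y. ennreal (exp (- (norm y)\<^sup>2) / ?s) * indicator A y \<partial>lborel)"
      by (simp add: std_gaussian_def emeasure_density)
    also have "\<dots> = (\<integral>\<^sup>+y. d (B *v y) * indicator A (matrix_inv B *v (B *v y)) \<partial>lborel)"
      unfolding dB' BB by (subst nn_integral_cmult[symmetric]) (auto simp: mult.assoc)
    also have "\<dots> = (\<integral>\<^sup>+y. d (B *v y) * indicator A (matrix_inv B *v (B *v y)) \<partial>lborel) * (\<integral>\<^sup>+z. d z \<partial>lborel)"
      by (simp add: d1)
    also have "\<dots> = (\<integral>\<^sup>+y. d (B *v y) \<partial>lborel) * ?I"
      by (rule nn_integral_linear_cross[OF lin bij, where g = "\<lambda>z. d z * indicator A (matrix_inv B *v z)" and h = d]) measurable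
    also have "(\<integral>\<^sup>+y. d (B *v y) \<partial>lborel) = ennreal (?s / K) * (\<integral>\<^sup>+y. ennreal (exp (- (norm y)\<^sup>2) / ?s) \<partial>(lborel :: (complex ^ 'n) measure))"
      unfolding dB' by (rule nn_integral_cmult) measurable
    also have "(\<integral>\<^sup>+y. ennreal (exp (- (norm y)\<^sup>2) / ?s) \<partial>(lborel :: (complex ^ 'n) measure)) = 1"
      using std_gaussian.emeasure_space_1[where 'a = "complex ^ 'n"] by (simp add: std_gaussian_def emeasure_density)
    finally have "ennreal (?s / K) * emeasure std_gaussian A = ennreal (?s / K) * ?I" by simp
    then have "emeasure std_gaussian A = ?I"
      using cd by (simp add: ennreal_mult_cancel_left)
    then show "emeasure (distr M borel (\<lambda>\<omega>. matrix_inv B *v X \<omega>)) A = emeasure std_gaussian A"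
      using 1 by simp
  qed simp
qed

text \<open>The covariance \<open>C'\<close> hidden in \<open>circ_gaussian\<close> is recovered by
  whitening: \<open>C' = B0 ** B0\<^sup>H\<close>, and \<open>X\<close> is the image under
  \<open>B0\<close> of a vector whose second moments are the identity. Hence \<open>C'\<close> is
  the matrix \<open>C\<close> of second moments of \<open>X\<close>.\<close>

lemma (in prob_space) circ_gaussian_standardize:
  fixes X :: "'a \<Rightarrow> complex ^ 'n" and B :: "complex ^ 'n ^ 'n"
  assumes X: "circ_gaussian M X" and cov: "\<And>i k. (\<integral>\<omega>. X \<omega> $ i * cnj (X \<omega> $ k) \<partial>M) = C $ i $ k"
  shows "hermitian_posdef C"
    and "B\<^sup>H ** matrix_inv C ** B = mat 1 \<Longrightarrow> distr M borel (\<lambda>\<omega>. matrix_inv B *v X \<omega>) = std_gaussian"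
    and "X \<in> borel_measurable M"
proof -
  obtain C' where C': "hermitian_posdef C'" and D: "distributed M lborel X (\<lambda>z. ennreal (circ_gaussian_density C' z))"
    using X by (auto simp: circ_gaussian_def)
  show [measurable]: "X \<in> borel_measurable M"
    using distributed_measurable[OF D] by simp
  have pd: "hermitian_posdef (matrix_inv C')" using C' by (rule posdef_inverse)
  \<comment> \<open>Any nonzero vector serves to start the Gram--Schmidt process here; no particular
    basis is needed.\<close>
  have "axis undefined 1 \<noteq> (0 :: complex ^ 'n)" by simp
  from posdef_orthonormal_basis[OF pd posdef_scale_unit[OF pd this]]
  obtain B0 :: "complex ^ 'n ^ 'n" where B0: "B0\<^sup>H ** matrix_inv C' ** B0 = mat 1" by blast
  have inv: "invertible B0" by (rule invertible_left_inverse[THEN iffD2, OF exI, OF B0])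
  have "B0 ** (B0\<^sup>H ** matrix_inv C') = mat 1"
    by (rule matrix_left_right_inverse[THEN iffD2, OF B0])
  then have "(B0 ** B0\<^sup>H) ** matrix_inv C' ** C' = C'" by (simp add: matrix_mul_assoc)
  then have C'B0: "C' = B0 ** B0\<^sup>H"
    by (simp only: matrix_mul_assoc[symmetric] matrix_inv_cancel(1)[OF posdef_invertible[OF C']] matrix_mul_rid)
  define Y where "Y \<omega> = matrix_inv B0 *v X \<omega>" for \<omega>
  have [measurable]: "(\<lambda>z. matrix_inv B0 *v z) \<in> borel_measurable borel"
    by (rule linear_borel_measurable) (rule linear_matrix_vector_mult_complex)
  have Ym[measurable]: "Y \<in> borel_measurable M" unfolding Y_def[abs_def] by measurable
  have XY: "X \<omega> = B0 *v Y \<omega>" for \<omega>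
    by (simp only: Y_def matrix_vector_mul_assoc matrix_inv_cancel[OF inv] matrix_vector_mul_lid)
  have lawY: "distr M borel Y = std_gaussian"
    unfolding Y_def[abs_def] by (rule distr_whitened_gaussian[OF D B0])
  have Ycov: "has_bochner_integral M (\<lambda>\<omega>. Y \<omega> $ a * cnj (Y \<omega> $ b)) (if a = b then 1 else 0)" for a b
  proof -
    have "has_bochner_integral (distr M borel Y) (\<lambda>y. y $ a * cnj (y $ b)) (if a = b then 1 else 0)"
      unfolding lawY by (rule has_bochner_std_gaussian_covariance)
    moreover have "(\<lambda>y :: complex ^ 'n. y $ a * cnj (y $ b)) \<in> borel_measurable borel"
      by (intro borel_measurable_continuous_onI continuous_intros)
    ultimately show ?thesis
      by (simp add: has_bochner_integral_iff integrable_distr_eq integral_distr)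
  qed
  have "C $ i $ k = C' $ i $ k" for i k
  proof -
    have "has_bochner_integral M (\<lambda>\<omega>. \<Sum>a\<in>UNIV. \<Sum>b\<in>UNIV. (B0 $ i $ a * cnj (B0 $ k $ b)) * (Y \<omega> $ a * cnj (Y \<omega> $ b)))
       (\<Sum>a\<in>UNIV. \<Sum>b\<in>UNIV. (B0 $ i $ a * cnj (B0 $ k $ b)) * (if a = b then 1 else 0))"
      by (intro has_bochner_integral_sum has_bochner_integral_mult_right Ycov)
    moreover have "(\<Sum>a\<in>UNIV. \<Sum>b\<in>UNIV. (B0 $ i $ a * cnj (B0 $ k $ b)) * (Y \<omega> $ a * cnj (Y \<omega> $ b))) = X \<omega> $ i * cnj (X \<omega> $ k)" for \<omega>
      unfolding XY by (simp add: matrix_vector_mult_def sum_product cnj_sum mult_ac)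
    moreover have "(\<Sum>a\<in>UNIV. \<Sum>b\<in>UNIV. (B0 $ i $ a * cnj (B0 $ k $ b)) * (if a = b then 1 else 0)) = C' $ i $ k"
      unfolding C'B0 by (simp add: matrix_matrix_mult_def if_distrib cong: if_cong)
    ultimately show ?thesis using cov[of i k] by (simp add: has_bochner_integral_iff)
  qed
  then have "C = C'" by (simp add: vec_eq_iff)
  then show "hermitian_posdef C"
    and "B\<^sup>H ** matrix_inv C ** B = mat 1 \<Longrightarrow> distr M borel (\<lambda>\<omega>. matrix_inv B *v X \<omega>) = std_gaussian"
    using C' distr_whitened_gaussian[OF D] by auto
qed

text \<open>Independence speaks of products of single events, whereas a decision error is a general
  event \<open>A\<close> in the pair of whitened channel and noise. Restricted to \<open>Y\<close>
  in \<open>B\<close>, the law of the pair agrees with a scaled product measure on rectangles, and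
  therefore everywhere.\<close>

lemma (in prob_space) indep_three_emeasure:
  fixes X :: "'a \<Rightarrow> 'b::topological_space" and Y :: "'a \<Rightarrow> 'c::topological_space" and Z :: "'a \<Rightarrow> 'd::topological_space"
    and f :: "'b \<Rightarrow> 'e::topological_space" and g :: "'d \<Rightarrow> 'f::topological_space"
  assumes ind: "indep_three X Y Z" and B: "B \<in> sets borel"
    and f[measurable]: "f \<in> borel_measurable borel" and g[measurable]: "g \<in> borel_measurable borel"
    and A: "A \<in> sets (borel \<Otimes>\<^sub>M borel)"
  shows "emeasure M {\<omega> \<in> space M. Y \<omega> \<in> B \<and> (f (X \<omega>), g (Z \<omega>)) \<in> A} =
    emeasure M {\<omega> \<in> space M. Y \<omega> \<in> B} * emeasure (distr M borel (\<lambda>\<omega>. f (X \<omega>)) \<Otimes>\<^sub>M distr M borel (\<lambda>\<omega>. g (Z \<omega>))) A"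
proof -
  have [measurable]: "X \<in> borel_measurable M" "Y \<in> borel_measurable M" "Z \<in> borel_measurable M"
    using ind by (simp_all add: indep_three_def)
  note B[measurable] A[measurable]
  define E where "E = {\<omega> \<in> space M. Y \<omega> \<in> B}"
  have E[measurable]: "E \<in> sets M" unfolding E_def by measurable
  have prod: "prob ((X -` A1 \<inter> space M) \<inter> E \<inter> (Z -` A2 \<inter> space M)) =
      prob (X -` A1 \<inter> space M) * prob E * prob (Z -` A2 \<inter> space M)"
    if "A1 \<in> sets borel" "A2 \<in> sets borel" for A1 A2
  proof -
    let ?F = "(!) [{X -` A \<inter> space M | A. A \<in> sets borel}, {Y -` A \<inter> space M | A. A \<in> sets borel},
       {Z -` A \<inter> space M | A. A \<in> sets borel}]"
    let ?A = "(!) [X -` A1 \<inter> space M, E, Z -` A2 \<inter> space M]"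
    have ind': "indep_sets ?F {0, 1, 2::nat}" using ind by (simp add: indep_three_def)
    have EY: "E = Y -` B \<inter> space M" by (auto simp: E_def)
    have "?A \<in> Pi {0, 1, 2} ?F"
      using that B by (auto simp: Pi_iff EY)
    with ind' have "prob (\<Inter>j\<in>{0, 1, 2::nat}. ?A j) = (\<Prod>j\<in>{0, 1, 2::nat}. prob (?A j))"
      unfolding indep_sets_def by blast
    then show ?thesis by (simp add: Int_ac mult_ac)
  qed
  interpret PX: prob_space "distr M borel (\<lambda>\<omega>. f (X \<omega>))" by (rule prob_space_distr) measurable
  interpret PZ: prob_space "distr M borel (\<lambda>\<omega>. g (Z \<omega>))" by (rule prob_space_distr) measurable
  let ?M1 = "density (distr M borel (\<lambda>\<omega>. f (X \<omega>))) (\<lambda>_. emeasure M E)"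
  \<comment> \<open>The unnormalized law of the pair on the event \<open>E\<close>. Avoiding
    division by its probability covers the case of probability 0.\<close>
  let ?N = "distr (density M (indicator E)) (borel \<Otimes>\<^sub>M borel) (\<lambda>\<omega>. (f (X \<omega>), g (Z \<omega>)))"
  have "?M1 \<Otimes>\<^sub>M distr M borel (\<lambda>\<omega>. g (Z \<omega>)) = ?N"
  proof (rule pair_measure_eqI)
    have "finite_measure ?M1"
      by (rule finite_measureI) (simp add: emeasure_density nn_integral_const PX.emeasure_space_1[simplified] emeasure_eq_measure)
    then show "sigma_finite_measure ?M1" by (rule finite_measure.axioms(1))
    show "sigma_finite_measure (distr M borel (\<lambda>\<omega>. g (Z \<omega>)))" by (rule prob_space_imp_sigma_finite) (rule PZ.prob_space_axioms)
    show "sets (?M1 \<Otimes>\<^sub>M distr M borel (\<lambda>\<omega>. g (Z \<omega>))) = sets ?N"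
      by (simp cong: sets_pair_measure_cong)
    fix A1 A2 assume "A1 \<in> sets ?M1" "A2 \<in> sets (distr M borel (\<lambda>\<omega>. g (Z \<omega>)))"
    then have A12[measurable]: "A1 \<in> sets borel" "A2 \<in> sets borel" by simp_all
    have f1: "f -` A1 \<in> sets borel" "g -` A2 \<in> sets borel"
      using measurable_sets[OF f A12(1)] measurable_sets[OF g A12(2)] by simp_all
    have eX: "emeasure ?M1 A1 = ennreal (prob E * prob (X -` (f -` A1) \<inter> space M))"
      by (simp add: emeasure_density nn_integral_cmult_indicator emeasure_distr emeasure_eq_measure ennreal_mult' vimage_def)
    have eZ: "emeasure (distr M borel (\<lambda>\<omega>. g (Z \<omega>))) A2 = ennreal (prob (Z -` (g -` A2) \<inter> space M))"
      by (simp add: emeasure_distr emeasure_eq_measure vimage_def)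
    have "emeasure ?N (A1 \<times> A2) = emeasure (density M (indicator E)) {\<omega> \<in> space M. f (X \<omega>) \<in> A1 \<and> g (Z \<omega>) \<in> A2}"
      by (subst emeasure_distr) (auto intro!: arg_cong2[where f = emeasure])
    also have "\<dots> = emeasure M ((X -` (f -` A1) \<inter> space M) \<inter> E \<inter> (Z -` (g -` A2) \<inter> space M))"
      by (subst emeasure_density) (auto simp: indicator_inter_arith[symmetric] E_def intro!: arg_cong2[where f = emeasure])
    also have "\<dots> = ennreal (prob (X -` (f -` A1) \<inter> space M) * prob E * prob (Z -` (g -` A2) \<inter> space M))"
      unfolding emeasure_eq_measure prod[OF f1] ..
    finally show "emeasure ?M1 A1 * emeasure (distr M borel (\<lambda>\<omega>. g (Z \<omega>))) A2 = emeasure ?N (A1 \<times> A2)"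
      unfolding eX eZ by (simp add: ennreal_mult'[symmetric] mult_ac)
  qed
  then have "emeasure ?N A = emeasure (?M1 \<Otimes>\<^sub>M distr M borel (\<lambda>\<omega>. g (Z \<omega>))) A" by simp
  also have "\<dots> = (\<integral>\<^sup>+x. emeasure (distr M borel (\<lambda>\<omega>. g (Z \<omega>))) (Pair x -` A) \<partial>?M1)"
    by (rule PZ.emeasure_pair_measure_alt) (simp cong: sets_pair_measure_cong)
  also have "\<dots> = emeasure M E * (\<integral>\<^sup>+x. emeasure (distr M borel (\<lambda>\<omega>. g (Z \<omega>))) (Pair x -` A) \<partial>distr M borel (\<lambda>\<omega>. f (X \<omega>)))"
  proof -
    have "(\<lambda>x. emeasure (distr M borel (\<lambda>\<omega>. g (Z \<omega>))) (Pair x -` A)) \<in> borel_measurable (distr M borel (\<lambda>\<omega>. f (X \<omega>)))"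
      by (rule PZ.measurable_emeasure_Pair) (simp cong: sets_pair_measure_cong)
    then show ?thesis by (simp add: nn_integral_density nn_integral_cmult)
  qed
  also have "(\<integral>\<^sup>+x. emeasure (distr M borel (\<lambda>\<omega>. g (Z \<omega>))) (Pair x -` A) \<partial>distr M borel (\<lambda>\<omega>. f (X \<omega>))) =
      emeasure (distr M borel (\<lambda>\<omega>. f (X \<omega>)) \<Otimes>\<^sub>M distr M borel (\<lambda>\<omega>. g (Z \<omega>))) A"
    by (rule PZ.emeasure_pair_measure_alt[symmetric]) (simp cong: sets_pair_measure_cong)
  finally have "emeasure ?N A = emeasure M E * emeasure (distr M borel (\<lambda>\<omega>. f (X \<omega>)) \<Otimes>\<^sub>M distr M borel (\<lambda>\<omega>. g (Z \<omega>))) A" .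
  moreover have "emeasure ?N A = emeasure M {\<omega> \<in> space M. Y \<omega> \<in> B \<and> (f (X \<omega>), g (Z \<omega>)) \<in> A}"
  proof -
    have "emeasure ?N A = emeasure (density M (indicator E)) {\<omega> \<in> space M. (f (X \<omega>), g (Z \<omega>)) \<in> A}"
      by (subst emeasure_distr) (auto intro!: arg_cong2[where f = emeasure])
    also have "\<dots> = emeasure M {\<omega> \<in> space M. Y \<omega> \<in> B \<and> (f (X \<omega>), g (Z \<omega>)) \<in> A}"
      by (subst emeasure_density) (auto simp: indicator_inter_arith[symmetric] E_def intro!: arg_cong2[where f = emeasure])
    finally show ?thesis .
  qed
  ultimately show ?thesis by (simp add: E_def)
qed

section \<open>The error probability of a single symbol\<close>

text \<open>The number written x in the overview: the inverse of
  \<open>F\<^sup>H ** \<Sigma> ** F\<close>, expanded into a product of inverses.\<close>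

definition noise_gain :: "complex ^ 'n ^ 'n \<Rightarrow> complex ^ 'n ^ 'n \<Rightarrow> 'n \<Rightarrow> real"
  where "noise_gain \<Sigma> F k = Re ((matrix_inv F ** matrix_inv \<Sigma> ** (matrix_inv F)\<^sup>H) $ k $ k)"

text \<open>For n \<le> m the integer exponent is minus a natural number, so each kernel is an
  ordinary power of a number in [0, 1]. At sin \<theta> = 0 both forms divide by zero and take the
  value 1.\<close>

lemma G_fun_eq_weighted_integral:
  assumes v: "valid_order md M" and nm: "n \<le> m" and \<eta>: "\<eta> > 0" and x: "x > 0"
  shows "ennreal (G_fun md M m n \<eta> x) = (\<integral>\<^sup>+\<theta>. ennreal (mod_weight md M \<theta>) *
      ennreal ((1 / (1 + mod_gain md M / (x / \<eta>) / (sin \<theta>)\<^sup>2)) ^ (m - n + 1)) \<partial>lborel)"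
    and "0 \<le> G_fun md M m n \<eta> x"
proof -
  define h where "h = (\<lambda>\<theta>. (1 / (1 + mod_gain md M / (x / \<eta>) / (sin \<theta>)\<^sup>2)) ^ (m - n + 1))"
  have M: "M \<ge> 2" using v by (rule valid_order_ge_2)
  have g: "mod_gain md M > 0" using v by (rule mod_gain_pos)
  have h01: "0 \<le> h \<theta>" "h \<theta> \<le> 1" for \<theta>
  proof -
    have "0 \<le> mod_gain md M / (x / \<eta>) / (sin \<theta>)\<^sup>2" using g x \<eta> by simp
    then have y: "0 \<le> 1 / (1 + mod_gain md M / (x / \<eta>) / (sin \<theta>)\<^sup>2)"
      "1 / (1 + mod_gain md M / (x / \<eta>) / (sin \<theta>)\<^sup>2) \<le> 1" by simp_all
    show "0 \<le> h \<theta>" unfolding h_def by (rule zero_le_power[OF y(1)])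
    show "h \<theta> \<le> 1" unfolding h_def by (rule power_le_one[OF y])
  qed
  have hm[measurable]: "h \<in> borel_measurable borel" unfolding h_def by measurable
  have kernel: "G_kernel m n (mod_gain md M * \<eta>) x = h"
  proof
    fix \<theta>
    have d: "int m - int n + 1 = int (m - n + 1)" using nm by simp
    have e: "mod_gain md M / (x / \<eta>) / (sin \<theta>)\<^sup>2 = mod_gain md M * \<eta> / (x * (sin \<theta>)\<^sup>2)" by simp
    show "G_kernel m n (mod_gain md M * \<eta>) x \<theta> = h \<theta>"
      unfolding G_kernel_def h_def d e power_int_minus power_int_of_nat by (simp only: inverse_eq_divide power_one_over)
  qed
  have seg: "(\<integral>\<^sup>+\<theta>. ennreal (w * indicator {a..b} \<theta>) * ennreal (h \<theta>) \<partial>lborel) = ennreal (w * integral {a..b} h)"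
    if w: "w \<ge> 0" for w a b
  proof -
    have "(\<integral>\<^sup>+\<theta>. ennreal (w * indicator {a..b} \<theta>) * ennreal (h \<theta>) \<partial>lborel) =
        (\<integral>\<^sup>+\<theta>. ennreal w * (ennreal (h \<theta>) * indicator {a..b} \<theta>) \<partial>lborel)"
      by (intro nn_integral_cong) (auto simp: indicator_def)
    also have "\<dots> = ennreal w * (\<integral>\<^sup>+\<theta>. ennreal (h \<theta>) * indicator {a..b} \<theta> \<partial>lborel)"
      by (rule nn_integral_cmult) measurable
    also have "(\<integral>\<^sup>+\<theta>. ennreal (h \<theta>) * indicator {a..b} \<theta> \<partial>lborel) = ennreal (integral {a..b} h)"
      using h01 by (intro nn_integral_bounded_interval(2)[where a = a and b = b and C = 1]) auto
    finally show ?thesis using w by (simp add: ennreal_mult')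
  qed
  have int0: "integral {a..b} h \<ge> 0" for a b
  proof (rule integral_nonneg)
    show "h integrable_on {a..b}"
      using h01 by (intro set_lebesgue_integral_eq_integral(1) nn_integral_bounded_interval(1)[where a = a and b = b and C = 1]) auto
  qed (rule h01)
  have "ennreal (G_fun md M m n \<eta> x) = (\<integral>\<^sup>+\<theta>. ennreal (mod_weight md M \<theta>) * ennreal (h \<theta>) \<partial>lborel) \<and> 0 \<le> G_fun md M m n \<eta> x"
  proof (cases md)
    case PAM
    have G: "G_fun md M m n \<eta> x = 2 * (real M - 1) / (real M * pi) * integral {0..pi/2} h"
      using kernel by (simp add: PAM)
    have w: "2 * (real M - 1) / (real M * pi) \<ge> 0" using M by simp
    show ?thesis unfolding G unfolding PAM mod_weight.simps seg[OF w]
      using w int0 by (simp only: mult_nonneg_nonneg simp_thms)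
  next
    case PSK
    have k: "G_kernel m n (\<eta> * (sin (pi / real M))\<^sup>2) x = h"
      using kernel by (simp add: PSK mult.commute)
    have G: "G_fun md M m n \<eta> x = 1 / pi * integral {0..(real M - 1) * pi / real M} h"
      unfolding PSK G_fun.simps k ..
    have w: "1 / pi \<ge> 0" by simp
    show ?thesis unfolding G unfolding PSK mod_weight.simps seg[OF w]
      using w int0 by (simp only: mult_nonneg_nonneg simp_thms)
  next
    case QAM
    let ?w1 = "4 * (sqrt (real M) - 1) / (sqrt (real M) * pi)" and ?w2 = "4 * (sqrt (real M) - 1) / (real M * pi)"
    have "mod_gain md M * \<eta> = 3 * \<eta> / (2 * (real M - 1))" by (simp add: QAM)
    then have k: "G_kernel m n (3 * \<eta> / (2 * (real M - 1))) x = h" using kernel by simp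
    have G: "G_fun md M m n \<eta> x = ?w1 * integral {pi/4..pi/2} h + ?w2 * integral {0..pi/4} h"
      unfolding QAM G_fun.simps k ..
    have w: "?w1 \<ge> 0" "?w2 \<ge> 0" using M by simp_all
    have "(\<integral>\<^sup>+\<theta>. ennreal (mod_weight md M \<theta>) * ennreal (h \<theta>) \<partial>lborel) =
      (\<integral>\<^sup>+\<theta>. ennreal (?w1 * indicator {pi/4..pi/2} \<theta>) * ennreal (h \<theta>) + ennreal (?w2 * indicator {0..pi/4} \<theta>) * ennreal (h \<theta>) \<partial>lborel)"
      using w by (intro nn_integral_cong) (simp add: QAM distrib_right[symmetric] ennreal_plus[symmetric] del: ennreal_plus times_divide_eq_left)
    also have "\<dots> = ennreal (?w1 * integral {pi/4..pi/2} h) + ennreal (?w2 * integral {0..pi/4} h)"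
      by (subst nn_integral_add) (simp_all only: seg[OF w(1)] seg[OF w(2)], measurable)
    also have "\<dots> = ennreal (G_fun md M m n \<eta> x)"
      unfolding G using w int0 by (intro ennreal_plus[symmetric] mult_nonneg_nonneg)
    finally show ?thesis
      unfolding G using w int0 by (simp only: mult_nonneg_nonneg add_nonneg_nonneg simp_thms)
  qed
  then show "ennreal (G_fun md M m n \<eta> x) = (\<integral>\<^sup>+\<theta>. ennreal (mod_weight md M \<theta>) *
      ennreal ((1 / (1 + mod_gain md M / (x / \<eta>) / (sin \<theta>)\<^sup>2)) ^ (m - n + 1)) \<partial>lborel)"
    and "0 \<le> G_fun md M m n \<eta> x" by (simp_all add: h_def)
qed

lemma full_rank_mult:
  fixes R :: "complex ^ 'n ^ 'n"
  assumes "full_rank_on UNIV Z" "invertible R"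
  shows "full_rank_on UNIV (Z ** R)"
  unfolding full_rank_UNIV
proof (intro allI impI)
  fix v assume "(Z ** R) *v v = 0"
  then have "R *v v = 0" using assms(1) by (simp add: full_rank_UNIV matrix_vector_mul_assoc[symmetric])
  then have "(matrix_inv R ** R) *v v = 0" by (simp add: matrix_vector_mul_assoc[symmetric])
  then show "v = 0" by (simp add: matrix_inv_cancel[OF assms(2)])
qed

text \<open>The Gram matrix of \<open>Z ** R\<close> is that of \<open>Z\<close> between the
  invertible factors \<open>R\<^sup>H\<close> and \<open>R\<close>, so the factors to the left of
  the Gram matrix cancel.\<close>

lemma zf_inverse_mult:
  fixes R :: "complex ^ 'n ^ 'n"
  assumes Z: "full_rank_on UNIV Z" and R: "invertible R"
  shows "zf_inverse (Z ** R) = matrix_inv R ** zf_inverse Z"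
proof -
  define G where "G = Z\<^sup>H ** Z"
  have G: "invertible G" unfolding G_def using Z by (rule invertible_gram)
  note iR = matrix_inv_cancel[OF R] and iG = matrix_inv_cancel[OF G]
  have iRH: "(matrix_inv R)\<^sup>H ** R\<^sup>H = mat 1"
    by (simp only: ctranspose_mult[symmetric] iR ctranspose_mat_1)
  have cancel: "(matrix_inv R)\<^sup>H ** (R\<^sup>H ** X) = X" "matrix_inv G ** (G ** Y) = Y"
    for X :: "complex ^ 'k ^ 'n" and Y :: "complex ^ 'k ^ 'n"
    by (simp_all only: matrix_mul_assoc iRH iG matrix_mul_lid)
  have gram: "(Z ** R)\<^sup>H ** (Z ** R) = R\<^sup>H ** (G ** R)"
    by (simp only: G_def ctranspose_mult matrix_mul_assoc)
  have "(matrix_inv R ** (matrix_inv G ** (matrix_inv R)\<^sup>H)) ** ((Z ** R)\<^sup>H ** (Z ** R)) =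
      matrix_inv R ** (matrix_inv G ** ((matrix_inv R)\<^sup>H ** (R\<^sup>H ** (G ** R))))"
    unfolding gram by (simp only: matrix_mul_assoc)
  also have "\<dots> = mat 1" by (simp only: cancel iR)
  finally have "matrix_inv ((Z ** R)\<^sup>H ** (Z ** R)) = matrix_inv R ** (matrix_inv G ** (matrix_inv R)\<^sup>H)"
    by (rule matrix_inv_eqI)
  then have "zf_inverse (Z ** R) = matrix_inv R ** (matrix_inv G ** ((matrix_inv R)\<^sup>H ** (R\<^sup>H ** Z\<^sup>H)))"
    by (simp only: zf_inverse_def ctranspose_mult matrix_mul_assoc)
  then show ?thesis by (simp only: cancel zf_inverse_def G_def)
qed

lemma matrix_inv_mult:
  fixes A B :: "'a::field ^ 'n ^ 'n"
  assumes "invertible A" "invertible B"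
  shows "matrix_inv (A ** B) = matrix_inv B ** matrix_inv A"
proof (rule matrix_inv_eqI)
  have "matrix_inv B ** matrix_inv A ** (A ** B) = matrix_inv B ** (matrix_inv A ** A) ** B"
    by (simp only: matrix_mul_assoc)
  then show "matrix_inv B ** matrix_inv A ** (A ** B) = mat 1"
    by (simp only: matrix_inv_cancel[OF assms(1)] matrix_inv_cancel[OF assms(2)] matrix_mul_rid)
qed

text \<open>The gain is a quadratic form in row k of the inverse precoder. The transpose reflects
  two conventions: \<Sigma> has the conjugate on the first factor of each moment, while the
  covariance in \<open>circ_gaussian_density\<close> has it on the second.\<close>

lemma noise_gain_row:
  fixes F \<Sigma> :: "complex ^ 'n ^ 'n"
  assumes "invertible \<Sigma>"
  shows "noise_gain \<Sigma> F k = Re (cinner (row k (matrix_inv F)) (matrix_inv (transpose \<Sigma>) *v row k (matrix_inv F)))"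
proof -
  let ?P = "matrix_inv \<Sigma>" and ?v = "row k (matrix_inv F)"
  have "transpose ?P ** transpose \<Sigma> = mat 1"
    by (simp only: matrix_transpose_mul[symmetric] matrix_inv_cancel[OF assms] transpose_mat)
  then have t: "matrix_inv (transpose \<Sigma>) = transpose ?P" by (rule matrix_inv_eqI)
  have "(matrix_inv F ** ?P ** (matrix_inv F)\<^sup>H) $ k $ k = (\<Sum>j\<in>UNIV. \<Sum>i\<in>UNIV. ?v $ i * ?P $ i $ j * cnj (?v $ j))"
    by (simp add: matrix_matrix_mult_def row_def sum_distrib_right)
  also have "\<dots> = cinner ?v (transpose ?P *v ?v)"
    by (simp add: cinner_def matrix_vector_mult_def transpose_def sum_distrib_left mult_ac)
  finally show ?thesis by (simp add: noise_gain_def t)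
qed

lemma posdef_transpose:
  assumes "hermitian_posdef \<Sigma>"
  shows "hermitian_posdef (transpose \<Sigma>)"
proof -
  have herm: "\<Sigma> $ i $ j = cnj (\<Sigma> $ j $ i)" for i j
    using assms by (auto simp: hermitian_posdef_def vec_eq_iff)
  have "Re (cinner x (transpose \<Sigma> *v x)) > 0" if "x \<noteq> 0" for x
  proof -
    define y where "y = (\<chi> i. cnj (x $ i))"
    have "y \<noteq> 0" using that by (auto simp: y_def vec_eq_iff)
    then have "Re (cinner y (\<Sigma> *v y)) > 0" using assms by (auto simp: hermitian_posdef_def)
    also have "cinner y (\<Sigma> *v y) = cnj (cinner x (transpose \<Sigma> *v x))"
      by (simp add: cinner_def matrix_vector_mult_def transpose_def y_def flip: herm)
    finally show ?thesis by simp
  qed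
  then show "hermitian_posdef (transpose \<Sigma>)"
    by (auto simp: hermitian_posdef_def vec_eq_iff transpose_def simp flip: herm)
qed

lemma row_mult_transpose: "row i (A ** transpose B) = B *v row i A"
  for A :: "'a::comm_semiring_1 ^ 'n ^ 'm"
  by (simp add: row_def matrix_matrix_mult_def matrix_vector_mult_def transpose_def vec_eq_iff mult.commute)

lemma invertible_transpose:
  fixes A :: "'a::field ^ 'n ^ 'n"
  assumes "invertible A"
  shows "invertible (transpose A)"
proof -
  have "transpose (matrix_inv A) ** transpose A = mat 1"
    by (simp only: matrix_transpose_mul[symmetric] matrix_inv_cancel[OF assms] transpose_mat)
  then show ?thesis using invertible_left_inverse by blast
qed

lemma noise_gain_pos:
  fixes F \<Sigma> :: "complex ^ 'n ^ 'n"
  assumes \<Sigma>: "hermitian_posdef \<Sigma>" and F: "invertible F"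
  shows "noise_gain \<Sigma> F k > 0"
proof -
  let ?v = "row k (matrix_inv F)"
  have pd: "hermitian_posdef (matrix_inv (transpose \<Sigma>))"
    by (intro posdef_inverse posdef_transpose \<Sigma>)
  have "?v \<noteq> 0"
  proof
    assume v0: "?v = 0"
    have "(matrix_inv F ** F) $ k $ k = (\<Sum>j\<in>UNIV. ?v $ j * F $ j $ k)"
      by (simp add: matrix_matrix_mult_def row_def)
    then show False using v0 by (simp add: matrix_inv_cancel[OF F] mat_def)
  qed
  then show ?thesis
    unfolding noise_gain_row[OF posdef_invertible[OF \<Sigma>]] using pd by (simp add: hermitian_posdef_def)
qed

text \<open>A basis that whitens the rows of the channel and has the \<open>k\<close>-th row of \<open>F\<^sup>-\<^sup>1\<close> as its
  \<open>k\<close>-th vector (up to length) decouples the \<open>k\<close>-th output from the precoder.\<close>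

lemma zf_output_component:
  fixes F B :: "complex ^ 'n ^ 'n" and Z :: "complex ^ 'n ^ 'm"
  assumes F: "invertible F" and B: "invertible B" and x: "x > 0"
    and col: "column k B = complex_of_real (1 / sqrt x) *s row k (matrix_inv F)"
    and Z: "full_rank_on UNIV Z" and H: "H \<omega> = Z ** transpose B"
  shows "zf_output H s \<xi> F \<omega> $ k = s \<omega> $ k + complex_of_real (sqrt x) * (zf_inverse Z *v \<xi> \<omega>) $ k"
proof -
  have Bt: "invertible (transpose B)" using B by (rule invertible_transpose)
  define R where "R = transpose B ** F"
  have R: "invertible R" unfolding R_def using Bt F by (rule invertible_mult)
  have HF: "H \<omega> ** F = Z ** R" by (simp add: H R_def matrix_mul_assoc)
  have fr: "full_rank_on UNIV (Z ** R)" using Z R by (rule full_rank_mult)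
  have "zf_output H s \<xi> F \<omega> = (zf_inverse (Z ** R) ** (Z ** R)) *v s \<omega> + zf_inverse (Z ** R) *v \<xi> \<omega>"
    by (simp only: zf_output_def received_def HF matrix_vector_right_distrib matrix_vector_mul_assoc)
  then have "zf_output H s \<xi> F \<omega> = s \<omega> + zf_inverse (Z ** R) *v \<xi> \<omega>"
    by (simp only: zf_inverse_left[OF fr] matrix_vector_mul_lid)
  then have out: "zf_output H s \<xi> F \<omega> = s \<omega> + matrix_inv R *v (zf_inverse Z *v \<xi> \<omega>)"
    by (simp only: zf_inverse_mult[OF Z R] matrix_vector_mul_assoc)
  have "(matrix_inv R *v y) $ k = complex_of_real (sqrt x) * y $ k" for y
  proof -
    define z where "z = matrix_inv (transpose B) *v y"
    have y: "transpose B *v z = y"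
      by (simp only: z_def matrix_vector_mul_assoc matrix_inv_cancel[OF Bt] matrix_vector_mul_lid)
    have "matrix_inv R *v y = matrix_inv F *v z"
      by (simp only: R_def matrix_inv_mult[OF Bt F] z_def matrix_vector_mul_assoc)
    then have "(matrix_inv R *v y) $ k = (\<Sum>j\<in>UNIV. row k (matrix_inv F) $ j * z $ j)"
      by (simp add: matrix_vector_mult_def row_def)
    \<comment> \<open>The choice of column k of \<open>B\<close> makes this row a multiple of row k
      of \<open>transpose B\<close>, which undoes the inverse hidden in \<open>z\<close>.\<close>
    also have "row k (matrix_inv F) = complex_of_real (sqrt x) *s column k B"
      using x by (simp add: col)
    also have "(\<Sum>j\<in>UNIV. (complex_of_real (sqrt x) *s column k B) $ j * z $ j) = complex_of_real (sqrt x) * (transpose B *v z) $ k"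
      by (simp add: matrix_vector_mult_def transpose_def column_def sum_distrib_left mult.assoc)
    finally show ?thesis by (simp only: y)
  qed
  then show ?thesis by (simp add: out)
qed

text \<open>The event is split by the transmitted symbol. For a fixed symbol \<open>c\<close> an
  error is an event in the whitened channel and the normalized noise, which are independent of each
  other and of the symbol; the uniform weights 1 / M cancel the factor M of the summed
  error.\<close>

lemma symbol_error_probability:
  fixes \<Omega> :: "'w measure"
    and H :: "'w \<Rightarrow> complex ^ 'n ^ 'm"
    and s :: "'w \<Rightarrow> complex ^ 'n"
    and \<xi> :: "'w \<Rightarrow> complex ^ 'm"
    and \<Sigma> F :: "complex ^ 'n ^ 'n"
  assumes ps: "prob_space \<Omega>"
    and nm: "CARD('n) \<le> CARD('m)"
    and indH: "prob_space.indep_vars \<Omega> (\<lambda>_. borel) (\<lambda>m \<omega>. row m (H \<omega>)) UNIV"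
    and gaussH: "\<And>m. circ_gaussian \<Omega> (\<lambda>\<omega>. row m (H \<omega>))"
    and covH: "\<And>m i k. (\<integral>\<omega>. cnj (row m (H \<omega>) $ i) * row m (H \<omega>) $ k \<partial>\<Omega>) = \<Sigma> $ i $ k"
    and \<Sigma>: "hermitian_posdef \<Sigma>"
    and \<sigma>: "\<sigma> > 0"
    and gauss\<xi>: "circ_gaussian \<Omega> \<xi>"
    and cov\<xi>: "\<And>i k. (\<integral>\<omega>. \<xi> \<omega> $ i * cnj (\<xi> \<omega> $ k) \<partial>\<Omega>) = complex_of_real (\<sigma>\<^sup>2) * mat 1 $ i $ k"
    and v: "valid_order md M"
    and unif: "\<And>k c. c \<in> constellation md M \<Longrightarrow> measure \<Omega> {\<omega> \<in> space \<Omega>. s \<omega> $ k = c} = 1 / real M"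
    and ind: "prob_space.indep_three \<Omega> H s \<xi>"
    and F: "invertible F"
  shows "measure \<Omega> {\<omega> \<in> space \<Omega>. decide (constellation md M) (zf_output H s \<xi> F \<omega> $ k) \<noteq> s \<omega> $ k} =
    G_fun md M CARD('m) CARD('n) (1 / \<sigma>\<^sup>2) (noise_gain \<Sigma> F k)"
proof -
  interpret prob_space \<Omega> by (rule ps)
  define S where "S = constellation md M"
  have fin: "finite S" unfolding S_def using v by (rule finite_constellation)
  have cardS: "card S = M" unfolding S_def using v by (rule card_constellation)
  have M: "M \<ge> 2" using v by (rule valid_order_ge_2)
  have Hm[measurable]: "H \<in> borel_measurable \<Omega>" and sm[measurable]: "s \<in> borel_measurable \<Omega>"
    and \<xi>m[measurable]: "\<xi> \<in> borel_measurable \<Omega>"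
    using ind by (simp_all add: indep_three_def)
  define x where "x = noise_gain \<Sigma> F k"
  have x: "x > 0" unfolding x_def using \<Sigma> F by (rule noise_gain_pos)
  let ?P = "matrix_inv (transpose \<Sigma>)" and ?v = "row k (matrix_inv F)"
  have pd: "hermitian_posdef ?P" by (intro posdef_inverse posdef_transpose \<Sigma>)
  have xv: "Re (cinner ?v (?P *v ?v)) = x"
    by (simp add: x_def noise_gain_row[OF posdef_invertible[OF \<Sigma>]])
  have "?v \<noteq> 0" using xv x by auto
  from posdef_scale_unit[OF pd this]
  have w: "cinner (complex_of_real (1 / sqrt x) *s ?v) (?P *v (complex_of_real (1 / sqrt x) *s ?v)) = 1"
    unfolding xv .
  obtain B where B: "B\<^sup>H ** ?P ** B = mat 1" "column k B = complex_of_real (1 / sqrt x) *s ?v"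
    by (rule posdef_orthonormal_basis[OF pd w, of k])
  have invB: "invertible B" by (rule invertible_left_inverse[THEN iffD2, OF exI, OF B(1)])
  define Z where "Z h = (\<chi> m. matrix_inv B *v row m h)" for h :: "complex ^ 'n ^ 'm"
  have HZ: "h = Z h ** transpose B" for h
  proof -
    have "row m (Z h ** transpose B) = row m h" for m
    proof -
      have "row m (Z h) = matrix_inv B *v row m h" by (simp add: Z_def row_def vec_eq_iff)
      then show ?thesis
        by (simp only: row_mult_transpose matrix_vector_mul_assoc matrix_inv_cancel[OF invB] matrix_vector_mul_lid)
    qed
    then show ?thesis by (simp add: row_def vec_eq_iff)
  qed
  have Bm[measurable]: "(\<lambda>z. matrix_inv B *v z) \<in> borel_measurable borel"
    by (rule linear_borel_measurable) (rule linear_matrix_vector_mult_complex)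
  have Zm[measurable]: "Z \<in> borel_measurable borel"
  proof (rule linear_borel_measurable)
    show "linear Z"
    proof (rule linearI)
      note lin = linear_matrix_vector_mult_complex[of "matrix_inv B"]
      show "Z (a + b) = Z a + Z b" for a b
      proof -
        have "row m (a + b) = row m a + row m b" for m by (simp add: row_def vec_eq_iff)
        then have "Z (a + b) = (\<chi> m. matrix_inv B *v row m a + matrix_inv B *v row m b)"
          by (simp only: Z_def linear_add[OF lin])
        then show ?thesis by (simp add: Z_def vec_eq_iff)
      qed
      show "Z (r *\<^sub>R b) = r *\<^sub>R Z b" for r b
      proof -
        have "row m (r *\<^sub>R b) = r *\<^sub>R row m b" for m by (simp add: row_def vec_eq_iff)
        then have "Z (r *\<^sub>R b) = (\<chi> m. r *\<^sub>R (matrix_inv B *v row m b))"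
          by (simp only: Z_def linear_scale[OF lin])
        then show ?thesis by (simp add: Z_def vec_eq_iff)
      qed
    qed
  qed
  have lawZ: "distr \<Omega> borel (\<lambda>\<omega>. Z (H \<omega>)) = std_gaussian"
  proof -
    have "indep_vars (\<lambda>_. borel) (\<lambda>m \<omega>. matrix_inv B *v row m (H \<omega>)) UNIV"
      by (rule indep_vars_compose2[OF indH]) measurable
    moreover have "distr \<Omega> borel (\<lambda>\<omega>. matrix_inv B *v row m (H \<omega>)) = std_gaussian" for m
    proof (rule circ_gaussian_standardize(2)[OF gaussH _ B(1)])
      show "(\<integral>\<omega>. row m (H \<omega>) $ i * cnj (row m (H \<omega>) $ k) \<partial>\<Omega>) = transpose \<Sigma> $ i $ k" for i k
        using covH[of m k i] by (simp add: transpose_def mult.commute)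
    qed
    ultimately have "distr \<Omega> borel (\<lambda>\<omega>. \<chi> m. matrix_inv B *v row m (H \<omega>)) = std_gaussian"
      by (rule distr_vec_std_gaussian)
    then show ?thesis by (simp only: Z_def)
  qed
  define e where "e z = complex_of_real (1 / \<sigma>) *s z" for z :: "complex ^ 'm"
  have em[measurable]: "e \<in> borel_measurable borel"
    unfolding e_def by (rule linear_borel_measurable, intro linearI)
      (auto simp: vec_eq_iff algebra_simps)
  have \<xi>e: "complex_of_real \<sigma> *s e z = z" for z using \<sigma> by (simp add: e_def)
  have lawe: "distr \<Omega> borel (\<lambda>\<omega>. e (\<xi> \<omega>)) = std_gaussian"
  proof -
    define D where "D c = (\<chi> i j. if i = j then complex_of_real c else 0 :: complex ^ 'm ^ 'm)" for c
    have Dv: "D c *v z = complex_of_real c *s z" for c z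
      by (simp add: D_def matrix_vector_mult_def vec_eq_iff if_distrib[of "\<lambda>x. x * _"] cong: if_cong)
    have Deq: "A = A'" if "\<And>z. A *v z = A' *v z" for A A' :: "complex ^ 'm ^ 'm"
      using that by (simp add: matrix_eq)
    have DD: "D a ** D b = D (a * b)" for a b
      by (rule Deq) (simp add: Dv matrix_vector_mul_assoc[symmetric])
    have D1: "D 1 = mat 1" by (rule Deq) (simp add: Dv)
    have DH: "(D a)\<^sup>H = D a" for a by (simp add: D_def vec_eq_iff)
    have "matrix_inv (D (\<sigma>\<^sup>2)) = D (1 / \<sigma>\<^sup>2)" "matrix_inv (D \<sigma>) = D (1 / \<sigma>)"
      using \<sigma> by (auto intro!: matrix_inv_eqI simp: DD D1)
    then have "(D \<sigma>)\<^sup>H ** matrix_inv (D (\<sigma>\<^sup>2)) ** D \<sigma> = mat 1"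
      using \<sigma> by (simp add: DH DD power2_eq_square flip: D1)
    then have "distr \<Omega> borel (\<lambda>\<omega>. matrix_inv (D \<sigma>) *v \<xi> \<omega>) = std_gaussian"
      using cov\<xi> by (intro circ_gaussian_standardize(2)[OF gauss\<xi>]) (auto simp: D_def mat_def)
    then show ?thesis by (simp only: \<open>matrix_inv (D \<sigma>) = D (1 / \<sigma>)\<close> Dv e_def)
  qed
  \<comment> \<open>The amplitude in front of the normalized noise; its square x / \<eta> is the
    argument expected by the weighted form of \<open>G_fun\<close>.\<close>
  define \<rho> where "\<rho> = sqrt x * \<sigma>"
  have \<rho>: "\<rho> > 0" "\<rho>\<^sup>2 = x / (1 / \<sigma>\<^sup>2)" using x \<sigma> by (simp_all add: \<rho>_def power_mult_distrib)
  define A where "A c = {p :: (complex ^ 'n ^ 'm) \<times> (complex ^ 'm).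
      decide S (c + complex_of_real \<rho> * (zf_inverse (fst p) *v snd p) $ k) \<noteq> c}" for c
  have Am: "A c \<in> sets (borel \<Otimes>\<^sub>M borel)" for c
  proof -
    let ?f = "\<lambda>p :: (complex ^ 'n ^ 'm) \<times> (complex ^ 'm). c + complex_of_real \<rho> * (zf_inverse (fst p) *v snd p) $ k"
    have "?f \<in> borel_measurable (borel \<Otimes>\<^sub>M borel)" by measurable
    from sets.compl_sets[OF measurable_sets[OF this decide_borel_measurable[OF fin, of c]]]
    have "- (?f -` {z. decide S z = c}) \<in> sets (borel \<Otimes>\<^sub>M borel)"
      by (simp add: space_pair_measure Compl_eq_Diff_UNIV)
    also have "- (?f -` {z. decide S z = c}) = A c" by (auto simp: A_def)
    finally show ?thesis .
  qed
  have sc: "{y :: complex ^ 'n. y $ k = c} \<in> sets borel" for c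
    by (intro borel_closed closed_Collect_eq continuous_intros)
  have each: "emeasure \<Omega> {\<omega> \<in> space \<Omega>. s \<omega> $ k = c \<and> (Z (H \<omega>), e (\<xi> \<omega>)) \<in> A c} =
      ennreal (1 / real M) * emeasure (std_gaussian \<Otimes>\<^sub>M std_gaussian) (A c)" if "c \<in> S" for c
    using indep_three_emeasure[OF ind sc[of c] Zm em Am[of c]] unif[of c k] that
    by (simp add: lawZ lawe emeasure_eq_measure S_def)
  \<comment> \<open>M disjoint events of probability 1 / M exhaust the mass.\<close>
  have AEs: "AE \<omega> in \<Omega>. s \<omega> $ k \<in> S"
  proof -
    have "prob (\<Union>c\<in>S. {\<omega> \<in> space \<Omega>. s \<omega> $ k = c}) = (\<Sum>c\<in>S. prob {\<omega> \<in> space \<Omega>. s \<omega> $ k = c})"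
      using fin by (intro finite_measure_finite_Union) (auto simp: disjoint_family_on_def)
    also have "\<dots> = 1" using unif cardS M by (simp add: S_def)
    finally have "AE \<omega> in \<Omega>. \<omega> \<in> (\<Union>c\<in>S. {\<omega> \<in> space \<Omega>. s \<omega> $ k = c})"
      by (subst (asm) prob_eq_1) (use fin in auto)
    then show ?thesis by eventually_elim auto
  qed
  have AEZ: "AE \<omega> in \<Omega>. full_rank_on UNIV (Z (H \<omega>))"
  proof -
    have "AE z in distr \<Omega> borel (\<lambda>\<omega>. Z (H \<omega>)). full_rank_on UNIV z"
      unfolding lawZ using nm by (rule AE_full_rank_on)
    then show ?thesis
      by (subst (asm) AE_distr_iff) (auto intro: borel_open open_full_rank_on)
  qed
  let ?E = "{\<omega> \<in> space \<Omega>. decide S (zf_output H s \<xi> F \<omega> $ k) \<noteq> s \<omega> $ k}"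
  let ?E' = "\<lambda>c. {\<omega> \<in> space \<Omega>. s \<omega> $ k = c \<and> (Z (H \<omega>), e (\<xi> \<omega>)) \<in> A c}"
  have E'm[measurable]: "?E' c \<in> sets \<Omega>" for c
  proof -
    have "(\<lambda>\<omega>. (Z (H \<omega>), e (\<xi> \<omega>))) \<in> measurable \<Omega> (borel \<Otimes>\<^sub>M borel)" by measurable
    from measurable_sets[OF this Am[of c]] have "{\<omega> \<in> space \<Omega>. (Z (H \<omega>), e (\<xi> \<omega>)) \<in> A c} \<in> sets \<Omega>"
      by (simp add: vimage_def Int_def conj_commute)
    moreover have "{\<omega> \<in> space \<Omega>. s \<omega> $ k = c} \<in> sets \<Omega>" by measurable
    moreover have "?E' c = {\<omega> \<in> space \<Omega>. s \<omega> $ k = c} \<inter> {\<omega> \<in> space \<Omega>. (Z (H \<omega>), e (\<xi> \<omega>)) \<in> A c}" by auto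
    ultimately show ?thesis by simp
  qed
  have Em: "?E \<in> sets \<Omega>"
  proof -
    let ?z = "\<lambda>\<omega>. zf_output H s \<xi> F \<omega> $ k"
    have zm[measurable]: "?z \<in> borel_measurable \<Omega>"
      unfolding zf_output_def received_def by measurable
    have "{\<omega> \<in> space \<Omega>. decide S (?z \<omega>) = c \<and> s \<omega> $ k = c} \<in> sets \<Omega>" for c
    proof -
      have "?z -` {z. decide S z = c} \<inter> space \<Omega> \<in> sets \<Omega>"
        by (rule measurable_sets[OF zm decide_borel_measurable[OF fin]])
      moreover have "{\<omega> \<in> space \<Omega>. s \<omega> $ k = c} \<in> sets \<Omega>" by measurable
      moreover have "{\<omega> \<in> space \<Omega>. decide S (?z \<omega>) = c \<and> s \<omega> $ k = c} =
          (?z -` {z. decide S z = c} \<inter> space \<Omega>) \<inter> {\<omega> \<in> space \<Omega>. s \<omega> $ k = c}" by auto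
      ultimately show ?thesis by (simp only: sets.Int)
    qed
    then have "space \<Omega> - (\<Union>c\<in>S. {\<omega> \<in> space \<Omega>. decide S (?z \<omega>) = c \<and> s \<omega> $ k = c}) \<in> sets \<Omega>"
      using fin by (intro sets.compl_sets sets.finite_UN) auto
    \<comment> \<open>\<open>decide\<close> always lands in \<open>S\<close>, so a correct decision
      forces the transmitted symbol into \<open>S\<close>, and the error event is the complement of
      a finite union.\<close>
    also have "space \<Omega> - (\<Union>c\<in>S. {\<omega> \<in> space \<Omega>. decide S (?z \<omega>) = c \<and> s \<omega> $ k = c}) = ?E"
    proof -
      have "S \<noteq> {}" using cardS M by auto
      then have "decide S z \<in> S" for z by (rule decide_mem(1)[OF fin])
      then have "s \<omega> $ k \<in> S" if "decide S (?z \<omega>) = s \<omega> $ k" for \<omega>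
        using that by metis
      then show ?thesis by auto
    qed
    finally show ?thesis .
  qed
  have "emeasure \<Omega> ?E = emeasure \<Omega> (\<Union>c\<in>S. ?E' c)"
  proof (rule emeasure_eq_AE)
    show "AE \<omega> in \<Omega>. (\<omega> \<in> ?E) = (\<omega> \<in> (\<Union>c\<in>S. ?E' c))"
      using AEs AEZ AE_space
    proof eventually_elim
      fix \<omega> assume \<omega>: "s \<omega> $ k \<in> S" "full_rank_on UNIV (Z (H \<omega>))" "\<omega> \<in> space \<Omega>"
      have "zf_output H s \<xi> F \<omega> $ k = s \<omega> $ k + complex_of_real (sqrt x) * (zf_inverse (Z (H \<omega>)) *v \<xi> \<omega>) $ k"
        by (rule zf_output_component[where H = H and s = s and \<xi> = \<xi> and \<omega> = \<omega>, OF F invB x B(2) \<omega>(2) HZ])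
      also have "zf_inverse (Z (H \<omega>)) *v \<xi> \<omega> = complex_of_real \<sigma> *s (zf_inverse (Z (H \<omega>)) *v e (\<xi> \<omega>))"
        by (subst \<xi>e[symmetric]) (simp add: vector_scalar_commute)
      finally have "zf_output H s \<xi> F \<omega> $ k = s \<omega> $ k + complex_of_real \<rho> * (zf_inverse (Z (H \<omega>)) *v e (\<xi> \<omega>)) $ k"
        by (simp add: \<rho>_def mult.assoc)
      then show "(\<omega> \<in> ?E) = (\<omega> \<in> (\<Union>c\<in>S. ?E' c))"
        using \<omega> by (auto simp: A_def)
    qed
    show "(\<Union>c\<in>S. ?E' c) \<in> sets \<Omega>" using fin E'm by (intro sets.finite_UN) auto
  qed (rule Em)
  also have "\<dots> = (\<Sum>c\<in>S. emeasure \<Omega> (?E' c))"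
    using fin E'm by (intro sum_emeasure[symmetric]) (auto simp: disjoint_family_on_def)
  also have "\<dots> = (\<Sum>c\<in>S. ennreal (1 / real M) * emeasure (std_gaussian \<Otimes>\<^sub>M std_gaussian) (A c))"
    by (rule sum.cong[OF refl each])
  also have "\<dots> = ennreal (1 / real M) * (\<Sum>c\<in>S. emeasure (std_gaussian \<Otimes>\<^sub>M std_gaussian) (A c))"
    by (rule sum_distrib_left[symmetric])
  also have "(\<Sum>c\<in>S. emeasure (std_gaussian \<Otimes>\<^sub>M std_gaussian) (A c)) =
      ennreal (real M) * ennreal (G_fun md M CARD('m) CARD('n) (1 / \<sigma>\<^sup>2) x)"
    unfolding A_def S_def expected_decide_error[OF v \<rho>(1) nm] \<rho>(2)
    using \<sigma> by (simp only: G_fun_eq_weighted_integral(1)[OF v nm _ x] zero_less_divide_1_iff zero_less_power)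
  also have "ennreal (1 / real M) * (ennreal (real M) * ennreal (G_fun md M CARD('m) CARD('n) (1 / \<sigma>\<^sup>2) x)) =
      ennreal (G_fun md M CARD('m) CARD('n) (1 / \<sigma>\<^sup>2) x)"
    using M by (simp add: mult.assoc[symmetric] ennreal_mult'[symmetric])
  finally show ?thesis
    using G_fun_eq_weighted_integral(2)[OF v nm _ x, of "1 / \<sigma>\<^sup>2"] \<sigma>
    by (simp add: emeasure_eq_measure S_def x_def)
qed

section \<open>The smallest eigenvalue and the Rayleigh quotient\<close>

lemma hermitian_inner:
  assumes "A\<^sup>H = A"
  shows "(A *v x) \<bullet> y = x \<bullet> (A *v y)"
  by (simp add: Re_cinner[symmetric] cinner_ctranspose assms)

text \<open>Eigenvectors for distinct eigenvalues are orthogonal, hence linearly independent.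
  Finiteness is what gives \<open>Min\<close> in \<open>min_eigenvalue\<close> its meaning.\<close>

lemma finite_real_eigenvalues:
  fixes A :: "complex ^ 'n ^ 'n"
  assumes A: "A\<^sup>H = A"
  shows "finite {x. eigenvalue A (complex_of_real x)}"
proof -
  let ?E = "{x. eigenvalue A (complex_of_real x)}"
  define f where "f x = (SOME v. v \<noteq> 0 \<and> A *v v = complex_of_real x *s v)" for x
  have f: "f x \<noteq> 0" "A *v f x = x *\<^sub>R f x" if "x \<in> ?E" for x
  proof -
    have "\<exists>v. v \<noteq> 0 \<and> A *v v = complex_of_real x *s v" using that by (simp add: eigenvalue_def)
    from someI_ex[OF this] show "f x \<noteq> 0" "A *v f x = x *\<^sub>R f x"
      by (simp_all add: f_def scaleR_eq_scale)
  qed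
  have orth: "f x \<bullet> f y = 0" if "x \<in> ?E" "y \<in> ?E" "x \<noteq> y" for x y
  proof -
    have "x * (f x \<bullet> f y) = y * (f x \<bullet> f y)"
      using hermitian_inner[OF A, of "f x" "f y"] f(2)[OF that(1)] f(2)[OF that(2)] by simp
    then show ?thesis using that(3) by simp
  qed
  have inj: "inj_on f ?E"
  proof (rule inj_onI, rule ccontr)
    fix x y assume "x \<in> ?E" "y \<in> ?E" "f x = f y" "x \<noteq> y"
    then show False using orth[of x y] f(1)[of x] by simp
  qed
  have "pairwise orthogonal (f ` ?E)"
    using orth by (auto simp: pairwise_def orthogonal_def)
  moreover have "0 \<notin> f ` ?E" using f(1) by auto
  ultimately have "independent (f ` ?E)" by (rule pairwise_orthogonal_independent)
  then have "finite (f ` ?E)" by (rule independent_imp_finite)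
  then show ?thesis using inj by (rule finite_imageD)
qed

text \<open>The quotient attains its minimum \<mu> on the unit sphere, and the minimizer is an
  eigenvector: moving it along its own residual w = A v - \<mu> v would otherwise lower the
  quotient. So \<mu> is among the eigenvalues over which \<open>Min\<close> is taken.\<close>

lemma min_eigenvalue_le_Rayleigh:
  fixes A :: "complex ^ 'n ^ 'n"
  assumes A: "A\<^sup>H = A"
  shows "min_eigenvalue A * (norm x)\<^sup>2 \<le> x \<bullet> (A *v x)"
proof -
  note lin = linear_matrix_vector_mult_complex[of A]
  let ?q = "\<lambda>x. x \<bullet> (A *v x)"
  have "continuous_on (sphere 0 1) ?q"
    using lin by (intro continuous_intros linear_continuous_on) (simp add: linear_conv_bounded_linear)
  moreover have "sphere (0 :: complex ^ 'n) 1 \<noteq> {}" by simp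
  ultimately obtain v where v: "v \<in> sphere 0 1" "\<And>y. y \<in> sphere 0 1 \<Longrightarrow> ?q v \<le> ?q y"
    using continuous_attains_inf[OF compact_sphere, of "0 :: complex ^ 'n" 1 ?q] by blast
  define \<mu> where "\<mu> = ?q v"
  have nv: "norm v = 1" using v(1) by simp
  have ray: "\<mu> * (norm y)\<^sup>2 \<le> ?q y" for y
  proof (cases "y = 0")
    case False
    then have "\<mu> \<le> ?q (y /\<^sub>R norm y)" unfolding \<mu>_def by (intro v(2)) simp
    also have "?q (y /\<^sub>R norm y) = ?q y / (norm y)\<^sup>2"
      by (simp add: linear_scale[OF lin] power2_eq_square divide_inverse)
    finally show ?thesis using False by (simp add: field_simps)
  qed (simp add: linear_0[OF lin])
  define w where "w = A *v v - \<mu> *\<^sub>R v"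
  define c where "c = ?q w - \<mu> * (norm w)\<^sup>2"
  have c: "c \<ge> 0" using ray[of w] by (simp add: c_def)
  \<comment> \<open>The nonnegative form x . A x - \<mu> |x|^2 at v + t w, where it vanishes for t =
    0. Its linear term in t is twice |w|^2.\<close>
  have quad: "0 \<le> 2 * t * (norm w)\<^sup>2 + t\<^sup>2 * c" for t
  proof -
    have "?q (v + t *\<^sub>R w) - \<mu> * (norm (v + t *\<^sub>R w))\<^sup>2 =
        (?q v - \<mu> * (v \<bullet> v)) + 2 * t * (w \<bullet> w) + t\<^sup>2 * c"
    proof -
      have "v \<bullet> (A *v w) = (A *v v) \<bullet> w" by (rule hermitian_inner[OF A, symmetric])
      moreover have "(A *v v) \<bullet> w = w \<bullet> w + \<mu> * (v \<bullet> w)"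
        by (subst (2) w_def) (simp add: inner_diff_left)
      ultimately show ?thesis
        unfolding c_def power2_norm_eq_inner
        by (simp add: linear_add[OF lin] linear_scale[OF lin] inner_add_left
            inner_add_right inner_commute[of w v] inner_commute[of w "A *v v"] power2_eq_square algebra_simps)
    qed
    also have "?q v - \<mu> * (v \<bullet> v) = 0" using nv by (simp add: \<mu>_def norm_eq_1)
    finally show ?thesis using ray[of "v + t *\<^sub>R w"] by (simp add: power2_norm_eq_inner)
  qed
  have "w = 0"
  proof (rule ccontr)
    assume "w \<noteq> 0"
    then have a: "(norm w)\<^sup>2 > 0" by simp
    let ?a = "(norm w)\<^sup>2"
    \<comment> \<open>A small negative step; c + 1 replaces c in the denominator because c may be
      0.\<close>
    have "0 \<le> 2 * (- ?a / (c + 1)) * ?a + (- ?a / (c + 1))\<^sup>2 * c" by (rule quad)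
    also have "\<dots> = (?a)\<^sup>2 / (c + 1) * (c / (c + 1) - 2)"
    proof -
      have "2 * (- a / k) * a + (- a / k)\<^sup>2 * c = a\<^sup>2 / k * (c / k - 2)" for a k
        by (simp add: power2_eq_square right_diff_distrib)
      then show ?thesis .
    qed
    also have "\<dots> < 0"
    proof (rule mult_pos_neg)
      show "0 < (?a)\<^sup>2 / (c + 1)" using a c by simp
      have "c / (c + 1) < 1" using c by simp
      then show "c / (c + 1) - 2 < 0" by simp
    qed
    finally show False by simp
  qed
  then have "eigenvalue A (complex_of_real \<mu>)"
    using nv by (auto simp: eigenvalue_def w_def scaleR_eq_scale intro!: exI[of _ v])
  then have "min_eigenvalue A \<le> \<mu>"
    unfolding min_eigenvalue_def using finite_real_eigenvalues[OF A] by (intro Min_le) auto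
  then have "min_eigenvalue A * (norm x)\<^sup>2 \<le> \<mu> * (norm x)\<^sup>2" by (intro mult_right_mono) auto
  then show ?thesis using ray[of x] by simp
qed

subsection \<open>Convexity of the error integrand\<close>

text \<open>The second derivative is a nonnegative multiple of (e + 1) t - 2 x, so the right end of
  the interval is the inflection point. In the application the exponent e + 2 is N_r - N_t +
  1.\<close>

lemma integrand_convex:
  fixes t :: real
  assumes t: "t > 0"
  shows "convex_on {0<..t * real (Suc e) / 2} (\<lambda>x. (x / (x + t)) ^ Suc (Suc e))"
proof (rule f''_ge0_imp_convex)
  let ?u = "\<lambda>x. x / (x + t)"
  let ?f' = "\<lambda>x. real (Suc (Suc e)) * ?u x ^ Suc e * (t / (x + t)\<^sup>2)"
  let ?f'' = "\<lambda>x. real (Suc (Suc e)) * t * ?u x ^ e / (x + t) ^ 4 * (real (Suc e) * t - 2 * x)"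
  fix x assume x: "x \<in> {0<..t * real (Suc e) / 2}"
  then have xt: "x + t > 0" "x + t \<noteq> 0" "x > 0" using t by auto
  have u: "(?u has_real_derivative t / (x + t)\<^sup>2) (at x)"
    using xt by (auto intro!: derivative_eq_intros simp: power2_eq_square field_simps)
  have "((\<lambda>x. ?u x ^ Suc (Suc e)) has_real_derivative of_nat (Suc (Suc e)) * (t / (x + t)\<^sup>2 * ?u x ^ (Suc (Suc e) - Suc 0))) (at x)"
    by (rule DERIV_power[OF u])
  then show "((\<lambda>x. ?u x ^ Suc (Suc e)) has_real_derivative ?f' x) (at x)"
    by (simp add: mult_ac)
  have 1: "((\<lambda>x. ?u x ^ Suc e) has_real_derivative real (Suc e) * (t / (x + t)\<^sup>2 * ?u x ^ e)) (at x)"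
    using DERIV_power[OF u, of "Suc e"] by simp
  have 2: "((\<lambda>x. t / (x + t)\<^sup>2) has_real_derivative - 2 * t / (x + t) ^ 3) (at x)"
  proof -
    have "((\<lambda>x. t / (x + t)\<^sup>2) has_real_derivative
        (0 * (x + t)\<^sup>2 - t * (2 * (x + t))) / ((x + t)\<^sup>2 * (x + t)\<^sup>2)) (at x)"
      using xt by (intro DERIV_divide) (auto intro!: derivative_eq_intros)
    also have "(0 * (x + t)\<^sup>2 - t * (2 * (x + t))) / ((x + t)\<^sup>2 * (x + t)\<^sup>2) = - 2 * t / (x + t) ^ 3"
    proof -
      have "(0 * y\<^sup>2 - t * (2 * y)) / (y\<^sup>2 * y\<^sup>2) = - 2 * t / y ^ 3" if "y \<noteq> 0" for y
        using that by (simp add: field_simps power2_eq_square power3_eq_cube)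
      then show ?thesis using xt(2) .
    qed
    finally show ?thesis .
  qed
  have "(?f' has_real_derivative real (Suc (Suc e)) * (real (Suc e) * (t / (x + t)\<^sup>2 * ?u x ^ e)) * (t / (x + t)\<^sup>2)
      + - 2 * t / (x + t) ^ 3 * (real (Suc (Suc e)) * ?u x ^ Suc e)) (at x)"
    by (rule DERIV_mult[OF DERIV_cmult[OF 1] 2])
  also have "real (Suc (Suc e)) * (real (Suc e) * (t / (x + t)\<^sup>2 * ?u x ^ e)) * (t / (x + t)\<^sup>2)
      + - 2 * t / (x + t) ^ 3 * (real (Suc (Suc e)) * ?u x ^ Suc e) = ?f'' x"
  proof -
    define d where "d = real (Suc (Suc e))"
    define d1 where "d1 = real (Suc e)"
    define p where "p = ?u x ^ e"
    define y where "y = x + t"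
    have y: "y \<noteq> 0" using xt by (simp add: y_def)
    have "d * (d1 * (t / y\<^sup>2 * p)) * (t / y\<^sup>2) + - 2 * t / y ^ 3 * (d * (x / y * p)) =
        d * t * p / y ^ 4 * (d1 * t - 2 * x)"
      using y by (simp add: field_simps power2_eq_square power3_eq_cube power4_eq_xxxx)
    then show ?thesis by (simp add: d_def d1_def p_def y_def)
  qed
  finally show "(?f' has_real_derivative ?f'' x) (at x)" .
  have "2 * x \<le> real (Suc e) * t" using x by (simp add: mult.commute)
  then show "0 \<le> ?f'' x"
    using xt t by (intro mult_nonneg_nonneg divide_nonneg_nonneg zero_le_power) auto
next
  show "convex {0<..t * real (Suc e) / 2}" by (rule convex_real_interval)
qed

text \<open>Since \<open>y\<close> is only bounded by the mean, monotonicity is combined with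
  Jensen. The case t = 0 accounts for the angles with sin \<theta> = 0, where division by zero makes
  both sides 1.\<close>

lemma integrand_Jensen:
  fixes x :: "'n::finite \<Rightarrow> real"
  assumes t: "t \<ge> 0" and x: "\<And>k. 0 < x k" and xT: "\<And>k. 2 * x k \<le> t * real (d - 1) \<or> t = 0" and d: "d \<ge> 2"
    and y: "0 < y" "real CARD('n) * y \<le> (\<Sum>k\<in>UNIV. x k)"
  shows "(1 / (1 + t / y)) ^ d \<le> (\<Sum>k\<in>UNIV. 1 / real CARD('n) * (1 / (1 + t / x k)) ^ d)"
proof (cases "t = 0")
  case False
  then have t: "t > 0" using t by simp
  obtain e where e: "d = Suc (Suc e)" using d by (metis add_2_eq_Suc le_Suc_ex)
  let ?f = "\<lambda>x. (x / (x + t)) ^ d"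
  have n: "real CARD('n) > 0" by simp
  have eq: "1 / (1 + t / x) = x / (x + t)" if "x > 0" for x using that t by (simp add: field_simps)
  let ?C = "{0<..t * real (Suc e) / 2}"
  have xC: "x k \<in> ?C" for k using x[of k] xT[of k] False by (auto simp: e)
  let ?m = "\<Sum>k\<in>UNIV. (1 / real CARD('n)) *\<^sub>R x k"
  have ym: "y \<le> ?m"
    using y n by (simp add: sum_divide_distrib[symmetric] field_simps)
  have "y / (y + t) \<le> b / (b + t)" if "y \<le> b" for b
  proof -
    have "t / (b + t) \<le> t / (y + t)" using that y t by (intro divide_left_mono) auto
    moreover have "y / (y + t) = 1 - t / (y + t)" "b / (b + t) = 1 - t / (b + t)"
      using that y t by (simp_all add: field_simps)
    ultimately show ?thesis by simp
  qed
  from this[OF ym] have "y / (y + t) \<le> ?m / (?m + t)" .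
  then have "?f y \<le> ?f ?m" using y t by (intro power_mono) auto
  also have "?f ?m \<le> (\<Sum>k\<in>UNIV. 1 / real CARD('n) * ?f (x k))"
    unfolding e
    using convex_on_sum[OF _ _ integrand_convex[OF t, of e], of UNIV "\<lambda>_. 1 / real CARD('n)" x] xC by simp
  finally show ?thesis unfolding eq[OF y(1)] eq[OF x] .
next
  case True
  then show ?thesis by simp
qed

text \<open>The inequality already holds for each angle \<theta>, so it survives integration against
  the nonnegative weight.\<close>

lemma G_fun_average_mono:
  fixes x :: "'n::finite \<Rightarrow> real"
  assumes v: "valid_order md M" and nm: "n < m" and \<eta>: "\<eta> > 0"
    and x: "\<And>k. 0 < x k" and xT: "\<And>k. x k \<le> T_threshold md M m n \<eta>"
    and y: "0 < y" "real CARD('n) * y \<le> (\<Sum>k\<in>UNIV. x k)"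
  shows "G_fun md M m n \<eta> y \<le> 1 / real CARD('n) * (\<Sum>k\<in>UNIV. G_fun md M m n \<eta> (x k))"
proof -
  have nm': "n \<le> m" using nm by simp
  note G = G_fun_eq_weighted_integral[OF v nm' \<eta>]
  have T: "T_threshold md M m n \<eta> = mod_gain md M * \<eta> * real (m - n) / 2"
    using nm by (cases md) (simp_all add: of_nat_diff field_simps)
  have g: "mod_gain md M > 0" using v by (rule mod_gain_pos)
  define h where "h z \<theta> = (1 / (1 + mod_gain md M / (z / \<eta>) / (sin \<theta>)\<^sup>2)) ^ (m - n + 1)" for z \<theta> :: real
  have hm[measurable]: "h z \<in> borel_measurable borel" for z unfolding h_def by measurable
  have h0: "h z \<theta> \<ge> 0" if "z > 0" for z \<theta>
  proof -
    have "0 \<le> mod_gain md M / (z / \<eta>) / (sin \<theta>)\<^sup>2" using g that \<eta> by simp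
    then show ?thesis unfolding h_def by (intro zero_le_power divide_nonneg_nonneg) auto
  qed
  have n0: "0 \<le> 1 / real CARD('n)" by simp
  have w0: "mod_weight md M \<theta> \<ge> 0" for \<theta> using v by (rule mod_weight_nonneg)
  have pt: "h y \<theta> \<le> (\<Sum>k\<in>UNIV. 1 / real CARD('n) * h (x k) \<theta>)" for \<theta>
  proof -
    define t where "t = mod_gain md M * \<eta> / (sin \<theta>)\<^sup>2"
    have ht: "h z \<theta> = (1 / (1 + t / z)) ^ (m - n + 1)" for z
      by (simp add: h_def t_def mult.commute)
    have "2 * x k \<le> t * real (m - n + 1 - 1) \<or> t = 0" for k
    proof (cases "sin \<theta> = 0")
      case False
      \<comment> \<open>The inflection point t (m - n) / 2 is smallest at sin^2 \<theta> = 1, where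
        it equals the threshold, so every \<open>x k\<close> lies in the convex range for every
        angle.\<close>
      have "(sin \<theta>)\<^sup>2 \<le> 1" by (simp add: abs_square_le_1)
      then have "mod_gain md M * \<eta> \<le> t"
        using False g \<eta> unfolding t_def by (simp add: le_divide_eq mult_left_le)
      then have "mod_gain md M * \<eta> * real (m - n) \<le> t * real (m - n)"
        by (intro mult_right_mono) auto
      then show ?thesis using xT[of k] unfolding T by simp
    qed (simp add: t_def)
    then show ?thesis
      unfolding ht using nm x y g \<eta> by (intro integrand_Jensen) (auto simp: t_def)
  qed
  have "ennreal (G_fun md M m n \<eta> y) = (\<integral>\<^sup>+\<theta>. ennreal (mod_weight md M \<theta>) * ennreal (h y \<theta>) \<partial>lborel)"
    using G(1)[OF y(1)] by (simp add: h_def)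
  also have "\<dots> \<le> (\<integral>\<^sup>+\<theta>. (\<Sum>k\<in>(UNIV :: 'n set). ennreal (1 / real CARD('n)) * (ennreal (mod_weight md M \<theta>) * ennreal (h (x k) \<theta>))) \<partial>lborel)"
  proof (rule nn_integral_mono)
    fix \<theta>
    have "mod_weight md M \<theta> * h y \<theta> \<le> mod_weight md M \<theta> * (\<Sum>k\<in>UNIV. 1 / real CARD('n) * h (x k) \<theta>)"
      using pt w0 by (rule mult_left_mono)
    also have "\<dots> = (\<Sum>k\<in>UNIV. 1 / real CARD('n) * (mod_weight md M \<theta> * h (x k) \<theta>))"
      by (simp add: sum_distrib_left mult_ac)
    finally have "ennreal (mod_weight md M \<theta> * h y \<theta>) \<le> ennreal (\<Sum>k\<in>UNIV. 1 / real CARD('n) * (mod_weight md M \<theta> * h (x k) \<theta>))"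
      by (rule ennreal_leI)
    also have "\<dots> = (\<Sum>k\<in>UNIV. ennreal (1 / real CARD('n) * (mod_weight md M \<theta> * h (x k) \<theta>)))"
      using w0 h0 x by (intro sum_ennreal[symmetric]) auto
    finally show "ennreal (mod_weight md M \<theta>) * ennreal (h y \<theta>) \<le>
        (\<Sum>k\<in>(UNIV :: 'n set). ennreal (1 / real CARD('n)) * (ennreal (mod_weight md M \<theta>) * ennreal (h (x k) \<theta>)))"
      by (simp only: ennreal_mult'[OF w0] ennreal_mult'[of "1 / real CARD('n)"] n0)
  qed
  also have "\<dots> = (\<Sum>k\<in>(UNIV :: 'n set). ennreal (1 / real CARD('n)) * (\<integral>\<^sup>+\<theta>. ennreal (mod_weight md M \<theta>) * ennreal (h (x k) \<theta>) \<partial>lborel))"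
    by (subst nn_integral_sum) (auto simp: nn_integral_cmult)
  also have "\<dots> = (\<Sum>k\<in>(UNIV :: 'n set). ennreal (1 / real CARD('n) * G_fun md M m n \<eta> (x k)))"
    by (intro sum.cong refl) (simp only: G(1)[OF x] h_def ennreal_mult'[of "1 / real CARD('n)"] n0)
  also have "\<dots> = ennreal (\<Sum>k\<in>(UNIV :: 'n set). 1 / real CARD('n) * G_fun md M m n \<eta> (x k))"
    using G(2)[OF x] by (intro sum_ennreal) auto
  finally have "G_fun md M m n \<eta> y \<le> (\<Sum>k\<in>(UNIV :: 'n set). 1 / real CARD('n) * G_fun md M m n \<eta> (x k))"
    using G(2)[OF x] by (subst (asm) ennreal_le_iff) (auto intro!: sum_nonneg)
  then show ?thesis by (simp only: sum_distrib_left)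
qed

section \<open>Diagonal matrices, norms and traces\<close>

lemma diag_mult_vec: "(diag d *v x) $ i = d i * x $ i"
  for d :: "'n::finite \<Rightarrow> 'a::comm_semiring_1"
  by (simp add: diag_def matrix_vector_mult_def if_distrib[of "\<lambda>c. c * _"] cong: if_cong)

lemma diag_mult_diag: "diag a ** diag b = diag (\<lambda>i. a i * b i)"
  for a b :: "'n::finite \<Rightarrow> 'a::comm_semiring_1"
  by (simp add: matrix_eq matrix_vector_mul_assoc[symmetric] vec_eq_iff diag_mult_vec mult.assoc)

lemma diag_1: "diag (\<lambda>_. 1 :: 'a::comm_semiring_1) = mat 1"
  by (simp add: diag_def mat_def)

lemma ctranspose_diag: "(diag (\<lambda>i. complex_of_real (a i)))\<^sup>H = diag (\<lambda>i. complex_of_real (a i))"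
  by (simp add: diag_def vec_eq_iff)

lemma matrix_mult_scaleR: "(a *\<^sub>R A) ** B = a *\<^sub>R (A ** B)" "A ** (a *\<^sub>R B) = a *\<^sub>R (A ** B)"
  for A :: "complex ^ 'n ^ 'm" and B :: "complex ^ 'k ^ 'n"
  by (simp_all add: matrix_matrix_mult_def vec_eq_iff scaleR_sum_right)

lemma ctranspose_scaleR: "(a *\<^sub>R A)\<^sup>H = a *\<^sub>R A\<^sup>H"
  by (simp add: vec_eq_iff)

lemma norm_sq_trace: "(norm A)\<^sup>2 = Re (trace (A\<^sup>H ** A))"
  for A :: "complex ^ 'n ^ 'm"
proof -
  have "Re (trace (A\<^sup>H ** A)) = (\<Sum>j\<in>UNIV. \<Sum>i\<in>UNIV. Re (cnj (A $ i $ j) * A $ i $ j))"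
    by (simp add: trace_def matrix_matrix_mult_def)
  also have "\<dots> = (\<Sum>i\<in>UNIV. \<Sum>j\<in>UNIV. Re (cnj (A $ i $ j) * A $ i $ j))"
    by (rule sum.swap)
  also have "\<dots> = A \<bullet> A"
    by (simp add: inner_vec_def inner_complex_def)
  finally show ?thesis by (simp add: power2_norm_eq_inner)
qed

text \<open>Reading a trace as the real inner product of the underlying Euclidean space makes its
  Cauchy--Schwarz inequality applicable.\<close>

lemma Re_trace_mult: "Re (trace (A ** B)) = A \<bullet> B\<^sup>H"
  for A :: "complex ^ 'n ^ 'm" and B :: "complex ^ 'm ^ 'n"
  by (simp add: trace_def matrix_matrix_mult_def inner_vec_def inner_complex_def)

lemma trace_mult_commute: "trace (A ** B) = trace (B ** A)"
  for A :: "'a::comm_semiring_1 ^ 'n ^ 'm" and B :: "'a ^ 'm ^ 'n"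
proof -
  have "trace (A ** B) = (\<Sum>i\<in>UNIV. \<Sum>j\<in>UNIV. A $ i $ j * B $ j $ i)"
    by (simp add: trace_def matrix_matrix_mult_def)
  also have "\<dots> = (\<Sum>j\<in>UNIV. \<Sum>i\<in>UNIV. A $ i $ j * B $ j $ i)" by (rule sum.swap)
  also have "\<dots> = trace (B ** A)"
    by (simp add: trace_def matrix_matrix_mult_def mult.commute)
  finally show ?thesis .
qed

subsection \<open>The discrete Fourier transform matrix\<close>

lemma card_lessThan_bij: "bij_betw (\<lambda>i. card {..<i}) (UNIV :: 'n::{finite,linorder} set) {..<CARD('n)}"
proof -
  have mono: "card {..<i} < card {..<j}" if "i < j" for i j :: 'n
    using that by (intro psubset_card_mono) auto
  then have inj: "inj (\<lambda>i :: 'n. card {..<i})"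
    by (intro linorder_injI) (metis less_irrefl)
  have "card {..<i} < CARD('n)" for i :: 'n
    by (intro psubset_card_mono) auto
  then have "range (\<lambda>i :: 'n. card {..<i}) \<subseteq> {..<CARD('n)}" by auto
  moreover have "card (range (\<lambda>i :: 'n. card {..<i})) = CARD('n)" using inj by (rule card_image)
  ultimately have "range (\<lambda>i :: 'n. card {..<i}) = {..<CARD('n)}" by (intro card_subset_eq) auto
  then show ?thesis using inj by (simp add: bij_betw_def)
qed

lemma dft_matrix_nth:
  "(dft_matrix :: complex ^ ('n::{finite,linorder}) ^ ('n::{finite,linorder})) $ m $ k =
    complex_of_real (1 / sqrt (real CARD('n))) * cnj (cis (2 * pi * real (card {..<k}) / real CARD('n))) ^ card {..<m}"
proof -
  have cnj_cis: "cnj (cis x) = cis (- x)" for x by (simp add: complex_eq_iff)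
  have "exp (- 2 * complex_of_real pi * \<i> * of_nat (card {..<m}) * of_nat (card {..<k}) / of_nat CARD('n)) =
    cnj (cis (2 * pi * real (card {..<k}) / real CARD('n))) ^ card {..<m}"
    unfolding cnj_cis unfolding cis_conv_exp exp_of_nat_mult[symmetric] by (simp add: mult_ac)
  then show ?thesis by (simp add: dft_matrix_def)
qed

lemma dft_matrix_norm:
  "cmod ((dft_matrix :: complex ^ ('n::{finite,linorder}) ^ ('n::{finite,linorder})) $ m $ k) = 1 / sqrt (real CARD('n))"
  by (simp add: dft_matrix_nth norm_mult norm_divide norm_power)

text \<open>Entry (a, b) of the product is the mean of the powers \<zeta>^0, ..., \<zeta>^(n - 1) of
  an n-th root of unity \<zeta>, which is 1 only for a = b; otherwise the geometric sum
  vanishes.\<close>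

lemma dft_matrix_unitary: "(dft_matrix :: complex ^ ('n::{finite,linorder}) ^ ('n::{finite,linorder}))\<^sup>H ** dft_matrix = mat 1"
proof (rule vec_eq_iff[THEN iffD2], rule allI, rule vec_eq_iff[THEN iffD2], rule allI)
  fix a b :: 'n
  let ?n = "CARD('n)" and ?V = "dft_matrix :: complex ^ ('n::{finite,linorder}) ^ ('n::{finite,linorder})"
  define z where "z k = cis (2 * pi * real (card {..<k}) / real ?n)" for k :: 'n
  have zz: "z k * cnj (z k) = 1" for k
    using complex_norm_square[of "z k"] by (simp add: z_def)
  define \<zeta> where "\<zeta> = z a * cnj (z b)"
  have "(?V\<^sup>H ** ?V) $ a $ b = (\<Sum>m\<in>UNIV. cnj (?V $ m $ a) * ?V $ m $ b)"
    by (simp add: matrix_matrix_mult_def)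
  also have "\<dots> = (\<Sum>m\<in>(UNIV :: 'n set). complex_of_real (1 / real ?n) * \<zeta> ^ card {..<m})"
  proof (rule sum.cong[OF refl])
    fix m :: 'n
    have "complex_of_real (1 / sqrt (real ?n)) * complex_of_real (1 / sqrt (real ?n)) = complex_of_real (1 / real ?n)"
      by (simp add: of_real_mult[symmetric] del: of_real_mult)
    then show "cnj (?V $ m $ a) * ?V $ m $ b = complex_of_real (1 / real ?n) * \<zeta> ^ card {..<m}"
      unfolding dft_matrix_nth z_def[symmetric] \<zeta>_def power_mult_distrib
      by (simp only: complex_cnj_mult complex_cnj_power complex_cnj_cnj complex_cnj_complex_of_real mult_ac)
  qed
  also have "\<dots> = complex_of_real (1 / real ?n) * (\<Sum>j<?n. \<zeta> ^ j)"
    unfolding sum_distrib_left[symmetric]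
    using sum.reindex_bij_betw[OF card_lessThan_bij, of "\<lambda>j. \<zeta> ^ j"] by simp
  also have "\<dots> = mat 1 $ a $ b"
  proof (cases "a = b")
    case True
    then have "\<zeta> = 1" by (simp add: \<zeta>_def zz)
    then show ?thesis using True by (simp add: mat_def)
  next
    case False
    have zn: "z k ^ ?n = 1" for k
    proof -
      have "z k ^ ?n = cis (real ?n * (2 * pi * real (card {..<k}) / real ?n))"
        by (simp only: z_def Complex.DeMoivre)
      also have "\<dots> = cis (2 * pi * real (card {..<k}))" by simp
      also have "\<dots> = 1" by (rule cis_multiple_2pi) simp
      finally show ?thesis .
    qed
    have "\<zeta> \<noteq> 1"
    proof
      assume "\<zeta> = 1"
      have "z a = z a * (cnj (z b) * z b)" using zz[of b] by (simp add: mult.commute)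
      also have "\<dots> = \<zeta> * z b" by (simp add: \<zeta>_def mult.assoc)
      finally have "z a = z b" using \<open>\<zeta> = 1\<close> by simp
      moreover have "card {..<a} \<in> {..<?n}" "card {..<b} \<in> {..<?n}"
        using card_lessThan_bij[where 'n = 'n] by (auto simp: bij_betw_def)
      ultimately have "card {..<a} = card {..<b}"
        using cis_inj_lessThan[of ?n] by (auto simp: z_def inj_on_def)
      then show False using False card_lessThan_bij[where 'n = 'n] by (auto simp: bij_betw_def inj_on_def)
    qed
    moreover have "\<zeta> ^ ?n = 1" by (simp add: \<zeta>_def power_mult_distrib zn flip: complex_cnj_power)
    ultimately have "(\<Sum>j<?n. \<zeta> ^ j) = 0" by (simp add: geometric_sum)
    then show ?thesis using False by (simp add: mat_def)
  qed
  finally show "(?V\<^sup>H ** ?V) $ a $ b = mat 1 $ a $ b" .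
qed

subsection \<open>Precoders\<close>

locale spectral_covariance =
  fixes \<Sigma> W :: "complex ^ 'n ^ 'n" and lam :: "'n \<Rightarrow> real"
  assumes pd: "hermitian_posdef \<Sigma>" and unitary: "unitary W"
    and spec: "\<Sigma> = W ** diag (\<lambda>k. complex_of_real (lam k)) ** W\<^sup>H"
begin

lemma WW: "W\<^sup>H ** W = mat 1" "W ** W\<^sup>H = mat 1"
  using unitary by (simp_all add: unitary_def)

definition D :: "real \<Rightarrow> complex ^ 'n ^ 'n"
  where "D p = diag (\<lambda>k. complex_of_real (lam k powr p))"

text \<open>The real power \<Sigma>^p of the functional calculus, so that products of powers reduce
  to addition of exponents.\<close>

definition spectral_power :: "real \<Rightarrow> complex ^ 'n ^ 'n"
  where "spectral_power p = W ** D p ** W\<^sup>H"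

lemma quadratic_form: "x \<bullet> (\<Sigma> *v x) = (\<Sum>k\<in>UNIV. lam k * (cmod ((W\<^sup>H *v x) $ k))\<^sup>2)"
proof -
  have "cinner x (\<Sigma> *v x) = cinner (W\<^sup>H *v x) (diag (\<lambda>k. complex_of_real (lam k)) *v (W\<^sup>H *v x))"
    by (simp only: spec cinner_ctranspose ctranspose_ctranspose matrix_vector_mul_assoc matrix_mul_assoc)
  also have "\<dots> = (\<Sum>k\<in>UNIV. complex_of_real (lam k * (cmod ((W\<^sup>H *v x) $ k))\<^sup>2))"
    unfolding cinner_def diag_mult_vec
    by (intro sum.cong refl) (simp only: of_real_mult complex_norm_square mult_ac)
  finally have "Re (cinner x (\<Sigma> *v x)) = (\<Sum>k\<in>UNIV. lam k * (cmod ((W\<^sup>H *v x) $ k))\<^sup>2)"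
    by (simp only: Re_sum Re_complex_of_real)
  then show ?thesis by (simp add: Re_cinner)
qed

lemma norm_WH: "norm (W\<^sup>H *v x) = norm x"
proof -
  have "cinner (W\<^sup>H *v x) (W\<^sup>H *v x) = cinner x x"
    by (simp add: cinner_ctranspose matrix_vector_mul_assoc WW)
  then have "(norm (W\<^sup>H *v x))\<^sup>2 = (norm x)\<^sup>2" unfolding cinner_self of_real_eq_iff .
  then show ?thesis by simp
qed

text \<open>Column k of \<open>W\<close> is an eigenvector, and the quadratic form evaluated there
  is \<open>lam k\<close>.\<close>

lemma lam_pos: "lam k > 0"
proof -
  let ?x = "W *v axis k 1"
  have W: "W\<^sup>H *v ?x = axis k 1" by (simp add: matrix_vector_mul_assoc WW)
  then have "?x \<noteq> 0" by (metis axis_eq_0_iff matrix_vector_mult_0_right zero_neq_one)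
  then have "?x \<bullet> (\<Sigma> *v ?x) > 0" using pd by (simp add: hermitian_posdef_def Re_cinner)
  also have "?x \<bullet> (\<Sigma> *v ?x) = (\<Sum>j\<in>UNIV. lam j * (if j = k then 1 else 0))"
    unfolding quadratic_form W by (intro sum.cong refl) (simp add: axis_def)
  also have "\<dots> = lam k" by (simp add: if_distrib cong: if_cong)
  finally show ?thesis .
qed

lemma quadratic_form_ge:
  assumes "\<And>k. l \<le> lam k"
  shows "l * (norm x)\<^sup>2 \<le> x \<bullet> (\<Sigma> *v x)"
proof -
  have "l * (norm x)\<^sup>2 = (\<Sum>k\<in>UNIV. l * (cmod ((W\<^sup>H *v x) $ k))\<^sup>2)"
    unfolding norm_WH[of x, symmetric] by (simp add: norm_vec_def L2_set_def sum_nonneg sum_distrib_left)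
  also have "\<dots> \<le> x \<bullet> (\<Sigma> *v x)"
    unfolding quadratic_form using assms by (intro sum_mono mult_right_mono) auto
  finally show ?thesis .
qed

lemma D_mult: "D p ** D q = D (p + q)"
  by (simp add: D_def diag_mult_diag powr_add)

lemma D_0: "D 0 = mat 1"
  using lam_pos by (simp add: D_def diag_1 less_imp_neq[symmetric] flip: diag_1)

lemma ctranspose_D: "(D p)\<^sup>H = D p"
  unfolding D_def by (rule ctranspose_diag)

lemma spectral_power_mult: "spectral_power p ** spectral_power q = spectral_power (p + q)"
proof -
  have "spectral_power p ** spectral_power q = W ** D p ** (W\<^sup>H ** W) ** D q ** W\<^sup>H"
    by (simp only: spectral_power_def matrix_mul_assoc)
  also have "\<dots> = W ** (D p ** D q) ** W\<^sup>H" by (simp only: WW matrix_mul_rid matrix_mul_assoc)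
  finally show ?thesis by (simp only: D_mult spectral_power_def)
qed

lemma spectral_power_0: "spectral_power 0 = mat 1"
  by (simp add: spectral_power_def D_0 WW)

lemma spectral_power_1: "spectral_power 1 = \<Sigma>"
  using lam_pos by (simp add: spectral_power_def D_def spec less_imp_le abs_of_pos powr_one')

lemma ctranspose_spectral_power: "(spectral_power p)\<^sup>H = spectral_power p"
  by (simp only: spectral_power_def ctranspose_mult ctranspose_D ctranspose_ctranspose matrix_mul_assoc)

lemma inverse_\<Sigma>: "matrix_inv \<Sigma> = spectral_power (-1)"
  by (rule matrix_inv_eqI) (simp add: spectral_power_mult spectral_power_0 flip: spectral_power_1)

lemma trace_spectral_power: "trace (spectral_power p) = complex_of_real (\<Sum>k\<in>UNIV. lam k powr p)"
proof -
  have "trace (spectral_power p) = trace (W\<^sup>H ** (W ** D p))"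
    unfolding spectral_power_def by (rule trace_mult_commute)
  also have "\<dots> = trace (D p)" by (simp only: matrix_mul_assoc WW matrix_mul_lid)
  also have "\<dots> = complex_of_real (\<Sum>k\<in>UNIV. lam k powr p)" by (simp add: trace_def D_def diag_def)
  finally show ?thesis .
qed

text \<open>Cauchy--Schwarz for \<open>tr \<Sigma>\<^sup>-\<^sup>1\<^sup>/\<^sup>2 = tr (F (F\<^sup>-\<^sup>1 \<Sigma>\<^sup>-\<^sup>1\<^sup>/\<^sup>2))\<close>.\<close>

lemma sum_noise_gain_ge:
  assumes F: "invertible F" and tr: "trace (F\<^sup>H ** F) = 1"
  shows "(\<Sum>k\<in>UNIV. lam k powr (-1/2))\<^sup>2 \<le> (\<Sum>k\<in>UNIV. noise_gain \<Sigma> F k)"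
proof -
  define K where "K = matrix_inv F ** spectral_power (-1/2)"
  have "K ** K\<^sup>H = matrix_inv F ** (spectral_power (-1/2) ** spectral_power (-1/2)) ** (matrix_inv F)\<^sup>H"
    by (simp only: K_def ctranspose_mult ctranspose_spectral_power matrix_mul_assoc)
  then have KK: "K ** K\<^sup>H = matrix_inv F ** matrix_inv \<Sigma> ** (matrix_inv F)\<^sup>H"
    by (simp add: spectral_power_mult inverse_\<Sigma>)
  have gain: "(\<Sum>k\<in>UNIV. noise_gain \<Sigma> F k) = (norm (K\<^sup>H))\<^sup>2"
    by (simp add: norm_sq_trace KK noise_gain_def trace_def)
  have "F ** K = spectral_power (-1/2)"
    by (simp only: K_def matrix_mul_assoc matrix_inv_cancel[OF F] matrix_mul_lid)
  then have "(\<Sum>k\<in>UNIV. lam k powr (-1/2)) = F \<bullet> K\<^sup>H"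
    using Re_trace_mult[of F K] by (simp add: trace_spectral_power)
  also have "\<dots> \<le> norm F * norm (K\<^sup>H)" by (rule norm_cauchy_schwarz)
  \<comment> \<open>The power constraint says that the Frobenius norm of \<open>F\<close> is
    1.\<close>
  also have "norm F = 1"
  proof -
    have "(norm F)\<^sup>2 = 1" by (simp add: norm_sq_trace tr)
    then show ?thesis by (intro power2_eq_imp_eq[of "norm F" 1]) simp_all
  qed
  finally have "(\<Sum>k\<in>UNIV. lam k powr (-1/2)) \<le> norm (K\<^sup>H)" by simp
  then show ?thesis unfolding gain by (intro power_mono sum_nonneg) auto
qed

text \<open>Let Q be the inverse of F^H \<Sigma> F and y its column k, so that x is the k-th entry
  of y. Then x = y^H F^H \<Sigma> F y \<ge> l |F y|^2 \<ge> |y|^2 / T \<ge> x^2 / T, and dividing by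
  x > 0 gives the bound. In this way no eigenvalues of an inverse have to be compared.\<close>

lemma noise_gain_le:
  assumes F: "invertible F" and l: "\<And>k. l \<le> lam k" "l > 0" and T: "T > 0"
    and \<zeta>: "min_eigenvalue (F\<^sup>H ** F) \<ge> 1 / (l * T)"
  shows "noise_gain \<Sigma> F k \<le> T"
proof -
  define x where "x = noise_gain \<Sigma> F k"
  have x: "x > 0" unfolding x_def using pd F by (rule noise_gain_pos)
  define Q where "Q = matrix_inv F ** matrix_inv \<Sigma> ** (matrix_inv F)\<^sup>H"
  define y where "y = Q *v axis k 1"
  have yk: "Re (y $ k) = x"
    by (simp add: y_def x_def noise_gain_def Q_def matrix_vector_mult_def axis_def if_distrib cong: if_cong)
  note iF = matrix_inv_cancel[OF F] and iS = matrix_inv_cancel[OF posdef_invertible[OF pd]]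
  have iFH: "F\<^sup>H ** (matrix_inv F)\<^sup>H = mat 1"
    by (simp only: ctranspose_mult[symmetric] iF ctranspose_mat_1)
  have "F\<^sup>H ** \<Sigma> ** F ** Q = F\<^sup>H ** (\<Sigma> ** (F ** matrix_inv F) ** matrix_inv \<Sigma>) ** (matrix_inv F)\<^sup>H"
    by (simp only: Q_def matrix_mul_assoc)
  also have "\<dots> = mat 1" by (simp only: iF iS matrix_mul_rid iFH)
  finally have "F\<^sup>H *v (\<Sigma> *v (F *v y)) = axis k 1"
    by (simp add: y_def matrix_vector_mul_assoc matrix_mul_assoc)
  then have "x = Re (cinner y (F\<^sup>H *v (\<Sigma> *v (F *v y))))"
    by (simp add: yk[symmetric] cinner_def axis_def if_distrib cong: if_cong)
  also have "\<dots> = (F *v y) \<bullet> (\<Sigma> *v (F *v y))"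
    by (simp add: Re_cinner[symmetric] cinner_ctranspose)
  finally have "x = (F *v y) \<bullet> (\<Sigma> *v (F *v y))" .
  also have "\<dots> \<ge> l * (norm (F *v y))\<^sup>2" by (rule quadratic_form_ge[OF l(1)])
  finally have 1: "l * (norm (F *v y))\<^sup>2 \<le> x" .
  have "x\<^sup>2 \<le> (norm y)\<^sup>2"
  proof -
    have "x \<le> cmod (y $ k)" unfolding yk[symmetric] by (rule complex_Re_le_cmod)
    also have "\<dots> \<le> norm y" by (rule Finite_Cartesian_Product.norm_nth_le)
    finally show ?thesis using x by (intro power_mono) auto
  qed
  then have "1 / (l * T) * x\<^sup>2 \<le> min_eigenvalue (F\<^sup>H ** F) * (norm y)\<^sup>2"
    using \<zeta> l(2) T by (intro mult_mono) (auto intro: order_trans[rotated])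
  also have "\<dots> \<le> y \<bullet> ((F\<^sup>H ** F) *v y)"
    by (rule min_eigenvalue_le_Rayleigh) (simp add: ctranspose_mult)
  also have "\<dots> = (norm (F *v y))\<^sup>2"
    by (simp add: Re_cinner[symmetric] matrix_vector_mul_assoc[symmetric] cinner_ctranspose'[of y] cinner_self)
  finally have "l * (1 / (l * T) * x\<^sup>2) \<le> l * (norm (F *v y))\<^sup>2" using l(2) by (intro mult_left_mono) auto
  then have "x\<^sup>2 / T \<le> x" using 1 l(2) by simp
  then have "x * x \<le> T * x" using T by (simp add: power2_eq_square field_simps)
  then show ?thesis using x by (simp add: x_def)
qed

end

text \<open>The exponent -1/4 makes F F^H proportional to \<Sigma>^(-1/2), the equality case of
  Cauchy--Schwarz. What is left of the inverse of F^H \<Sigma> F is V^H \<Lambda>^(-1/2) V times the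
  trace factor, and since all entries of V have squared modulus 1 / n, every diagonal entry averages
  the numbers \<open>lam i powr (-1/2)\<close>.\<close>

lemma opt_precoder_noise_gain:
  fixes \<Sigma> W :: "complex ^ ('n::{finite,linorder}) ^ ('n::{finite,linorder})"
  assumes "spectral_covariance \<Sigma> W lam"
  shows "invertible (opt_precoder W lam)"
    and "noise_gain \<Sigma> (opt_precoder W lam) k = (\<Sum>k\<in>UNIV. lam k powr (-1/2))\<^sup>2 / real CARD('n)"
proof -
  interpret spectral_covariance \<Sigma> W lam by (rule assms)
  let ?V = "dft_matrix :: complex ^ ('n::{finite,linorder}) ^ ('n::{finite,linorder})"
  define \<tau> where "\<tau> = (\<Sum>k\<in>UNIV. lam k powr (-1/2))"
  have \<tau>: "\<tau> > 0" unfolding \<tau>_def by (intro sum_pos) (auto simp: less_imp_neq[OF lam_pos, symmetric])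
  have F: "opt_precoder W lam = (1 / sqrt \<tau>) *\<^sub>R (W ** D (-1/4) ** ?V)"
    by (simp add: opt_precoder_def D_def \<tau>_def trace_def diag_def)
  \<comment> \<open>The inverse of the precoder, factor by factor in reverse order.\<close>
  define G where "G = sqrt \<tau> *\<^sub>R (?V\<^sup>H ** D (1/4) ** W\<^sup>H)"
  have "?V\<^sup>H ** D (1/4) ** W\<^sup>H ** (W ** D (-1/4) ** ?V) = ?V\<^sup>H ** (D (1/4) ** (W\<^sup>H ** W) ** D (-1/4)) ** ?V"
    by (simp only: matrix_mul_assoc)
  also have "\<dots> = mat 1"
    by (simp add: WW D_mult D_0 dft_matrix_unitary)
  finally have GF: "G ** opt_precoder W lam = mat 1"
    using \<tau> by (simp add: F G_def matrix_mult_scaleR)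
  then show "invertible (opt_precoder W lam)" using invertible_left_inverse by blast
  have inv: "matrix_inv (opt_precoder W lam) = G" using GF by (rule matrix_inv_eqI)
  have "G ** matrix_inv \<Sigma> ** G\<^sup>H = \<tau> *\<^sub>R (?V\<^sup>H ** D (1/4) ** W\<^sup>H ** (W ** D (-1) ** W\<^sup>H) ** (W ** D (1/4) ** ?V))"
    using \<tau> by (simp add: G_def inverse_\<Sigma> spectral_power_def matrix_mult_scaleR ctranspose_scaleR ctranspose_mult ctranspose_D matrix_mul_assoc)
  also have "?V\<^sup>H ** D (1/4) ** W\<^sup>H ** (W ** D (-1) ** W\<^sup>H) ** (W ** D (1/4) ** ?V) =
      ?V\<^sup>H ** (D (1/4) ** (W\<^sup>H ** W) ** D (-1) ** (W\<^sup>H ** W) ** D (1/4)) ** ?V"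
    by (simp only: matrix_mul_assoc)
  also have "\<dots> = ?V\<^sup>H ** D (-1/2) ** ?V"
    by (simp add: WW D_mult)
  finally have "noise_gain \<Sigma> (opt_precoder W lam) k = \<tau> * Re ((?V\<^sup>H ** (D (-1/2) ** ?V)) $ k $ k)"
    by (simp add: noise_gain_def inv matrix_mul_assoc)
  also have "(?V\<^sup>H ** (D (-1/2) ** ?V)) $ k $ k = (\<Sum>i\<in>UNIV. cnj (?V $ i $ k) * (complex_of_real (lam i powr (-1/2)) * ?V $ i $ k))"
    unfolding ctranspose_mult_nth column_mult cinner_def D_def diag_mult_vec by (simp add: column_def)
  also have "\<dots> = (\<Sum>i\<in>UNIV. complex_of_real (lam i powr (-1/2) / real CARD('n)))"
  proof (rule sum.cong[OF refl])
    fix i :: 'n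
    have "?V $ i $ k * cnj (?V $ i $ k) = complex_of_real (1 / real CARD('n))"
      unfolding complex_norm_square[symmetric] dft_matrix_norm by (simp add: power_divide)
    then have "complex_of_real (lam i powr (-1/2)) * (?V $ i $ k * cnj (?V $ i $ k)) = complex_of_real (lam i powr (-1/2) / real CARD('n))"
      by simp
    then show "cnj (?V $ i $ k) * (complex_of_real (lam i powr (-1/2)) * ?V $ i $ k) = complex_of_real (lam i powr (-1/2) / real CARD('n))"
      by (simp only: mult_ac)
  qed
  also have "Re \<dots> = \<tau> / real CARD('n)"
    by (simp only: Re_sum Re_complex_of_real \<tau>_def sum_divide_distrib)
  finally show "noise_gain \<Sigma> (opt_precoder W lam) k = (\<Sum>k\<in>UNIV. lam k powr (-1/2))\<^sup>2 / real CARD('n)"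
    by (simp add: \<tau>_def power2_eq_square)
qed

theorem theorem1:
  fixes \<Omega> :: "'w measure"
    and H :: "'w \<Rightarrow> complex ^ ('n::{finite,linorder}) ^ ('m::finite)"
    and s :: "'w \<Rightarrow> complex ^ ('n::{finite,linorder})"
    and \<xi> :: "'w \<Rightarrow> complex ^ 'm"
    and \<Sigma> W :: "complex ^ ('n::{finite,linorder}) ^ ('n::{finite,linorder})"
    and lam :: "'n::{finite,linorder} \<Rightarrow> real"
    and \<sigma> \<eta> T :: real
    and md :: modulation
    and M :: nat
    and S :: "complex set"
  assumes "prob_space \<Omega>"
    and "CARD('n) < CARD('m)"
    \<comment> \<open>channel: i.i.d. Gaussian rows with covariance \<open>\<Sigma>\<close>\<close>
    and "hermitian_posdef \<Sigma>"
    and "prob_space.indep_vars \<Omega> (\<lambda>_. borel) (\<lambda>m \<omega>. row m (H \<omega>)) UNIV"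
    and "\<And>m. circ_gaussian \<Omega> (\<lambda>\<omega>. row m (H \<omega>))"
    and "\<And>m i k. (\<integral>\<omega>. cnj (row m (H \<omega>) $ i) * row m (H \<omega>) $ k \<partial>\<Omega>) = \<Sigma> $ i $ k"
    \<comment> \<open>noise with covariance \<open>\<sigma>\<^sup>2 I\<close>, SNR \<open>\<eta>\<close>\<close>
    and "\<sigma> > 0"
    and "circ_gaussian \<Omega> \<xi>"
    and "\<And>i k. (\<integral>\<omega>. \<xi> \<omega> $ i * cnj (\<xi> \<omega> $ k) \<partial>\<Omega>) = complex_of_real (\<sigma>\<^sup>2) * mat 1 $ i $ k"
    and "\<eta> = 1 / \<sigma>\<^sup>2"
    \<comment> \<open>i.i.d. symbols, uniform on the constellation\<close>
    and "valid_order md M"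
    and "S = constellation md M"
    and "prob_space.indep_vars \<Omega> (\<lambda>_. borel) (\<lambda>k \<omega>. s \<omega> $ k) UNIV"
    and "\<And>k c. c \<in> S \<Longrightarrow> measure \<Omega> {\<omega> \<in> space \<Omega>. s \<omega> $ k = c} = 1 / real M"
    and "prob_space.indep_three \<Omega> H s \<xi>"
    \<comment> \<open>eigenvalue decomposition of \<open>\<Sigma>\<close>, eigenvalues in increasing order\<close>
    and "unitary W"
    and "\<Sigma> = W ** diag (\<lambda>k. complex_of_real (lam k)) ** W\<^sup>H"
    and "mono lam"
    and "T = T_threshold md M CARD('m) CARD('n) \<eta>"
  shows "(\<forall>F.
            invertible F \<and> trace (F\<^sup>H ** F) = 1 \<and>
            min_eigenvalue (F\<^sup>H ** F) \<ge> 1 / (lam (Min UNIV) * T) \<longrightarrow>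
            average_sep \<Omega> H s \<xi> S F \<ge> average_sep \<Omega> H s \<xi> S (opt_precoder W lam))
       \<and> average_sep \<Omega> H s \<xi> S (opt_precoder W lam)
           = G_fun md M CARD('m) CARD('n) \<eta>
               ((\<Sum>k\<in>UNIV. lam k powr (-1/2))\<^sup>2 / real CARD('n))"
proof -
  note nm = assms(2) and \<Sigma> = assms(3) and \<sigma> = assms(7) and \<eta> = assms(10) and v = assms(11) and S = assms(12)
  interpret spectral_covariance \<Sigma> W lam
    by (rule spectral_covariance.intro[OF assms(3,16,17)])
  let ?G = "G_fun md M CARD('m) CARD('n) \<eta>"
  have \<eta>0: "\<eta> > 0" using \<sigma> \<eta> by simp
  \<comment> \<open>From here on the random quantities enter only through the gains; the remaining
    argument is a deterministic optimization over \<open>F\<close>.\<close>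
  have sep: "average_sep \<Omega> H s \<xi> S F = 1 / real CARD('n) * (\<Sum>k\<in>UNIV. ?G (noise_gain \<Sigma> F k))"
    if F: "invertible F" for F
    unfolding average_sep_def S \<eta>
    using symbol_error_probability[OF assms(1) less_imp_le[OF nm] assms(4-6) \<Sigma> \<sigma> assms(8,9) v
        assms(14)[unfolded S] assms(15) F]
    by simp
  let ?x = "(\<Sum>k\<in>UNIV. lam k powr (-1/2))\<^sup>2 / real CARD('n)"
  note opt = opt_precoder_noise_gain[OF spectral_covariance_axioms]
  have opt_sep: "average_sep \<Omega> H s \<xi> S (opt_precoder W lam) = ?G ?x"
    by (simp add: sep[OF opt(1)] opt(2))
  have x: "?x > 0"
  proof -
    have "(\<Sum>k\<in>UNIV. lam k powr (-1/2)) > 0" by (intro sum_pos) (auto simp: less_imp_neq[OF lam_pos, symmetric])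
    then show ?thesis by simp
  qed
  have T: "T > 0"
  proof -
    have "T = mod_gain md M * \<eta> * (real CARD('m) - real CARD('n)) / 2"
      unfolding assms(19) by (cases md) simp_all
    moreover have "0 < mod_gain md M * \<eta> * (real CARD('m) - real CARD('n))"
      using mod_gain_pos[OF v] \<eta>0 nm by (intro mult_pos_pos) auto
    ultimately show ?thesis by simp
  qed
  \<comment> \<open>The least index carries the smallest eigenvalue because \<open>lam\<close> is
    monotone.\<close>
  have lmin: "lam (Min UNIV) \<le> lam k" for k
    using assms(18) by (intro monoD[of lam]) auto
  have "?G ?x \<le> average_sep \<Omega> H s \<xi> S F"
    if F: "invertible F" "trace (F\<^sup>H ** F) = 1" "min_eigenvalue (F\<^sup>H ** F) \<ge> 1 / (lam (Min UNIV) * T)" for F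
    unfolding sep[OF F(1)]
  proof (rule G_fun_average_mono[OF v nm \<eta>0])
    show "0 < noise_gain \<Sigma> F k" for k using \<Sigma> F(1) by (rule noise_gain_pos)
    show "noise_gain \<Sigma> F k \<le> T_threshold md M CARD('m) CARD('n) \<eta>" for k
      using noise_gain_le[OF F(1) lmin lam_pos T F(3)] by (simp add: assms(19))
    show "real CARD('n) * ?x \<le> (\<Sum>k\<in>UNIV. noise_gain \<Sigma> F k)"
      using sum_noise_gain_ge[OF F(1,2)] by simp
  qed (rule x)
  then show ?thesis unfolding opt_sep by blast
qed

end
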